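(* Let $X$ be a Banach algebra and $x\in X$ regular. There exists a unique vector projection family $\mu^{x}=\{\mu^x_\Lambda\mid\Lambda\in X^{\ast}\}$ in $\sigma(x)$ such that $$f(x)=\int_{\sigma(x)}f\,d\mu^{x}$$ for each $f\in C(\sigma(x))$, i.e. $\Lambda(f(x))=\int_{\sigma(x)}f\,d\mu^x_\Lambda$ for each $\Lambda\in X^{\ast}$ and $f\in C(\sigma(x))$. In particular, $$x=\int_{\sigma(x)}\mathrm{Id}\,d\mu^{x}=\int_{\sigma(x)}\lambda\,d\mu^{x}(\lambda),$$ where $x$ is identified with its canonical image in $X^{\ast\ast}$.
   Context: Banach algebras are complex and unital. For $x\in X$, $R_x(\lambda)=(\lambda 1-x)^{-1}$ is the resolvent function on $\mathbb{C}\setminus\sigma(x)$. $\ell$ is Lebesgue measure on $\mathbb{C}$, and $\partial_{z^{\ast}}=\frac12(\partial_x+i\partial_y)$. A function $g$ from a measure space $(S,\Sigma,\mu)$ into $X$ is Dunford integrable if $\Lambda\circ g\in L^1(\mu)$ for each $\Lambda\in X^{\ast}$; its Dunford integral $D\int g\,d\mu\in X^{\ast\ast}$ is $\Lambda\mapsto\int\Lambda\circ g\,d\mu$. The element $x$ is regular if for every precompact neighborhood $U$ of $\sigma(x)$ the function $R_x$ is Dunford integrable on $U\setminus\sigma(x)$ with respect to $\ell$. Smooth Functional Calculus: for $x$ regular, $f$ a $C^\infty$ complex function on a neighborhood $\mathrm{Dom}\,f$ of $\sigma(x)$, and $\gamma$ a smooth curve (possibly with several components, positively oriented, bounding a bounded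 open region $\mathrm{int}\,\gamma$) with $\sigma(x)\subset\mathrm{int}\,\gamma$ and $\gamma\cup\mathrm{int}\,\gamma\subset\mathrm{Dom}\,f$, define $f(x)\in X^{\ast\ast}$ by $$f(x)=\frac{1}{2\pi i}D\int_{\gamma}fR_x\,d\gamma-\frac1\pi D\int_{\mathrm{int}\,\gamma\setminus\sigma(x)}\partial_{z^{\ast}}f\,R_x\,d\ell,$$ where $d\gamma$ is the complex line element along $\gamma$; this is independent of $\gamma$. One writes $\Lambda(f(x))$ for $f(x)(\Lambda)$. Continuous Functional Calculus: for $f\in C(\sigma(x))$, $f(x)\in X^{\ast\ast}$ is defined by $\Lambda(f(x))=\lim_n\Lambda(f_n(x))$ for $\Lambda\in X^{\ast}$, where $F$ is a continuous extension of $f$ to an open neighborhood $\Omega$ of $\sigma(x)$ and $f_n\in C^\infty(\Omega)$ converge uniformly to $F$ on $\Omega$ (the limit exists and does not depend on the choices). A vector projection family on a measurable space $(S,\Sigma)$ (for a Banach space $X$) is a family of complex measures $\mu=\{\mu_\Lambda\mid\Lambda\in X^{\ast}\}$ on $(S,\Sigma)$ such that $\Lambda\mapsto\mu_\Lambda$ is linear and, whenever a net $\Lambda_i\to\Lambda$ in $X^{\ast}$, $\mu_{\Lambda_i}\to\mu_\Lambda$ setwise (i.e. $\mu_{\Lambda_i}(E)\to\mu_\Lambda(E)$ for every $E\in\Sigma$). Its integral $\int f\,d\mu\in X^{\ast\ast}$ is $\Lambda\mapsto\int f\,d\mu_\Lambda$. On $\sigma(x)$ the Borel $\sigma$-algebra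 is used.
   Formalization: Well-definedness of the continuous calculus (the limit of Λ(f_n(x)) exists and is independent of the choices) is assumed in addition to x being regular; it fails for some regular x, e.g. x(t)=t in the algebra of α-Hölder functions on [0,1], 0<α<1. *)

theory Defs
  imports "HOL-Complex_Analysis.Complex_Analysis"
begin

section \<open>Complex unital Banach algebras and their duals\<close>

class complex_banach_algebra = real_normed_algebra_1 + banach +
  fixes scaleC :: "complex \<Rightarrow> 'a \<Rightarrow> 'a"  (infixr \<open>*\<^sub>C\<close> 75)
  assumes scaleC_add_right: "c *\<^sub>C (a + b) = c *\<^sub>C a + c *\<^sub>C b"
    and scaleC_add_left: "(c + d) *\<^sub>C a = c *\<^sub>C a + d *\<^sub>C a"
    and scaleC_scaleC: "c *\<^sub>C d *\<^sub>C a = (c * d) *\<^sub>C a"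
    and scaleC_of_real: "complex_of_real r *\<^sub>C a = r *\<^sub>R a"
    and mult_scaleC_left: "(c *\<^sub>C a) * b = c *\<^sub>C (a * b)"
    and mult_scaleC_right: "a * (c *\<^sub>C b) = c *\<^sub>C (a * b)"
    and norm_scaleC: "norm (c *\<^sub>C a) = cmod c * norm a"

text \<open>The dual consists of the complex-linear elements of the type of bounded real-linear maps
  into \<^typ>\<open>complex\<close>; it carries the operator norm and its topology.  An element of the bidual is
  represented by its values on the dual.\<close>

definition cdual :: "('a::complex_banach_algebra \<Rightarrow>\<^sub>L complex) set" where
  "cdual = {\<Lambda>. \<forall>c a. blinfun_apply \<Lambda> (c *\<^sub>C a) = c * blinfun_apply \<Lambda> a}"

definition cdual_scale ::
    "complex \<Rightarrow> ('a::complex_banach_algebra \<Rightarrow>\<^sub>L complex) \<Rightarrow> ('a \<Rightarrow>\<^sub>L complex)" where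
  "cdual_scale c \<Lambda> = blinfun_mult_right c o\<^sub>L \<Lambda>"

definition spectrum :: "'a::complex_banach_algebra \<Rightarrow> complex set" where
  "spectrum x = {z. \<not> (\<exists>y. (z *\<^sub>C 1 - x) * y = 1 \<and> y * (z *\<^sub>C 1 - x) = 1)}"

definition resolvent :: "'a::complex_banach_algebra \<Rightarrow> complex \<Rightarrow> 'a" where
  "resolvent x z = (THE y. (z *\<^sub>C 1 - x) * y = 1 \<and> y * (z *\<^sub>C 1 - x) = 1)"


section \<open>Dunford integrals and regular elements\<close>

definition dunford_integrable_on ::
    "('s \<Rightarrow> 'a::complex_banach_algebra) \<Rightarrow> 's measure \<Rightarrow> 's set \<Rightarrow> bool" where
  "dunford_integrable_on g M A \<longleftrightarrow> (\<forall>\<Lambda>\<in>cdual. set_integrable M A (\<lambda>s. blinfun_apply \<Lambda> (g s)))"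

definition dunford_integral ::
    "'s measure \<Rightarrow> 's set \<Rightarrow> ('s \<Rightarrow> 'a::complex_banach_algebra) \<Rightarrow> ('a \<Rightarrow>\<^sub>L complex) \<Rightarrow> complex" where
  "dunford_integral M A g \<Lambda> = set_lebesgue_integral M A (\<lambda>s. blinfun_apply \<Lambda> (g s))"

definition regular_element :: "'a::complex_banach_algebra \<Rightarrow> bool" where
  "regular_element x \<longleftrightarrow>
     (\<forall>U. U \<in> sets lebesgue \<and> spectrum x \<subseteq> interior U \<and> compact (closure U) \<longrightarrow>
        dunford_integrable_on (resolvent x) lebesgue (U - spectrum x))"


section \<open>Smooth functions and smooth closed curves\<close>

primrec Ck_on ::
    "nat \<Rightarrow> 'b::real_normed_vector set \<Rightarrow> ('b \<Rightarrow> 'c::real_normed_vector) \<Rightarrow> bool" where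
  "Ck_on 0 S f \<longleftrightarrow> continuous_on S f"
| "Ck_on (Suc k) S f \<longleftrightarrow>
     (\<forall>p\<in>S. f differentiable (at p)) \<and> (\<forall>v. Ck_on k S (\<lambda>p. frechet_derivative f (at p) v))"

text \<open>For open \<open>S\<close>.  Differentiability is over the reals, also when the domain is \<^typ>\<open>complex\<close>.\<close>

definition smooth_on :: "'b::real_normed_vector set \<Rightarrow> ('b \<Rightarrow> 'c::real_normed_vector) \<Rightarrow> bool" where
  "smooth_on S f \<longleftrightarrow> (\<forall>k. Ck_on k S f)"

definition dbar :: "(complex \<Rightarrow> complex) \<Rightarrow> complex \<Rightarrow> complex" where
  "dbar f z = (frechet_derivative f (at z) 1 + \<i> * frechet_derivative f (at z) \<i>) / 2"

definition smooth_closed_curve :: "(real \<Rightarrow> complex) \<Rightarrow> bool" where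
  "smooth_closed_curve g \<longleftrightarrow>
     smooth_on UNIV g \<and> (\<forall>t. g (t + 1) = g t) \<and> (\<forall>t. vector_derivative g (at t) \<noteq> 0) \<and>
     simple_path g"

text \<open>A curve with several components is the list of its components.\<close>

definition curve_image :: "(real \<Rightarrow> complex) list \<Rightarrow> complex set" where
  "curve_image \<gamma> = (\<Union>g\<in>set \<gamma>. path_image g)"

definition curve_winding :: "(real \<Rightarrow> complex) list \<Rightarrow> complex \<Rightarrow> complex" where
  "curve_winding \<gamma> z = (\<Sum>g\<leftarrow>\<gamma>. winding_number g z)"

definition curve_int :: "(real \<Rightarrow> complex) list \<Rightarrow> complex set" where
  "curve_int \<gamma> = {z. z \<notin> curve_image \<gamma> \<and> curve_winding \<gamma> z = 1}"

text \<open>Positive orientation means that the curve winds once around each point of the region it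
  bounds and not around the points outside.  As the winding number jumps by one across each
  component and vanishes near infinity, the region is then open and bounded, with the curve as
  its frontier.\<close>

definition bounding_curve :: "(real \<Rightarrow> complex) list \<Rightarrow> bool" where
  "bounding_curve \<gamma> \<longleftrightarrow>
     (\<forall>g\<in>set \<gamma>. smooth_closed_curve g) \<and>
     (\<forall>i<length \<gamma>. \<forall>j<i. path_image (\<gamma> ! i) \<inter> path_image (\<gamma> ! j) = {}) \<and>
     (\<forall>z. z \<notin> curve_image \<gamma> \<longrightarrow> curve_winding \<gamma> z \<in> {0, 1})"


section \<open>Smooth and continuous functional calculus\<close>

definition smooth_calculus_curve ::
    "'a::complex_banach_algebra \<Rightarrow> complex set \<Rightarrow> (real \<Rightarrow> complex) list \<Rightarrow> bool" where
  "smooth_calculus_curve x D \<gamma> \<longleftrightarrow>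
     bounding_curve \<gamma> \<and> spectrum x \<subseteq> curve_int \<gamma> \<and> curve_image \<gamma> \<union> curve_int \<gamma> \<subseteq> D"

definition smooth_calculus_formula ::
    "'a::complex_banach_algebra \<Rightarrow> (real \<Rightarrow> complex) list \<Rightarrow> (complex \<Rightarrow> complex) \<Rightarrow>
     ('a \<Rightarrow>\<^sub>L complex) \<Rightarrow> complex" where
  "smooth_calculus_formula x \<gamma> f \<Lambda> =
     1 / (2 * of_real pi * \<i>) *
       (\<Sum>g\<leftarrow>\<gamma>. contour_integral g (\<lambda>z. blinfun_apply \<Lambda> (f z *\<^sub>C resolvent x z)))
     - 1 / of_real pi *
       dunford_integral lebesgue (curve_int \<gamma> - spectrum x) (\<lambda>z. dbar f z *\<^sub>C resolvent x z) \<Lambda>"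

text \<open>\<open>D\<close> is the domain of \<open>f\<close>.  For regular \<open>x\<close> the value does not depend on the curve chosen.\<close>

definition smooth_calculus ::
    "'a::complex_banach_algebra \<Rightarrow> complex set \<Rightarrow> (complex \<Rightarrow> complex) \<Rightarrow>
     ('a \<Rightarrow>\<^sub>L complex) \<Rightarrow> complex" where
  "smooth_calculus x D f = smooth_calculus_formula x (SOME \<gamma>. smooth_calculus_curve x D \<gamma>) f"

definition smooth_approximation ::
    "'a::complex_banach_algebra \<Rightarrow> (complex \<Rightarrow> complex) \<Rightarrow> complex set \<Rightarrow> (complex \<Rightarrow> complex) \<Rightarrow>
     (nat \<Rightarrow> complex \<Rightarrow> complex) \<Rightarrow> bool" where
  "smooth_approximation x f \<Omega> F h \<longleftrightarrow>
     open \<Omega> \<and> spectrum x \<subseteq> \<Omega> \<and> continuous_on \<Omega> F \<and> (\<forall>z\<in>spectrum x. F z = f z) \<and>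
     (\<forall>n. smooth_on \<Omega> (h n)) \<and> uniform_limit \<Omega> h F sequentially"

definition continuous_calculus_limit ::
    "'a::complex_banach_algebra \<Rightarrow> (complex \<Rightarrow> complex) \<Rightarrow> ('a \<Rightarrow>\<^sub>L complex) \<Rightarrow> complex \<Rightarrow> bool" where
  "continuous_calculus_limit x f \<Lambda> L \<longleftrightarrow>
     (\<forall>\<Omega> F h. smooth_approximation x f \<Omega> F h \<longrightarrow>
        (\<lambda>n. smooth_calculus x \<Omega> (h n) \<Lambda>) \<longlonglongrightarrow> L)"

definition continuous_calculus ::
    "'a::complex_banach_algebra \<Rightarrow> (complex \<Rightarrow> complex) \<Rightarrow> ('a \<Rightarrow>\<^sub>L complex) \<Rightarrow> complex" where
  "continuous_calculus x f \<Lambda> = (THE L. continuous_calculus_limit x f \<Lambda> L)"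

text \<open>The limits defining the continuous functional calculus of \<open>x\<close> exist and do not depend on the
  choices.  Regularity alone does not imply this: the function \<open>t\<close> in the algebra of
  \<open>\<alpha>\<close>-Hoelder functions on the unit interval, \<open>0 < \<alpha> < 1\<close>, is regular, but the smooth functions
  \<open>n powr - \<beta> * sin (n * t)\<close>, \<open>0 < \<beta> < \<alpha>\<close>, tend to zero uniformly and are unbounded in the
  algebra, hence do not converge weakly.\<close>

definition continuous_calculus_well_defined :: "'a::complex_banach_algebra \<Rightarrow> bool" where
  "continuous_calculus_well_defined x \<longleftrightarrow>
     (\<forall>f. \<forall>\<Lambda>\<in>cdual. continuous_on (spectrum x) f \<longrightarrow> (\<exists>L. continuous_calculus_limit x f \<Lambda> L))"


section \<open>Complex measures and vector projection families\<close>

text \<open>Only the space and the sigma-algebra of \<open>M\<close> matter.  Complex measures, and families of them,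
  are extensional, so that equality of functions is equality on the relevant arguments.\<close>

definition complex_measures :: "'s measure \<Rightarrow> ('s set \<Rightarrow> complex) set" where
  "complex_measures M =
     {\<nu> \<in> extensional (sets M). \<forall>A :: nat \<Rightarrow> 's set.
        range A \<subseteq> sets M \<longrightarrow> disjoint_family A \<longrightarrow> (\<lambda>n. \<nu> (A n)) sums \<nu> (\<Union>n. A n)}"

text \<open>The positive part in the Jordan decomposition of a real measure \<open>\<rho>\<close>: the value at \<open>E\<close> is
  the supremum of \<open>\<rho>\<close> over the measurable subsets of \<open>E\<close> (\<^const>\<open>ennreal\<close> maps negative numbers
  to zero, and the empty set is always a candidate).\<close>

definition jordan_pos :: "'s measure \<Rightarrow> ('s set \<Rightarrow> real) \<Rightarrow> 's measure" where
  "jordan_pos M \<rho> =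
     measure_of (space M) (sets M) (\<lambda>E. SUP B\<in>{B \<in> sets M. B \<subseteq> E}. ennreal (\<rho> B))"

definition complex_measure_integral ::
    "'s measure \<Rightarrow> ('s set \<Rightarrow> complex) \<Rightarrow> ('s \<Rightarrow> complex) \<Rightarrow> complex" where
  "complex_measure_integral M \<nu> f =
     (integral\<^sup>L (jordan_pos M (\<lambda>E. Re (\<nu> E))) f - integral\<^sup>L (jordan_pos M (\<lambda>E. - Re (\<nu> E))) f)
     + \<i> * (integral\<^sup>L (jordan_pos M (\<lambda>E. Im (\<nu> E))) f - integral\<^sup>L (jordan_pos M (\<lambda>E. - Im (\<nu> E))) f)"

text \<open>Convergence of the measures along convergent nets of functionals, evaluated at a measurable
  set, is continuity on the dual (with its norm topology).\<close>

definition vector_projection_family ::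
    "'s measure \<Rightarrow> (('a::complex_banach_algebra \<Rightarrow>\<^sub>L complex) \<Rightarrow> 's set \<Rightarrow> complex) \<Rightarrow> bool" where
  "vector_projection_family M \<mu> \<longleftrightarrow>
     \<mu> \<in> cdual \<rightarrow>\<^sub>E complex_measures M \<and>
     (\<forall>\<Lambda>\<in>cdual. \<forall>\<Lambda>'\<in>cdual. \<forall>E\<in>sets M. \<mu> (\<Lambda> + \<Lambda>') E = \<mu> \<Lambda> E + \<mu> \<Lambda>' E) \<and>
     (\<forall>c. \<forall>\<Lambda>\<in>cdual. \<forall>E\<in>sets M. \<mu> (cdual_scale c \<Lambda>) E = c * \<mu> \<Lambda> E) \<and>
     (\<forall>E\<in>sets M. continuous_on cdual (\<lambda>\<Lambda>. \<mu> \<Lambda> E))"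

definition family_integral ::
    "'s measure \<Rightarrow> (('a::complex_banach_algebra \<Rightarrow>\<^sub>L complex) \<Rightarrow> 's set \<Rightarrow> complex) \<Rightarrow>
     ('s \<Rightarrow> complex) \<Rightarrow> ('a \<Rightarrow>\<^sub>L complex) \<Rightarrow> complex" where
  "family_integral M \<mu> f \<Lambda> = complex_measure_integral M (\<mu> \<Lambda>) f"

definition spectrum_borel :: "'a::complex_banach_algebra \<Rightarrow> complex measure" where
  "spectrum_borel x = restrict_space borel (spectrum x)"

definition represents_calculus ::
    "'a::complex_banach_algebra \<Rightarrow> (('a \<Rightarrow>\<^sub>L complex) \<Rightarrow> complex set \<Rightarrow> complex) \<Rightarrow> bool" where
  "represents_calculus x \<mu> \<longleftrightarrow>
     (\<forall>f. continuous_on (spectrum x) f \<longrightarrow>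
        (\<forall>\<Lambda>\<in>cdual. continuous_calculus x f \<Lambda> = family_integral (spectrum_borel x) \<mu> f \<Lambda>))"

end

theory Submission
  imports Defs
begin

text \<open>For a single functional \<open>\<Lambda>\<close>, existence of the limits forces the calculus to be bounded on the
  polynomials of supremum at most one on a disc around the spectrum.  For a single polynomial, the
  calculus is bounded in \<open>\<Lambda>\<close>: a Dunford integral over the region inside the curve is the pointwise
  limit of integrals over the parts on which the resolvent is bounded.  Uniform boundedness combines
  the two into \<open>cmod (\<Lambda> (p(x))) \<le> K * norm \<Lambda> * sup (cmod \<circ> p)\<close>, and by Stone-Weierstrass and Tietze
  into the same estimate, with the supremum over the spectrum only, for all continuous functions.
  The Riesz representation theorem then yields the measures.  Linearity and continuity in \<open>\<Lambda>\<close>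
  hold for \<open>\<Lambda> \<mapsto> \<mu> \<Lambda> C\<close> with closed \<open>C\<close>, whose indicator is a limit of continuous functions, and
  pass to all Borel sets by a Dynkin argument in which Banach-Steinhaus preserves continuity under
  countable disjoint unions; the same argument gives uniqueness.  That \<open>id(x)\<close> is \<open>x\<close> is a
  statement about the contour integral only, as \<open>dbar\<close> of the identity vanishes; it amounts to the
  contour integral of the resolvent being \<open>2 \<pi> \<i>\<close> times the unit, which follows from Liouville's theorem.\<close>

section \<open>The resolvent\<close>

text \<open>The obstacle is that nothing is bounded at the outset. Well-definedness gives limits for
  one function and one functional at a time, and regularity makes \<Lambda> \<circ> R integrable for
  each \<Lambda> without integrability of the norm of the resolvent R, so that even for a fixed
  polynomial the bound in \<Lambda> takes a Banach-Steinhaus argument. Polynomials are meant in the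
  real and the imaginary part: they are smooth on the plane, closed under sums and multiples, and
  uniformly dense in the continuous functions on a disc, which holomorphic polynomials are not.
  Everything is computed on one disc, with the one curve that \<open>smooth_calculus\<close> chooses
  for it. The dual is a closed real subspace of a type of real-linear maps; therefore uniform
  boundedness is stated for maps on a subspace. Riesz's theorem is proved for real functionals of
  arbitrary sign and applied to the real and the imaginary part of f \<mapsto> \<Lambda>(f(x)). Its
  measures are not identified with Jordan parts; instead, integrals are shown to depend on
  differences of measures alone.\<close>

lemma scaleC_one [simp]: "1 *\<^sub>C (a::'a::complex_banach_algebra) = a"
  using scaleC_of_real[of 1 a] by simp

lemma scaleC_zero_left [simp]: "0 *\<^sub>C (a::'a::complex_banach_algebra) = 0"
  using scaleC_of_real[of 0 a] by simp

lemma scaleC_minus_left: "(- c) *\<^sub>C (a::'a::complex_banach_algebra) = - (c *\<^sub>C a)"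
  using scaleC_add_left[of "- c" c a] by (simp add: eq_neg_iff_add_eq_0)

lemma scaleC_diff_left: "(c - d) *\<^sub>C (a::'a::complex_banach_algebra) = c *\<^sub>C a - d *\<^sub>C a"
  using scaleC_add_left[of c "- d" a] by (simp add: scaleC_minus_left)

lemma inverse_unique:
  fixes u y y' :: "'a::complex_banach_algebra"
  assumes "u * y = 1" "y' * u = 1"
  shows "y' = y"
proof -
  have "y' * (u * y) = (y' * u) * y" by (simp only: mult.assoc)
  then show ?thesis using assms by simp
qed

lemma resolvent_inverse:
  fixes x :: "'a::complex_banach_algebra"
  assumes "z \<notin> spectrum x"
  shows "(z *\<^sub>C 1 - x) * resolvent x z = 1" "resolvent x z * (z *\<^sub>C 1 - x) = 1"
proof -
  obtain y where y: "(z *\<^sub>C 1 - x) * y = 1 \<and> y * (z *\<^sub>C 1 - x) = 1"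
    using assms unfolding spectrum_def by blast
  then have "\<exists>!y. (z *\<^sub>C 1 - x) * y = 1 \<and> y * (z *\<^sub>C 1 - x) = 1"
    by (intro ex1I[of _ y]) (auto intro: inverse_unique)
  then have "(z *\<^sub>C 1 - x) * resolvent x z = 1 \<and> resolvent x z * (z *\<^sub>C 1 - x) = 1"
    unfolding resolvent_def by (rule theI')
  then show "(z *\<^sub>C 1 - x) * resolvent x z = 1" "resolvent x z * (z *\<^sub>C 1 - x) = 1"
    by auto
qed

lemma resolvent_eqI:
  fixes x :: "'a::complex_banach_algebra"
  assumes "(z *\<^sub>C 1 - x) * y = 1" "y * (z *\<^sub>C 1 - x) = 1"
  shows "z \<notin> spectrum x" "resolvent x z = y"
proof -
  show *: "z \<notin> spectrum x" using assms by (auto simp: spectrum_def)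
  show "resolvent x z = y"
    using inverse_unique resolvent_inverse[OF *] assms by metis
qed

text \<open>The geometric series is the inverse. The norm bound follows from b = 1 + a b alone and
  is kept free of division.\<close>

lemma neumann_inverse:
  fixes a :: "'a::{real_normed_algebra_1,banach}"
  assumes "norm a < 1"
  obtains b where "(1 - a) * b = 1" "b * (1 - a) = 1" "norm b * (1 - norm a) \<le> 1"
proof -
  define b where "b = (\<Sum>n. a ^ n)"
  have s: "summable (\<lambda>n. a ^ n)" by (rule complete_algebra_summable_geometric[OF assms])
  have tel: "(\<lambda>n. a ^ n - a ^ Suc n) sums 1"
    using telescope_sums'[OF summable_LIMSEQ_zero[OF s]] by simp
  have "(1 - a) * b = (\<Sum>n. (1 - a) * a ^ n)"
    unfolding b_def by (rule suminf_mult[OF s, symmetric])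
  also have "\<dots> = 1" using sums_unique[OF tel] by (simp add: algebra_simps)
  finally have 1: "(1 - a) * b = 1" .
  have "b * (1 - a) = (\<Sum>n. a ^ n * (1 - a))"
    unfolding b_def by (rule suminf_mult2[OF s])
  also have "\<dots> = 1" using sums_unique[OF tel] by (simp add: algebra_simps power_commutes)
  finally have 2: "b * (1 - a) = 1" .
  have "b = 1 + a * b" using 1 by (simp add: algebra_simps)
  then have "norm b \<le> 1 + norm a * norm b"
    by (metis norm_triangle_le norm_mult_ineq norm_one add_left_mono)
  then have "norm b * (1 - norm a) \<le> 1" by (simp add: algebra_simps)
  with 1 2 that show ?thesis by blast
qed

text \<open>With u = z - x and a = (z - w) R(z), both u (1 - a) and (1 - a) u equal w - x, and a
  Neumann series inverts 1 - a.\<close>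

lemma resolvent_perturb:
  fixes x :: "'a::complex_banach_algebra"
  assumes z: "z \<notin> spectrum x" and w: "cmod (w - z) * norm (resolvent x z) < 1"
  shows "w \<notin> spectrum x"
    "norm (resolvent x w) * (1 - cmod (w - z) * norm (resolvent x z)) \<le> norm (resolvent x z)"
proof -
  let ?R = "resolvent x z" and ?u = "z *\<^sub>C 1 - x"
  define a where "a = (z - w) *\<^sub>C ?R"
  have na: "norm a = cmod (w - z) * norm ?R"
    by (simp add: a_def norm_scaleC norm_minus_commute)
  obtain b where b: "(1 - a) * b = 1" "b * (1 - a) = 1" "norm b * (1 - norm a) \<le> 1"
    using neumann_inverse[of a] w na by auto
  have u: "w *\<^sub>C 1 - x = ?u - (z - w) *\<^sub>C 1"
    by (simp add: scaleC_diff_left)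
  have 1: "w *\<^sub>C 1 - x = ?u * (1 - a)"
    unfolding u a_def
    by (simp add: right_diff_distrib mult_scaleC_right resolvent_inverse[OF z])
  have 2: "w *\<^sub>C 1 - x = (1 - a) * ?u"
    unfolding u a_def
    by (simp add: left_diff_distrib mult_scaleC_left resolvent_inverse[OF z])
  have 3: "(w *\<^sub>C 1 - x) * (b * ?R) = 1"
  proof -
    have "(w *\<^sub>C 1 - x) * (b * ?R) = ?u * ((1 - a) * b) * ?R"
      unfolding 1 by (simp only: mult.assoc)
    then show ?thesis using b resolvent_inverse[OF z] by simp
  qed
  have 4: "(?R * b) * (w *\<^sub>C 1 - x) = 1"
  proof -
    have "(?R * b) * (w *\<^sub>C 1 - x) = ?R * (b * (1 - a)) * ?u"
      unfolding 2 by (simp only: mult.assoc)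
    then show ?thesis using b resolvent_inverse[OF z] by simp
  qed
  \<comment> \<open>The right and the left inverse were built in opposite orders; uniqueness of
    inverses identifies them.\<close>
  have 5: "?R * b = b * ?R" using inverse_unique[OF 3 4] .
  show "w \<notin> spectrum x" using resolvent_eqI(1)[OF 3] 4 5 by auto
  have "resolvent x w = b * ?R" using resolvent_eqI(2)[OF 3] 4 5 by auto
  then have "norm (resolvent x w) \<le> norm b * norm ?R"
    by (simp add: norm_mult_ineq)
  then have "norm (resolvent x w) * (1 - norm a) \<le> (norm b * norm ?R) * (1 - norm a)"
    using w na by (intro mult_right_mono) auto
  also have "\<dots> \<le> norm ?R"
    using mult_right_mono[OF b(3), of "norm ?R"] by (simp add: algebra_simps)
  finally show "norm (resolvent x w) * (1 - cmod (w - z) * norm ?R) \<le> norm ?R"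
    using na by simp
qed

section \<open>The spectrum as a compact set, and the resolvent as a holomorphic function vanishing
  at infinity\<close>

lemma closed_spectrum: "closed (spectrum (x::'a::complex_banach_algebra))"
proof -
  have "\<exists>e>0. \<forall>w. dist w z < e \<longrightarrow> w \<in> - spectrum x" if z: "z \<in> - spectrum x" for z
  proof (intro exI conjI allI impI)
    \<comment> \<open>The summand 1 makes the radius positive with no case distinction on the norm
      of the resolvent.\<close>
    let ?e = "inverse (norm (resolvent x z) + 1)"
    show "?e > 0" by (simp add: add_nonneg_pos)
    fix w assume "dist w z < ?e"
    then have "cmod (w - z) * (norm (resolvent x z) + 1) < 1"
      using less_divide_eq[of "dist w z" 1 "norm (resolvent x z) + 1"]
      by (simp add: dist_norm inverse_eq_divide add_nonneg_pos)
    moreover have "cmod (w - z) * norm (resolvent x z) \<le> cmod (w - z) * (norm (resolvent x z) + 1)"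
      by (intro mult_left_mono) auto
    ultimately have "cmod (w - z) * norm (resolvent x z) < 1" by linarith
    then show "w \<in> - spectrum x" using resolvent_perturb(1) z by auto
  qed
  then show ?thesis by (simp add: closed_def open_dist)
qed

text \<open>Since z - x = z (1 - x/z), a Neumann series gives the inverse; the bound comes from z
  R(z) = 1 + x R(z).\<close>

lemma resolvent_outside:
  fixes x :: "'a::complex_banach_algebra"
  assumes z: "norm x < cmod z"
  shows "z \<notin> spectrum x" "norm (resolvent x z) * (cmod z - norm x) \<le> 1"
proof -
  have z0: "z \<noteq> 0" using z norm_ge_zero[of x] by auto
  define a where "a = inverse z *\<^sub>C x"
  have "norm a < 1"
    using z z0 by (simp add: a_def norm_scaleC norm_divide norm_inverse field_simps)
  then obtain b where b: "(1 - a) * b = 1" "b * (1 - a) = 1"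
    using neumann_inverse by blast
  have u: "z *\<^sub>C 1 - x = z *\<^sub>C (1 - a)"
    using scaleC_add_right[of z "1 - a" a] z0 by (simp add: a_def scaleC_scaleC)
  show sp: "z \<notin> spectrum x"
    by (rule resolvent_eqI(1)[of _ _ "inverse z *\<^sub>C b"])
       (simp_all add: u b mult_scaleC_left mult_scaleC_right scaleC_scaleC z0)
  have "z *\<^sub>C resolvent x z = 1 + x * resolvent x z"
    using resolvent_inverse(1)[OF sp] by (simp add: left_diff_distrib mult_scaleC_left diff_eq_eq)
  then have "cmod z * norm (resolvent x z) \<le> 1 + norm x * norm (resolvent x z)"
    by (metis norm_triangle_le norm_mult_ineq norm_one add_left_mono norm_scaleC)
  then show "norm (resolvent x z) * (cmod z - norm x) \<le> 1" by (simp add: algebra_simps)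
qed

lemma spectrum_subset_cball: "spectrum (x::'a::complex_banach_algebra) \<subseteq> cball 0 (norm x)"
  using resolvent_outside(1) by (force simp: not_le)

lemma compact_spectrum: "compact (spectrum (x::'a::complex_banach_algebra))"
  using closed_spectrum spectrum_subset_cball
  by (meson bounded_cball bounded_subset compact_eq_bounded_closed)

lemma tendsto_resolvent_at_infinity:
  "(resolvent (x::'a::complex_banach_algebra) \<longlongrightarrow> 0) at_infinity"
proof (rule Lim_null_comparison)
  show "\<forall>\<^sub>F z in at_infinity. norm (resolvent x z) \<le> inverse (cmod z - norm x)"
    unfolding eventually_at_infinity
  proof (intro exI allI impI)
    fix z :: complex assume "norm x + 1 \<le> norm z"
    then show "norm (resolvent x z) \<le> inverse (cmod z - norm x)"
      using resolvent_outside(2)[of x z]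
      by (simp add: inverse_eq_divide pos_le_divide_eq)
  qed
  have "filterlim (\<lambda>z::complex. - norm x + cmod z) at_top at_infinity"
    by (intro filterlim_tendsto_add_at_top[OF tendsto_const] filterlim_norm_at_top)
  then show "((\<lambda>z. inverse (cmod z - norm x)) \<longlongrightarrow> 0) at_infinity"
    by (intro tendsto_inverse_0_at_top) simp
qed

lemma resolvent_identity:
  fixes x :: "'a::complex_banach_algebra"
  assumes z: "z \<notin> spectrum x" and w: "w \<notin> spectrum x"
  shows "resolvent x w - resolvent x z = (z - w) *\<^sub>C (resolvent x w * resolvent x z)"
proof -
  let ?Z = "resolvent x z" and ?W = "resolvent x w"
  have "?W - ?Z = ?W * ((z *\<^sub>C 1 - x) * ?Z) - (?W * (w *\<^sub>C 1 - x)) * ?Z"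
    by (simp add: resolvent_inverse z w)
  also have "\<dots> = ?W * ((z *\<^sub>C 1 - x) - (w *\<^sub>C 1 - x)) * ?Z"
    by (simp add: algebra_simps)
  also have "(z *\<^sub>C 1 - x) - (w *\<^sub>C 1 - x) = (z - w) *\<^sub>C 1"
    by (simp add: scaleC_diff_left)
  finally show ?thesis by (simp add: mult_scaleC_right mult_scaleC_left)
qed

text \<open>Where |w - z| |R(z)| < 1/2, the perturbation bound gives |R(w)| \<le> 2 |R(z)|, and the
  resolvent identity turns this into a Lipschitz estimate at z.\<close>

lemma isCont_resolvent:
  fixes x :: "'a::complex_banach_algebra"
  assumes z: "z \<notin> spectrum x"
  shows "isCont (resolvent x) z"
proof -
  let ?R = "norm (resolvent x z)"
  have lim: "((\<lambda>w. cmod (w - z) * ?R) \<longlongrightarrow> 0) (at z)"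
    by (auto intro!: tendsto_eq_intros)
  have "((\<lambda>w. resolvent x w - resolvent x z) \<longlongrightarrow> 0) (at z)"
  proof (rule Lim_null_comparison)
    show "((\<lambda>w. cmod (w - z) * (2 * ?R * ?R)) \<longlongrightarrow> 0) (at z)"
      by (auto intro!: tendsto_eq_intros)
    show "\<forall>\<^sub>F w in at z. norm (resolvent x w - resolvent x z) \<le> cmod (w - z) * (2 * ?R * ?R)"
      using order_tendstoD(2)[OF lim, of "1/2", simplified]
    proof eventually_elim
      case (elim w)
      have *: "cmod (w - z) * ?R < 1" using elim by simp
      have "norm (resolvent x w) * (1/2) \<le> norm (resolvent x w) * (1 - cmod (w - z) * ?R)"
        using elim by (intro mult_left_mono) auto
      also have "\<dots> \<le> ?R" using resolvent_perturb(2)[OF z *] .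
      finally have "norm (resolvent x w) \<le> 2 * ?R" by simp
      moreover have "norm (resolvent x w - resolvent x z)
          \<le> cmod (w - z) * (norm (resolvent x w) * ?R)"
        using resolvent_identity[OF z resolvent_perturb(1)[OF z *]]
        by (simp add: norm_scaleC norm_minus_commute norm_mult_ineq mult_left_mono)
      ultimately show ?case
        by (smt (verit) mult_left_mono mult_right_mono norm_ge_zero)
    qed
  qed
  then show ?thesis by (simp add: isCont_def LIM_zero_iff)
qed

lemma continuous_on_resolvent:
  "A \<inter> spectrum x = {} \<Longrightarrow> continuous_on A (resolvent (x::'a::complex_banach_algebra))"
  by (auto simp: continuous_on_eq_continuous_within intro!: continuous_at_imp_continuous_at_within isCont_resolvent)

lemma cdualD: "\<Lambda> \<in> cdual \<Longrightarrow> blinfun_apply \<Lambda> (c *\<^sub>C a) = c * blinfun_apply \<Lambda> a"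
  by (simp add: cdual_def)

text \<open>By the resolvent identity and complex linearity of \<Lambda>, the difference quotient at
  z is - \<Lambda>(R(w) R(z)), which converges by continuity of the resolvent.\<close>

lemma holomorphic_on_resolvent:
  fixes x :: "'a::complex_banach_algebra"
  assumes \<Lambda>: "\<Lambda> \<in> cdual"
  shows "(\<lambda>z. blinfun_apply \<Lambda> (resolvent x z)) holomorphic_on - spectrum x"
  unfolding holomorphic_on_open[OF open_Compl[OF closed_spectrum]]
proof (intro ballI exI)
  fix z assume z: "z \<in> - spectrum x"
  let ?R = "resolvent x"
  have ev: "\<forall>\<^sub>F w in at z. w \<in> - spectrum x"
    using eventually_at_topological open_Compl[OF closed_spectrum] z by blast
  have "((\<lambda>w. ?R w * ?R z) \<longlongrightarrow> ?R z * ?R z) (at z)"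
    using isCont_resolvent[of z x] z by (intro tendsto_intros) (auto simp: isCont_def)
  then have "((\<lambda>w. - blinfun_apply \<Lambda> (?R w * ?R z)) \<longlongrightarrow> - blinfun_apply \<Lambda> (?R z * ?R z)) (at z)"
    by (intro tendsto_minus bounded_linear.tendsto[OF blinfun.bounded_linear_right])
  moreover have "\<forall>\<^sub>F w in at z. (blinfun_apply \<Lambda> (?R w) - blinfun_apply \<Lambda> (?R z)) / (w - z)
      = - blinfun_apply \<Lambda> (?R w * ?R z)"
    using ev eventually_neq_at_within[of z]
  proof eventually_elim
    case (elim w)
    have "blinfun_apply \<Lambda> (?R w) - blinfun_apply \<Lambda> (?R z)
        = (z - w) * blinfun_apply \<Lambda> (?R w * ?R z)"
      using resolvent_identity[of z x w] z elim cdualD[OF \<Lambda>]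
      by (metis ComplD blinfun.diff_right)
    then show ?case using elim by (simp add: field_simps)
  qed
  ultimately have "((\<lambda>w. (blinfun_apply \<Lambda> (?R w) - blinfun_apply \<Lambda> (?R z)) / (w - z))
      \<longlongrightarrow> - blinfun_apply \<Lambda> (?R z * ?R z)) (at z)"
    by (simp add: tendsto_cong)
  then show "((\<lambda>z. blinfun_apply \<Lambda> (?R z)) has_field_derivative - blinfun_apply \<Lambda> (?R z * ?R z)) (at z)"
    by (simp add: has_field_derivative_iff)
qed

section \<open>Integrals along bounding curves\<close>

definition curve_integral :: "(real \<Rightarrow> complex) list \<Rightarrow> (complex \<Rightarrow> complex) \<Rightarrow> complex" where
  "curve_integral \<gamma> f = (\<Sum>g\<leftarrow>\<gamma>. contour_integral g f)"

lemma smooth_closed_curve_C1: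
  assumes "smooth_closed_curve g"
  shows "g C1_differentiable_on UNIV"
proof -
  have "Ck_on (Suc 0) UNIV g" using assms by (auto simp: smooth_closed_curve_def smooth_on_def)
  then have d: "\<And>t. g differentiable at t"
    and c: "continuous_on UNIV (\<lambda>t. frechet_derivative g (at t) 1)" by auto
  show ?thesis
    unfolding C1_differentiable_on_eq using d c
    by (simp add: frechet_derivative_eq_vector_derivative[OF d])
qed

lemma smooth_closed_curve_valid_path:
  assumes "smooth_closed_curve g"
  shows "valid_path g"
  unfolding valid_path_def
  by (rule C1_differentiable_imp_piecewise, rule C1_differentiable_on_subset[OF smooth_closed_curve_C1[OF assms]]) simp

lemma smooth_closed_curve_path: "smooth_closed_curve g \<Longrightarrow> path g"
  using smooth_closed_curve_valid_path valid_path_imp_path by blast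

lemma smooth_closed_curve_loop:
  assumes "smooth_closed_curve g"
  shows "pathfinish g = pathstart g"
proof -
  have "g (0 + 1) = g 0" using assms unfolding smooth_closed_curve_def by blast
  then show ?thesis by (simp add: pathfinish_def pathstart_def)
qed

lemma smooth_closed_curve_speed_bound:
  assumes "smooth_closed_curve g"
  obtains B where "\<And>t. t \<in> {0..1} \<Longrightarrow> cmod (vector_derivative g (at t)) \<le> B"
proof -
  have "continuous_on {0..1} (\<lambda>t. vector_derivative g (at t))"
    using smooth_closed_curve_C1[OF assms]
    by (auto simp: C1_differentiable_on_eq intro: continuous_on_subset)
  then have "bounded ((\<lambda>t. vector_derivative g (at t)) ` {0..1})"
    by (intro compact_imp_bounded compact_continuous_image) auto
  then show ?thesis using that unfolding bounded_iff by blast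
qed

lemma contour_integrable_smooth:
  assumes g: "smooth_closed_curve g" and f: "continuous_on (path_image g) f"
  shows "f contour_integrable_on g"
    "continuous_on {0..1} (\<lambda>t. f (g t) * vector_derivative g (at t))"
proof -
  show c: "continuous_on {0..1} (\<lambda>t. f (g t) * vector_derivative g (at t))"
  proof (intro continuous_on_mult)
    show "continuous_on {0..1} (\<lambda>t. f (g t))"
      using continuous_on_compose[of "{0..1}" g f] smooth_closed_curve_path[OF g] f
      by (simp add: path_def path_image_def o_def)
    show "continuous_on {0..1} (\<lambda>t. vector_derivative g (at t))"
      using smooth_closed_curve_C1[OF g]
      by (auto simp: C1_differentiable_on_eq intro: continuous_on_subset)
  qed
  then show "f contour_integrable_on g"
    unfolding contour_integrable_on by (rule integrable_continuous_interval)
qed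

lemma contour_integral_bound_smooth:
  assumes g: "smooth_closed_curve g"
    and B: "\<And>t. t \<in> {0..1} \<Longrightarrow> cmod (vector_derivative g (at t)) \<le> B"
    and f: "continuous_on (path_image g) f" and M: "\<And>z. z \<in> path_image g \<Longrightarrow> cmod (f z) \<le> M"
  shows "cmod (contour_integral g f) \<le> M * B"
proof -
  have "cmod (integral {0..1} (\<lambda>t. f (g t) * vector_derivative g (at t))) \<le> M * B * (1 - 0)"
  proof (rule integral_bound[OF _ contour_integrable_smooth(2)[OF g f]])
    fix t :: real assume t: "t \<in> {0..1}"
    have "0 \<le> M" using M[of "g t"] t order_trans[OF norm_ge_zero] by (auto simp: path_image_def)
    then show "cmod (f (g t) * vector_derivative g (at t)) \<le> M * B"
      using t by (auto simp: norm_mult path_image_def intro!: mult_mono M B)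
  qed simp
  then show ?thesis by (simp add: contour_integral_integral)
qed

text \<open>One constant B, the sum of speed bounds of the components, serves all integrands; this
  is what makes later estimates uniform in the functional.\<close>

lemma curve_integral_bound:
  assumes g: "\<forall>g\<in>set \<gamma>. smooth_closed_curve g"
  shows "\<exists>B\<ge>0. \<forall>f M. continuous_on (curve_image \<gamma>) f \<longrightarrow> (\<forall>z\<in>curve_image \<gamma>. cmod (f z) \<le> M) \<longrightarrow> 0 \<le> M \<longrightarrow>
    cmod (curve_integral \<gamma> f) \<le> M * B"
  using g
proof (induction \<gamma>)
  case Nil
  then show ?case by (auto simp: curve_integral_def)
next
  case (Cons g \<gamma>)
  then obtain B where B: "B \<ge> 0" "\<And>f M. continuous_on (curve_image \<gamma>) f \<Longrightarrow>
      (\<forall>z\<in>curve_image \<gamma>. cmod (f z) \<le> M) \<Longrightarrow> 0 \<le> M \<Longrightarrow> cmod (curve_integral \<gamma> f) \<le> M * B"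
    by auto
  have sg: "smooth_closed_curve g" using Cons by auto
  obtain B' where B': "\<And>t. t \<in> {0..1} \<Longrightarrow> cmod (vector_derivative g (at t)) \<le> B'"
    using smooth_closed_curve_speed_bound[OF sg] by blast
  have "B' \<ge> 0" using order_trans[OF norm_ge_zero B'[of 0]] by simp
  show ?case
  proof (intro exI[of _ "B' + B"] conjI allI impI)
    fix f M assume f: "continuous_on (curve_image (g # \<gamma>)) f"
      and M: "\<forall>z\<in>curve_image (g # \<gamma>). cmod (f z) \<le> M" "0 \<le> M"
    have "cmod (contour_integral g f) \<le> M * B'"
      by (rule contour_integral_bound_smooth[OF sg B' continuous_on_subset[OF f]])
        (use M in \<open>auto simp: curve_image_def\<close>)
    moreover have "cmod (curve_integral \<gamma> f) \<le> M * B"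
      by (rule B(2)[OF continuous_on_subset[OF f]]) (use M in \<open>auto simp: curve_image_def\<close>)
    moreover have "curve_integral (g # \<gamma>) f = contour_integral g f + curve_integral \<gamma> f"
      by (simp add: curve_integral_def)
    ultimately show "cmod (curve_integral (g # \<gamma>) f) \<le> M * (B' + B)"
      using norm_triangle_mono[of "contour_integral g f" "M * B'" "curve_integral \<gamma> f" "M * B"]
      by (simp add: distrib_left)
  qed (use B \<open>B' \<ge> 0\<close> in auto)
qed

lemma curve_integral_add:
  assumes "\<forall>g\<in>set \<gamma>. smooth_closed_curve g"
    "continuous_on (curve_image \<gamma>) f" "continuous_on (curve_image \<gamma>) h"
  shows "curve_integral \<gamma> (\<lambda>z. f z + h z) = curve_integral \<gamma> f + curve_integral \<gamma> h"
  using assms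
proof (induction \<gamma>)
  case (Cons g \<gamma>)
  have "contour_integral g (\<lambda>z. f z + h z) = contour_integral g f + contour_integral g h"
    using Cons.prems by (intro contour_integral_add contour_integrable_smooth)
      (auto simp: curve_image_def intro: continuous_on_subset)
  moreover have "curve_integral \<gamma> (\<lambda>z. f z + h z) = curve_integral \<gamma> f + curve_integral \<gamma> h"
    using Cons.prems by (intro Cons.IH) (auto simp: curve_image_def intro: continuous_on_subset)
  ultimately show ?case by (simp add: curve_integral_def)
qed (simp add: curve_integral_def)

lemma curve_integral_cmult:
  assumes "\<forall>g\<in>set \<gamma>. smooth_closed_curve g" "continuous_on (curve_image \<gamma>) f"
  shows "curve_integral \<gamma> (\<lambda>z. c * f z) = c * curve_integral \<gamma> f"
  using assms
proof (induction \<gamma>)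
  case (Cons g \<gamma>)
  have "contour_integral g (\<lambda>z. c * f z) = c * contour_integral g f"
    using Cons.prems by (intro contour_integral_lmul contour_integrable_smooth)
      (auto simp: curve_image_def intro: continuous_on_subset)
  moreover have "curve_integral \<gamma> (\<lambda>z. c * f z) = c * curve_integral \<gamma> f"
    using Cons.prems by (intro Cons.IH) (auto simp: curve_image_def intro: continuous_on_subset)
  ultimately show ?case by (simp add: curve_integral_def distrib_left)
qed (simp add: curve_integral_def)

lemma curve_integral_cong:
  assumes "\<And>z. z \<in> curve_image \<gamma> \<Longrightarrow> f z = h z"
  shows "curve_integral \<gamma> f = curve_integral \<gamma> h"
proof -
  have "contour_integral g f = contour_integral g h" if "g \<in> set \<gamma>" for g
    using assms that by (intro contour_integral_cong) (auto simp: curve_image_def)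
  then have "map (\<lambda>g. contour_integral g f) \<gamma> = map (\<lambda>g. contour_integral g h) \<gamma>" by simp
  then show ?thesis by (simp only: curve_integral_def)
qed

lemma curve_integral_const:
  assumes "\<forall>g\<in>set \<gamma>. smooth_closed_curve g"
  shows "curve_integral \<gamma> (\<lambda>z. c) = 0"
  using assms
proof (induction \<gamma>)
  case (Cons g \<gamma>)
  have "((\<lambda>z. c) has_contour_integral 0) g"
    using Cons.prems by (intro Cauchy_theorem_convex_simple[where S=UNIV])
      (auto intro: smooth_closed_curve_valid_path smooth_closed_curve_loop)
  then show ?case using Cons by (auto simp: curve_integral_def contour_integral_unique)
qed (simp add: curve_integral_def)

lemma curve_integral_winding:
  assumes "\<forall>g\<in>set \<gamma>. smooth_closed_curve g" "z \<notin> curve_image \<gamma>"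
  shows "curve_integral \<gamma> (\<lambda>w. 1 / (w - z)) = 2 * of_real pi * \<i> * curve_winding \<gamma> z"
  using assms
proof (induction \<gamma>)
  case (Cons g \<gamma>)
  have "contour_integral g (\<lambda>w. 1 / (w - z)) = 2 * of_real pi * \<i> * winding_number g z"
    using Cons.prems winding_number_valid_path[of g z] smooth_closed_curve_valid_path[of g]
    by (auto simp: curve_image_def)
  moreover have "curve_integral \<gamma> (\<lambda>w. 1 / (w - z)) = 2 * of_real pi * \<i> * curve_winding \<gamma> z"
    using Cons by (auto simp: curve_image_def)
  ultimately show ?case by (simp add: curve_integral_def curve_winding_def distrib_left)
qed (simp add: curve_integral_def curve_winding_def)

lemma compact_curve_image:
  assumes "\<forall>g\<in>set \<gamma>. smooth_closed_curve g"
  shows "compact (curve_image \<gamma>)"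
  unfolding curve_image_def using assms
  by (auto intro!: compact_UN compact_path_image smooth_closed_curve_path)

lemma cauchy_transform_holomorphic:
  assumes "\<forall>g\<in>set \<gamma>. smooth_closed_curve g" "continuous_on (curve_image \<gamma>) f"
  shows "(\<lambda>z. curve_integral \<gamma> (\<lambda>w. f w / (w - z))) holomorphic_on - curve_image \<gamma>"
  using assms
proof (induction \<gamma>)
  case (Cons g \<gamma>)
  have sg: "smooth_closed_curve g" and f: "continuous_on (path_image g) f"
    using Cons.prems by (auto simp: curve_image_def intro: continuous_on_subset)
  obtain B where B: "\<And>t. t \<in> {0..1} \<Longrightarrow> cmod (vector_derivative g (at t)) \<le> B"
    using smooth_closed_curve_speed_bound[OF sg] by blast
  \<comment> \<open>Exponent 1 is the case of \<open>Cauchy_next_derivative\<close> that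
    differentiates the kernel 1 / (w - z).\<close>
  have int: "((\<lambda>w. f w / (w - z) ^ 1) has_contour_integral contour_integral g (\<lambda>w. f w / (w - z))) g"
    if "z \<in> UNIV - path_image g" for z
    using that f by (auto intro!: has_contour_integral_integral contour_integrable_smooth(1)[OF sg]
      continuous_intros)
  have "(\<lambda>z. contour_integral g (\<lambda>w. f w / (w - z))) holomorphic_on - path_image g"
    unfolding holomorphic_on_open[OF open_Compl[OF closed_path_image[OF smooth_closed_curve_path[OF sg]]]]
    using Cauchy_next_derivative(2)[OF f B int _ open_UNIV smooth_closed_curve_valid_path[OF sg]]
    by blast
  then have 1: "(\<lambda>z. contour_integral g (\<lambda>w. f w / (w - z))) holomorphic_on - curve_image (g # \<gamma>)"
    by (rule holomorphic_on_subset) (auto simp: curve_image_def)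
  have "(\<lambda>z. curve_integral \<gamma> (\<lambda>w. f w / (w - z))) holomorphic_on - curve_image \<gamma>"
    using Cons.prems by (intro Cons.IH) (auto simp: curve_image_def intro: continuous_on_subset)
  then have 2: "(\<lambda>z. curve_integral \<gamma> (\<lambda>w. f w / (w - z))) holomorphic_on - curve_image (g # \<gamma>)"
    by (rule holomorphic_on_subset) (auto simp: curve_image_def)
  show ?case using holomorphic_on_add[OF 1 2] by (simp add: curve_integral_def)
qed (simp add: curve_integral_def)

text \<open>Off the curve the winding number takes only the values 0 and 1. The open ball of radius
  1 about 1 misses 0, so the region is the preimage of an open set under a continuous map.\<close>

lemma open_curve_int:
  assumes "bounding_curve \<gamma>"
  shows "open (curve_int \<gamma>)"
proof -
  have sm: "\<forall>g\<in>set \<gamma>. smooth_closed_curve g" using assms by (simp add: bounding_curve_def)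
  have "continuous_on (- curve_image \<gamma>) (curve_winding \<gamma>)"
    using sm
  proof (induction \<gamma>)
    case (Cons g \<gamma>)
    have "continuous_on (- curve_image (g # \<gamma>)) (\<lambda>z. winding_number g z + curve_winding \<gamma> z)"
      using Cons continuous_on_winding_number[OF smooth_closed_curve_path, of g]
      by (intro continuous_on_add) (auto simp: curve_image_def intro: continuous_on_subset)
    then show ?case by (simp add: curve_winding_def)
  qed (simp add: curve_winding_def)
  then have "open (- curve_image \<gamma> \<inter> curve_winding \<gamma> -` ball 1 1)"
    using continuous_open_preimage compact_imp_closed[OF compact_curve_image[OF sm]] by blast
  moreover have "curve_int \<gamma> = - curve_image \<gamma> \<inter> curve_winding \<gamma> -` ball 1 1"
    using assms unfolding bounding_curve_def curve_int_def by force
  ultimately show ?thesis by simp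
qed

lemma bounded_curve_int:
  assumes "bounding_curve \<gamma>"
  shows "bounded (curve_int \<gamma>)"
proof -
  have sm: "\<forall>g\<in>set \<gamma>. smooth_closed_curve g" using assms by (simp add: bounding_curve_def)
  obtain B where B: "curve_image \<gamma> \<subseteq> ball 0 B"
    using compact_imp_bounded[OF compact_curve_image[OF sm]] bounded_subset_ballD by blast
  have "curve_winding \<gamma> z = 0" if "z \<notin> ball 0 B" for z
    using sm B
  proof (induction \<gamma>)
    case (Cons g \<gamma>)
    have "winding_number g z = 0"
      using Cons.prems that
      by (intro winding_number_zero_outside[OF _ convex_ball[of 0 B]] smooth_closed_curve_path
          smooth_closed_curve_loop) (auto simp: curve_image_def)
    moreover have "curve_winding \<gamma> z = 0"
      using Cons by (auto simp: curve_image_def)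
    ultimately show ?case by (simp add: curve_winding_def)
  qed (simp add: curve_winding_def)
  then have "curve_int \<gamma> \<subseteq> ball 0 B" unfolding curve_int_def by force
  then show ?thesis using bounded_ball bounded_subset by blast
qed

text \<open>The factor c is arbitrary because differentiation reproduces the same form with a new
  factor.\<close>

lemma Ck_on_exp: "Ck_on k UNIV (\<lambda>t::real. c * exp (2 * of_real pi * \<i> * of_real t) :: complex)"
proof (induction k arbitrary: c)
  case (Suc k)
  have d: "((\<lambda>t::real. c * exp (2 * of_real pi * \<i> * of_real t)) has_derivative
      (\<lambda>v. of_real v * (c * (2 * of_real pi * \<i>) * exp (2 * of_real pi * \<i> * of_real t)))) (at t)" for t
  proof -
    have "((\<lambda>t::real. c * exp (2 * of_real pi * \<i> * of_real t)) has_vector_derivative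
      c * (2 * of_real pi * \<i>) * exp (2 * of_real pi * \<i> * of_real t)) (at t)"
      by (rule has_vector_derivative_real_field[where f="\<lambda>z. c * exp (2 * of_real pi * \<i> * z)"])
         (auto intro!: derivative_eq_intros)
    then show ?thesis by (simp add: has_vector_derivative_def scaleR_conv_of_real)
  qed
  have fd: "frechet_derivative (\<lambda>t::real. c * exp (2 * of_real pi * \<i> * of_real t)) (at t)
     = (\<lambda>v. of_real v * (c * (2 * of_real pi * \<i>) * exp (2 * of_real pi * \<i> * of_real t)))" for t
    using frechet_derivative_at[OF d] by simp
  show ?case
    unfolding Ck_on.simps fd
    using d Suc.IH[of "of_real v * (c * (2 * of_real pi * \<i>))" for v]
    by (auto simp: mult.assoc differentiable_def)
qed (auto intro!: continuous_intros)

text \<open>Circles are the witnesses that make the choice of a curve in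
  \<open>smooth_calculus\<close> meaningful on a disc.\<close>

lemma bounding_curve_circlepath:
  assumes r: "0 < r"
  shows "bounding_curve [circlepath 0 r]" "curve_image [circlepath 0 r] = sphere 0 r"
    "curve_int [circlepath 0 r] = ball 0 r"
proof -
  have eq: "circlepath 0 r = (\<lambda>t. of_real r * exp (2 * of_real pi * \<i> * of_real t))"
    by (simp add: circlepath)
  have vd: "vector_derivative (circlepath 0 r) (at t) \<noteq> 0" for t
    using r by (simp add: vector_derivative_circlepath)
  have per: "circlepath 0 r (t + 1) = circlepath 0 r t" for t
    using exp_two_pi_i by (simp add: eq distrib_left exp_add mult.commute mult.left_commute)
  have "smooth_on UNIV (circlepath 0 r)"
    unfolding smooth_on_def eq using Ck_on_exp by blast
  then have s: "smooth_closed_curve (circlepath 0 r)"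
    unfolding smooth_closed_curve_def
    using vd per r by (simp add: simple_path_circlepath)
  have w1: "winding_number (circlepath 0 r) z = 1" if "cmod z < r" for z
    using that by (intro winding_number_circlepath) auto
  have w0: "winding_number (circlepath 0 r) z = 0" if "cmod z > r" for z
    using that r by (intro winding_number_zero_outside[OF _ convex_cball[of 0 r]]) auto
  show "bounding_curve [circlepath 0 r]"
    unfolding bounding_curve_def
    using s w0 w1 r by (auto simp: curve_image_def curve_winding_def not_less_iff_gr_or_eq split: if_splits) (meson linorder_neqE)
  show im: "curve_image [circlepath 0 r] = sphere 0 r"
    using r by (simp add: curve_image_def)
  show "curve_int [circlepath 0 r] = ball 0 r"
  proof (intro set_eqI)
    fix z
    show "z \<in> curve_int [circlepath 0 r] \<longleftrightarrow> z \<in> ball 0 r"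
      unfolding curve_int_def im using w0[of z] w1[of z]
      by (cases "cmod z" r rule: linorder_cases) (auto simp: curve_winding_def)
  qed
qed

section \<open>Smoothness of polynomial functions\<close>

text \<open>The induction runs on an explicit derivative p' together with polynomiality of its value
  in direction v, since the product rule needs derivatives as functions;
  \<open>frechet_derivative\<close> is identified only at the end, by uniqueness.\<close>

lemma real_polynomial_function_frechet_derivative:
  fixes p :: "'a::real_normed_vector \<Rightarrow> real"
  assumes "real_polynomial_function p"
  shows "p differentiable at z \<and> real_polynomial_function (\<lambda>z. frechet_derivative p (at z) v)"
proof -
  have "\<exists>p'. (\<forall>z. (p has_derivative p' z) (at z)) \<and> real_polynomial_function (\<lambda>z. p' z v)"
    using assms
  proof induction
    case (linear f)
    then show ?case
      by (intro exI[of _ "\<lambda>z. f"]) (auto intro: bounded_linear_imp_has_derivative real_polynomial_function.intros)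
  next
    case (const c)
    then show ?case
      by (intro exI[of _ "\<lambda>z v. 0"]) (auto intro: real_polynomial_function.intros)
  next
    case (add f g)
    then obtain f' g' where "\<forall>z. (f has_derivative f' z) (at z)" "real_polynomial_function (\<lambda>z. f' z v)"
      "\<forall>z. (g has_derivative g' z) (at z)" "real_polynomial_function (\<lambda>z. g' z v)" by blast
    then show ?case
      by (intro exI[of _ "\<lambda>z v. f' z v + g' z v"]) (auto intro: has_derivative_add real_polynomial_function.intros)
  next
    case (mult f g)
    then obtain f' g' where "\<forall>z. (f has_derivative f' z) (at z)" "real_polynomial_function (\<lambda>z. f' z v)"
      "\<forall>z. (g has_derivative g' z) (at z)" "real_polynomial_function (\<lambda>z. g' z v)" by blast
    with mult.hyps show ?case
      by (intro exI[of _ "\<lambda>z v. f z * g' z v + f' z v * g z"])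
        (auto intro: has_derivative_mult real_polynomial_function.intros real_polynomial_function.intros)
  qed
  then obtain p' where d: "\<And>z. (p has_derivative p' z) (at z)" and p': "real_polynomial_function (\<lambda>z. p' z v)"
    by blast
  have "frechet_derivative p (at z) = p' z" for z
    using frechet_derivative_at[OF d] by simp
  then show ?thesis using d p' by (auto simp: differentiable_def)
qed

text \<open>Reduction to coordinates: the coordinates of the derivative are the derivatives of the
  coordinates.\<close>

lemma polynomial_function_frechet_derivative:
  fixes p :: "'a::euclidean_space \<Rightarrow> 'b::euclidean_space"
  assumes p: "polynomial_function p"
  shows "polynomial_function (\<lambda>z. frechet_derivative p (at z) v)"
  unfolding polynomial_function_iff_Basis_inner
proof
  fix b :: 'b assume b: "b \<in> Basis"
  have d: "p differentiable at z" for z using p by (rule differentiable_at_polynomial_function)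
  have "((\<lambda>z. inner (p z) b) has_derivative (\<lambda>v. inner (frechet_derivative p (at z) v) b)) (at z)" for z
    using d frechet_derivative_works by (intro has_derivative_inner_left) blast
  then have "frechet_derivative (\<lambda>z. inner (p z) b) (at z) v = inner (frechet_derivative p (at z) v) b" for z
    using frechet_derivative_at by metis
  then show "real_polynomial_function (\<lambda>z. inner (frechet_derivative p (at z) v) b)"
    using real_polynomial_function_frechet_derivative[of "\<lambda>z. inner (p z) b" _ v] p b
    by (simp add: polynomial_function_iff_Basis_inner)
qed

lemma smooth_on_polynomial_function:
  fixes p :: "'a::euclidean_space \<Rightarrow> 'b::euclidean_space"
  assumes "polynomial_function p"
  shows "smooth_on S p"
proof -
  have "Ck_on k S p" for k
    using assms
    by (induction k arbitrary: p)
      (auto intro: continuous_on_polymonial_function differentiable_at_polynomial_function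
        polynomial_function_frechet_derivative)
  then show ?thesis by (simp add: smooth_on_def)
qed

lemma polynomial_function_cmult:
  fixes p :: "complex \<Rightarrow> complex"
  assumes "polynomial_function p"
  shows "polynomial_function (\<lambda>z. c * p z)"
  using polynomial_function_compose[OF assms polynomial_function_bounded_linear[OF bounded_linear_mult_right[of c]]]
  by (simp add: o_def)

lemma continuous_on_dbar:
  assumes "polynomial_function p"
  shows "continuous_on S (dbar p)"
proof -
  have "continuous_on S (\<lambda>z. frechet_derivative p (at z) v)" for v
    using assms by (intro continuous_on_polymonial_function polynomial_function_frechet_derivative)
  then show ?thesis unfolding dbar_def by (intro continuous_intros) auto
qed

lemma dbar_add:
  assumes "f differentiable at z" "g differentiable at z"
  shows "dbar (\<lambda>z. f z + g z) z = dbar f z + dbar g z"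
proof -
  have "((\<lambda>z. f z + g z) has_derivative (\<lambda>v. frechet_derivative f (at z) v + frechet_derivative g (at z) v)) (at z)"
    using assms frechet_derivative_works by (intro has_derivative_add) blast+
  then show ?thesis
    by (simp add: dbar_def algebra_simps add_divide_distrib flip: frechet_derivative_at)
qed

lemma dbar_cmult:
  assumes "f differentiable at z"
  shows "dbar (\<lambda>z. c * f z) z = c * dbar f z"
proof -
  have "((\<lambda>z. c * f z) has_derivative (\<lambda>v. c * frechet_derivative f (at z) v)) (at z)"
    using assms frechet_derivative_works by (intro has_derivative_mult_right) blast+
  then show ?thesis
    by (simp add: dbar_def algebra_simps flip: frechet_derivative_at)
qed

lemma dbar_id: "dbar (\<lambda>z. z) z = 0"
proof -
  have "frechet_derivative (\<lambda>z::complex. z) (at z) = (\<lambda>v. v)"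
    using frechet_derivative_at[OF has_derivative_ident] by simp
  then show ?thesis by (simp add: dbar_def)
qed

section \<open>Uniform boundedness\<close>

text \<open>Baire's theorem in the complete space V. The maps are raw functions, linear on V only,
  so that V can be the dual inside its larger type and the index can be a polynomial.\<close>

lemma uniform_boundedness:
  fixes V :: "'v::banach set" and T :: "'i \<Rightarrow> 'v \<Rightarrow> 'w::real_normed_vector"
  assumes V: "closed V" "subspace V"
    and add: "\<And>i u v. i \<in> I \<Longrightarrow> u \<in> V \<Longrightarrow> v \<in> V \<Longrightarrow> T i (u + v) = T i u + T i v"
    and scale: "\<And>i c v. i \<in> I \<Longrightarrow> v \<in> V \<Longrightarrow> T i (c *\<^sub>R v) = c *\<^sub>R T i v"
    and bdd: "\<And>i. i \<in> I \<Longrightarrow> \<exists>K. \<forall>v\<in>V. norm (T i v) \<le> K * norm v"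
    and pw: "\<And>v. v \<in> V \<Longrightarrow> \<exists>C. \<forall>i\<in>I. norm (T i v) \<le> C"
  shows "\<exists>K. \<forall>i\<in>I. \<forall>v\<in>V. norm (T i v) \<le> K * norm v"
proof -
  define A where "A n = {v \<in> V. \<forall>i\<in>I. norm (T i v) \<le> real n}" for n
  have diff: "T i (u - v) = T i u - T i v" if "i \<in> I" "u \<in> V" "v \<in> V" for i u v
    using add[OF that(1,2), of "- v"] scale[OF that(1,3), of "- 1"] that V
    by (simp add: subspace_neg)
  have cont: "continuous_on V (T i)" if i: "i \<in> I" for i
  proof -
    obtain K where K: "\<And>v. v \<in> V \<Longrightarrow> norm (T i v) \<le> K * norm v" using bdd[OF i] by blast
    have "(max K 0)-lipschitz_on V (T i)"
    proof (rule lipschitz_onI)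
      fix u v assume "u \<in> V" "v \<in> V"
      then have "norm (T i u - T i v) \<le> K * norm (u - v)"
        using K[of "u - v"] diff[OF i] V by (simp add: subspace_diff)
      also have "\<dots> \<le> max K 0 * norm (u - v)" by (intro mult_right_mono) auto
      finally show "dist (T i u) (T i v) \<le> max K 0 * dist u v" by (simp add: dist_norm)
    qed simp
    then show ?thesis by (rule lipschitz_on_continuous_on)
  qed
  have clA: "closed (A n)" for n
  proof -
    have "closed (V \<inter> (\<lambda>v. norm (T i v)) -` {..real n})" if "i \<in> I" for i
      using cont[OF that] V by (intro continuous_closed_preimage continuous_on_norm) auto
    \<comment> \<open>The outer V matters for empty I, where the inner intersection is the whole
      type.\<close>
    then have "closed (V \<inter> (\<Inter>i\<in>I. V \<inter> (\<lambda>v. norm (T i v)) -` {..real n}))"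
      using V by (intro closed_Int closed_INT) auto
    moreover have "A n = V \<inter> (\<Inter>i\<in>I. V \<inter> (\<lambda>v. norm (T i v)) -` {..real n})"
      by (auto simp: A_def)
    ultimately show ?thesis by simp
  qed
  have un: "(\<Union>n. A n) = V"
  proof -
    have "\<exists>n. v \<in> A n" if v: "v \<in> V" for v
    proof -
      obtain C where C: "\<forall>i\<in>I. norm (T i v) \<le> C" using pw[OF v] by blast
      obtain n where "C \<le> real n" using real_arch_simple by blast
      with C v show ?thesis unfolding A_def by (auto intro!: exI[of _ n] intro: order_trans)
    qed
    moreover have "A n \<subseteq> V" for n by (auto simp: A_def)
    ultimately show ?thesis by blast
  qed
  have "\<exists>n. top_of_set V interior_of A n \<noteq> {}"
  proof (rule ccontr)
    assume "\<nexists>n. top_of_set V interior_of A n \<noteq> {}"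
    then have "top_of_set V interior_of \<Union> (range A) = {}"
      using clA V un
      by (intro Baire_category_alt)
         (auto intro!: closed_subset completely_metrizable_space_closedin
            completely_metrizable_space_euclidean)
    moreover have "0 \<in> top_of_set V interior_of V"
      using interior_of_topspace[of "top_of_set V"] V subspace_0 by auto
    ultimately show False using un by auto
  qed
  then obtain n u U where "openin (top_of_set V) U" "u \<in> U" "U \<subseteq> A n"
    unfolding interior_of_def by blast
  then obtain r where r: "r > 0" "\<And>y. y \<in> V \<Longrightarrow> dist y u < r \<Longrightarrow> y \<in> A n" and u: "u \<in> V" "u \<in> A n"
    unfolding openin_euclidean_subtopology_iff by (metis subset_iff)
  \<comment> \<open>The vector c v has norm r / 2, so u + c v stays in the ball. Then c (T v) is a
    difference of two values of norm at most n, whence the constant 2 n \<cdot> 2 / r.\<close>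
  have "norm (T i v) \<le> (4 * real n / r) * norm v" if i: "i \<in> I" and v: "v \<in> V" for i v
  proof (cases "v = 0")
    case True
    then show ?thesis using diff[OF i v v] by simp
  next
    case False
    define c where "c = r / (2 * norm v)"
    have c: "c > 0" using False r by (simp add: c_def)
    have cv: "c *\<^sub>R v \<in> V" using V v subspace_scale by blast
    have "u + c *\<^sub>R v \<in> A n"
      using V u cv r False c
      by (intro r(2)) (auto simp: subspace_add dist_norm c_def)
    then have "norm (T i (u + c *\<^sub>R v)) \<le> n" "norm (T i u) \<le> n" using u i by (auto simp: A_def)
    moreover have "c *\<^sub>R T i v = T i (u + c *\<^sub>R v) - T i u"
      using add[OF i u(1) cv] scale[OF i v] by simp
    ultimately have "norm (c *\<^sub>R T i v) \<le> real n + real n"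
      by (smt (verit) norm_triangle_ineq4)
    then have "c * norm (T i v) \<le> 2 * real n" using c by simp
    then show ?thesis using False r by (simp add: c_def field_simps)
  qed
  then show ?thesis by blast
qed

text \<open>Convergent sequences are bounded, so uniform boundedness gives all T i a common
  constant, which survives the limit.\<close>

lemma banach_steinhaus_limit:
  fixes V :: "'v::banach set" and T :: "nat \<Rightarrow> 'v \<Rightarrow> 'w::real_normed_vector"
  assumes V: "closed V" "subspace V"
    and add: "\<And>i u v. u \<in> V \<Longrightarrow> v \<in> V \<Longrightarrow> T i (u + v) = T i u + T i v"
    and scale: "\<And>i c v. v \<in> V \<Longrightarrow> T i (c *\<^sub>R v) = c *\<^sub>R T i v"
    and bdd: "\<And>i. \<exists>K. \<forall>v\<in>V. norm (T i v) \<le> K * norm v"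
    and lim: "\<And>v. v \<in> V \<Longrightarrow> (\<lambda>i. T i v) \<longlonglongrightarrow> L v"
  shows "\<exists>K. \<forall>v\<in>V. norm (L v) \<le> K * norm v"
proof -
  have "\<exists>C. \<forall>i\<in>UNIV. norm (T i v) \<le> C" if "v \<in> V" for v
    using convergent_imp_Bseq[of "\<lambda>i. T i v"] lim[OF that] unfolding convergent_def Bseq_def by blast
  then obtain K where K: "\<forall>i\<in>UNIV. \<forall>v\<in>V. norm (T i v) \<le> K * norm v"
    using uniform_boundedness[of V UNIV T, OF V add scale bdd] by blast
  have "norm (L v) \<le> K * norm v" if "v \<in> V" for v
    using tendsto_norm[OF lim[OF that]] K that by (intro Lim_bounded) auto
  then show ?thesis by blast
qed

section \<open>The Riesz representation theorem\<close>

lemma ennreal_plus_le: "ennreal (a + b) \<le> ennreal a + ennreal b"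
  unfolding ennreal_plus_if by (intro ennreal_leI) auto

lemma ennreal_sum_le: "ennreal (sum f I) \<le> (\<Sum>i\<in>I. ennreal (f i))"
proof (induction I rule: infinite_finite_induct)
  case (insert i I)
  have "ennreal (f i + sum f I) \<le> ennreal (f i) + ennreal (sum f I)"
    by (rule ennreal_plus_le)
  also have "\<dots> \<le> ennreal (f i) + (\<Sum>i\<in>I. ennreal (f i))"
    using insert by (intro add_left_mono)
  finally show ?case using insert by simp
qed auto

text \<open>A functional on C(K) in disguise: L acts on continuous functions on the whole space, but
  by linearity and the bound it depends on their values on K alone. It may take either sign on
  nonnegative functions.\<close>

locale bounded_functional =
  fixes K :: "'a::metric_space set" and L :: "('a \<Rightarrow> real) \<Rightarrow> real" and C :: real
  assumes compact_K: "compact K"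
    and C_nonneg: "0 \<le> C"
    and L_add: "\<And>f g. continuous_on UNIV f \<Longrightarrow> continuous_on UNIV g \<Longrightarrow> L (\<lambda>x. f x + g x) = L f + L g"
    and L_scale: "\<And>f c. continuous_on UNIV f \<Longrightarrow> L (\<lambda>x. c * f x) = c * L f"
    and L_bound: "\<And>f B. continuous_on UNIV f \<Longrightarrow> 0 \<le> B \<Longrightarrow> (\<And>x. x \<in> K \<Longrightarrow> \<bar>f x\<bar> \<le> B) \<Longrightarrow> \<bar>L f\<bar> \<le> C * B"
begin

lemma L_zero: "L (\<lambda>x. 0) = 0"
  using L_scale[of "\<lambda>x. 0" 0] by simp

lemma L_diff:
  assumes "continuous_on UNIV f" "continuous_on UNIV g"
  shows "L (\<lambda>x. f x - g x) = L f - L g"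
proof -
  have "L (\<lambda>x. f x + (-1) * g x) = L f + L (\<lambda>x. (-1) * g x)"
    using assms by (intro L_add continuous_on_mult_left)
  also have "L (\<lambda>x. (-1) * g x) = (-1) * L g" using assms(2) by (rule L_scale)
  finally show ?thesis by simp
qed

lemma L_sum:
  assumes "\<And>i. i \<in> I \<Longrightarrow> continuous_on UNIV (f i)"
  shows "L (\<lambda>x. \<Sum>i\<in>I. f i x) = (\<Sum>i\<in>I. L (f i))"
  using assms
proof (induction I rule: infinite_finite_induct)
  case (insert i I)
  then have "L (\<lambda>x. f i x + (\<Sum>i\<in>I. f i x)) = L (f i) + L (\<lambda>x. \<Sum>i\<in>I. f i x)"
    by (intro L_add continuous_on_sum) auto
  with insert show ?case by simp
qed (simp_all add: L_zero)

lemma L_close: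
  assumes "continuous_on UNIV f" "continuous_on UNIV g" "0 \<le> e" "\<And>x. x \<in> K \<Longrightarrow> \<bar>f x - g x\<bar> \<le> e"
  shows "L f \<le> L g + C * e"
proof -
  have "\<bar>L (\<lambda>x. f x - g x)\<bar> \<le> C * e"
    using assms by (intro L_bound) (auto intro!: continuous_intros)
  with assms show ?thesis by (simp add: L_diff)
qed

section \<open>The outer measure generated by the functional on open sets\<close>

definition adm :: "'a set \<Rightarrow> ('a \<Rightarrow> real) \<Rightarrow> bool" where
  "adm U g \<longleftrightarrow> continuous_on UNIV g \<and> (\<forall>x. 0 \<le> g x \<and> g x \<le> 1) \<and> (\<forall>x. x \<notin> U \<longrightarrow> g x = 0)"

text \<open>For a functional without sign this is the positive variation on open sets:
  \<open>ennreal\<close> clips negative values, and g = 0 is always a candidate.\<close>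

definition content_open :: "'a set \<Rightarrow> ennreal" where
  "content_open U = (SUP g\<in>Collect (adm U). ennreal (L g))"

definition outer :: "'a set \<Rightarrow> ennreal" where
  "outer E = (INF U\<in>{U. open U \<and> E \<subseteq> U}. content_open U)"

lemma adm_zero: "adm U (\<lambda>x. 0)"
  by (auto simp: adm_def)

lemma adm_mono: "adm U g \<Longrightarrow> U \<subseteq> V \<Longrightarrow> adm V g"
  by (auto simp: adm_def)

lemma adm_L_le:
  assumes "adm U g"
  shows "\<bar>L g\<bar> \<le> C"
  using L_bound[of g 1] assms by (simp add: adm_def)

lemma content_open_upper: "adm U g \<Longrightarrow> ennreal (L g) \<le> content_open U"
  unfolding content_open_def by (rule SUP_upper) simp

lemma content_open_le: "content_open U \<le> ennreal C"
  unfolding content_open_def using adm_L_le by (intro SUP_least ennreal_leI) force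

lemma content_open_mono: "U \<subseteq> V \<Longrightarrow> content_open U \<le> content_open V"
  unfolding content_open_def by (intro SUP_subset_mono) (auto intro: adm_mono)

lemma outer_open: "open U \<Longrightarrow> outer U = content_open U"
  unfolding outer_def by (intro antisym INF_lower INF_greatest) (auto intro: content_open_mono)

lemma outer_le_content: "open U \<Longrightarrow> E \<subseteq> U \<Longrightarrow> outer E \<le> content_open U"
  unfolding outer_def by (intro INF_lower) auto

lemma outer_mono: "E \<subseteq> F \<Longrightarrow> outer E \<le> outer F"
  unfolding outer_def by (intro INF_superset_mono) auto

lemma outer_le: "outer E \<le> ennreal C"
  using outer_le_content[of UNIV E] content_open_le[of UNIV] by (simp add: order_trans)

text \<open>Because of the clipping, the sum f + g serves as a candidate only if both values are
  nonnegative; otherwise one summand is zero and the other function alone suffices.\<close>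

lemma ennreal_L_add_le:
  assumes "adm V f" "adm V g" "adm V (\<lambda>x. f x + g x)"
  shows "ennreal (L f) + ennreal (L g) \<le> content_open V"
proof -
  have s: "L (\<lambda>x. f x + g x) = L f + L g"
    using assms by (intro L_add) (auto simp: adm_def)
  consider "L f \<le> 0" | "L g \<le> 0" | "0 \<le> L f" "0 \<le> L g" by linarith
  then show ?thesis
  proof cases
    case 1
    then show ?thesis using content_open_upper[OF assms(2)] by (simp add: ennreal_neg)
  next
    case 2
    then show ?thesis using content_open_upper[OF assms(1)] by (simp add: ennreal_neg)
  next
    case 3
    then show ?thesis using content_open_upper[OF assms(3)] by (simp add: s)
  qed
qed

text \<open>The distance to the complement. The whole space is treated apart because
  \<open>infdist\<close> to the empty set is 0.\<close>

lemma open_gauge: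
  assumes "open (U :: 'a set)"
  obtains d :: "'a \<Rightarrow> real"
  where "continuous_on UNIV d" "\<And>x. 0 \<le> d x" "\<And>x. x \<in> U \<Longrightarrow> 0 < d x" "\<And>x. x \<notin> U \<Longrightarrow> d x = 0"
proof (cases "U = UNIV")
  case True
  show ?thesis by (rule that[of "\<lambda>x. 1"]) (auto simp: True)
next
  case False
  show ?thesis
  proof (rule that[of "\<lambda>x. infdist x (- U)"])
    show "0 < infdist x (- U)" if "x \<in> U" for x
      using that False assms by (intro infdist_pos_not_in_closed) auto
    show "continuous_on UNIV (\<lambda>x. infdist x (- U))"
      by (rule continuous_on_infdist[OF continuous_on_id])
  qed (simp_all add: infdist_nonneg)
qed

text \<open>An admissible function on a union is, up to a uniformly small error on the compact set,
  a finite sum of admissible functions on the members: Dini's theorem applied to the minima of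
  \<open>f\<close> with multiples of partial sums of distance functions.\<close>

lemma content_open_UN_le:
  assumes U: "\<And>i. open (U i)"
  shows "content_open (\<Union>i::nat. U i) \<le> (\<Sum>i. content_open (U i))"
proof -
  have "\<forall>i. \<exists>d :: 'a \<Rightarrow> real. continuous_on UNIV d \<and> (\<forall>x. 0 \<le> d x) \<and> (\<forall>x\<in>U i. 0 < d x) \<and> (\<forall>x. x \<notin> U i \<longrightarrow> d x = 0)"
    using open_gauge[OF U] by metis
  then obtain d :: "nat \<Rightarrow> 'a \<Rightarrow> real" where d: "\<And>i. continuous_on UNIV (d i)" "\<And>i x. 0 \<le> d i x"
    "\<And>i x. x \<in> U i \<Longrightarrow> 0 < d i x" "\<And>i x. x \<notin> U i \<Longrightarrow> d i x = 0"
    by metis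
  define s where "s n x = (\<Sum>k<n. d k x)" for n x
  have s_cont: "continuous_on UNIV (s n)" for n
    unfolding s_def using d by (intro continuous_on_sum) auto
  have s_Suc: "s (Suc n) x = s n x + d n x" for n x by (simp add: s_def)
  have s_mono: "s m x \<le> s n x" if "m \<le> n" for m n x
    unfolding s_def using d that by (intro sum_mono2) auto
  have s0: "s 0 x = 0" for x by (simp add: s_def)
  have s_nn: "0 \<le> s n x" for n x using s_mono[of 0 n x] s0 by simp
  show ?thesis
    unfolding content_open_def[of "\<Union> (range U)"]
  proof (rule SUP_least)
    fix f assume "f \<in> Collect (adm (\<Union> (range U)))"
    then have f: "continuous_on UNIV f" "\<And>x. 0 \<le> f x" "\<And>x. f x \<le> 1" "\<And>x. x \<notin> \<Union> (range U) \<Longrightarrow> f x = 0"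
      by (auto simp: adm_def)
    have fin: "ennreal (L (\<lambda>x. min (f x) (c * s n x))) \<le> (\<Sum>i. content_open (U i))" if c: "0 \<le> c" for n c
    proof -
      \<comment> \<open>These pieces telescope to the minimum of f and c times the n-th partial sum;
        the k-th piece can be nonzero only where d k is positive, that is on U k.\<close>
      define g where "g k x = min (f x) (c * s (Suc k) x) - min (f x) (c * s k x)" for k x
      have adm_g: "adm (U k) (g k)" for k
        unfolding adm_def
      proof (intro conjI allI impI)
        show "continuous_on UNIV (g k)"
          unfolding g_def using f s_cont by (intro continuous_intros) auto
        fix x
        have "c * s k x \<le> c * s (Suc k) x" using c s_mono[of k "Suc k" x] by (intro mult_left_mono) auto
        then show "0 \<le> g k x" by (auto simp: g_def)
        have "0 \<le> c * s k x" using c s_nn by simp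
        then show "g k x \<le> 1" using f(2,3)[of x] unfolding g_def by linarith
        show "g k x = 0" if "x \<notin> U k" using d(4)[OF that] by (simp add: g_def s_Suc)
      qed
      have "(\<Sum>k<n. g k x) = min (f x) (c * s n x)" for x
        unfolding g_def by (subst sum_lessThan_telescope) (simp add: s0 f)
      then have "L (\<lambda>x. min (f x) (c * s n x)) = (\<Sum>k<n. L (g k))"
        using L_sum[of "{..<n}" g] adm_g by (simp add: adm_def)
      also have "ennreal \<dots> \<le> (\<Sum>k<n. ennreal (L (g k)))" by (rule ennreal_sum_le)
      also have "\<dots> \<le> (\<Sum>k<n. content_open (U k))"
        by (intro sum_mono content_open_upper adm_g)
      also have "\<dots> \<le> (\<Sum>i. content_open (U i))"
        by (rule sum_le_suminf) auto
      finally show ?thesis .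
    qed
    have approx: "L f \<le> L (\<lambda>x. min (f x) (real N * s N x)) + C * e"
      if "e > 0" and N: "\<And>x. x \<in> K \<Longrightarrow> e \<le> f x \<Longrightarrow> f x \<le> real N * s N x" for e N
    proof (rule L_close)
      show "continuous_on UNIV (\<lambda>x. min (f x) (real N * s N x))"
        using f s_cont by (intro continuous_intros)
      fix x assume x: "x \<in> K"
      have "0 \<le> real N * s N x" using s_nn by simp
      then show "\<bar>f x - min (f x) (real N * s N x)\<bar> \<le> e"
        using N[OF x] f(2)[of x] that(1) by (cases "e \<le> f x") (auto simp: min_def)
    qed (use f that in auto)
    have ex: "\<exists>N. \<forall>x\<in>K. e \<le> f x \<longrightarrow> f x \<le> real N * s N x" if e: "e > 0" for e
    proof -
      \<comment> \<open>At each point where f \<ge> e some partial sum is positive, so these open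
        sets cover a compact set; as s n grows with n, one N replaces the finite subcover.\<close>
      define W where "W n = {x. 1 < real n * s n x}" for n
      have "closed {x. e \<le> f x}"
        using f by (intro closed_Collect_le) auto
      then have cK: "compact (K \<inter> {x. e \<le> f x})"
        using compact_K by (intro compact_Int_closed)
      have opW: "open (W n)" for n
        unfolding W_def using s_cont by (intro open_Collect_less continuous_intros)
      have cover: "K \<inter> {x. e \<le> f x} \<subseteq> (\<Union>n. W n)"
      proof
        fix x assume "x \<in> K \<inter> {x. e \<le> f x}"
        then have "f x \<noteq> 0" using e by auto
        then obtain i where "x \<in> U i" using f(4) by blast
        then have "0 < d i x" using d by blast
        then have p: "0 < s (Suc i) x" using s_nn[of i x] by (simp add: s_Suc)
        obtain m where m: "1 / s (Suc i) x < real m" using reals_Archimedean2 by blast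
        define n where "n = max m (Suc i)"
        have "1 < real m * s (Suc i) x" using m p by (simp add: field_simps)
        also have "\<dots> \<le> real n * s n x"
          using s_mono[of "Suc i" n x] p by (intro mult_mono) (auto simp: n_def)
        finally show "x \<in> (\<Union>n. W n)" by (auto simp: W_def)
      qed
      obtain F where F: "finite F" "K \<inter> {x. e \<le> f x} \<subseteq> (\<Union>n\<in>F. W n)"
        by (rule compactE_image[OF cK opW cover])
      define N where "N = Max (insert 0 F)"
      have "f x \<le> real N * s N x" if x: "x \<in> K" "e \<le> f x" for x
      proof -
        obtain n where n: "n \<in> F" "1 < real n * s n x" using F x by (auto simp: W_def)
        have "n \<le> N" using n F by (simp add: N_def)
        then have "real n * s n x \<le> real N * s N x"
          using s_mono[of n N x] s_nn by (intro mult_mono) auto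
        then show ?thesis using n f(3)[of x] by linarith
      qed
      then show ?thesis by blast
    qed
    show "ennreal (L f) \<le> (\<Sum>i. content_open (U i))"
    proof (rule ennreal_le_epsilon)
      fix e :: real assume e: "0 < e"
      \<comment> \<open>The denominator C + 1 ensures C e' \<le> e also for C = 0.\<close>
      define e' where "e' = e / (C + 1)"
      have e': "e' > 0" "C * e' \<le> e"
        using e C_nonneg by (auto simp: e'_def field_simps)
      obtain N where "\<forall>x\<in>K. e' \<le> f x \<longrightarrow> f x \<le> real N * s N x" using ex[OF e'(1)] by blast
      then have "L f \<le> L (\<lambda>x. min (f x) (real N * s N x)) + e"
        using approx[OF e'(1), of N] e' by fastforce
      then have "ennreal (L f) \<le> ennreal (L (\<lambda>x. min (f x) (real N * s N x)) + e)"
        by (rule ennreal_leI)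
      also have "\<dots> \<le> ennreal (L (\<lambda>x. min (f x) (real N * s N x))) + ennreal e"
        by (rule ennreal_plus_le)
      also have "\<dots> \<le> (\<Sum>i. content_open (U i)) + ennreal e"
        by (intro add_right_mono fin) simp
      finally show "ennreal (L f) \<le> (\<Sum>i. content_open (U i)) + ennreal e" .
    qed
  qed
qed

lemma outer_measure_space_outer: "outer_measure_space (Pow UNIV) outer"
  unfolding outer_measure_space_def
proof (intro conjI)
  have "content_open {} \<le> 0"
    unfolding content_open_def
  proof (rule SUP_least)
    fix g assume "g \<in> Collect (adm {})"
    then have "g = (\<lambda>x. 0)" by (auto simp: adm_def)
    then show "ennreal (L g) \<le> 0" by (simp add: L_zero)
  qed
  then show "positive (Pow UNIV) outer" by (simp add: positive_def outer_open)
  show "increasing (Pow UNIV) outer" by (simp add: increasing_def outer_mono)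
  show "countably_subadditive (Pow UNIV) outer"
    unfolding countably_subadditive_def
  proof (intro allI impI)
    fix A :: "nat \<Rightarrow> 'a set"
    show "outer (\<Union>i. A i) \<le> (\<Sum>i. outer (A i))"
    proof (rule ennreal_le_epsilon)
      fix e :: real assume e: "0 < e"
      \<comment> \<open>Finiteness of the outer measure makes the enlarged value strictly larger
        than the infimum; the errors e / 2^(n+1) sum to e.\<close>
      have "\<exists>U. open U \<and> A n \<subseteq> U \<and> content_open U \<le> outer (A n) + ennreal (e * (1/2) ^ Suc n)" for n
      proof -
        have "outer (A n) < top" using outer_le[of "A n"] by (simp add: order_le_less_trans)
        then have "outer (A n) < outer (A n) + ennreal (e * (1/2) ^ Suc n)"
          using e by (simp add: ennreal_zero_less_mult_iff)
        then show ?thesis unfolding outer_def[of "A n"] INF_less_iff by (auto intro: less_imp_le)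
      qed
      then obtain U where U: "\<And>n. open (U n)" "\<And>n. A n \<subseteq> U n"
        "\<And>n. content_open (U n) \<le> outer (A n) + ennreal (e * (1/2) ^ Suc n)" by metis
      have "outer (\<Union>i. A i) \<le> content_open (\<Union>i. U i)"
        using U by (intro outer_le_content) auto
      also have "\<dots> \<le> (\<Sum>i. content_open (U i))" by (intro content_open_UN_le U)
      also have "\<dots> \<le> (\<Sum>n. outer (A n) + ennreal (e * (1/2) ^ Suc n))"
        by (intro suminf_le U) auto
      also have "\<dots> = (\<Sum>n. outer (A n)) + (\<Sum>n. ennreal e * ennreal ((1/2) ^ Suc n))"
      proof -
        have "ennreal (e * (1/2) ^ Suc n) = ennreal e * ennreal ((1/2) ^ Suc n)" for n
          using e by (intro ennreal_mult) auto
        then show ?thesis by (simp only: suminf_add[OF summableI summableI])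
      qed
      also have "\<dots> = (\<Sum>n. outer (A n)) + ennreal e"
        unfolding ennreal_suminf_cmult
        by (subst suminf_ennreal_eq[OF zero_le_power power_half_series]) auto
      finally show "outer (\<Union>i. A i) \<le> (\<Sum>n. outer (A n)) + ennreal e" .
    qed
  qed
qed

text \<open>Caratheodory's condition for an open set. A function f admissible on U \<inter> V is
  lowered by e', so that it is positive only where f \<ge> e'. A function g admissible on V minus
  that closed set is never nonzero at the same point, so the sum is admissible on V and
  \<open>ennreal_L_add_le\<close> applies.\<close>

lemma outer_split_open:
  assumes U: "open U"
  shows "outer (U \<inter> E) + outer (- U \<inter> E) \<le> outer E"
  unfolding outer_def[of E]
proof (rule INF_greatest)
  fix V assume "V \<in> {U. open U \<and> E \<subseteq> U}"
  then have V: "open V" "E \<subseteq> V" by auto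
  have key: "ennreal (L f) + outer (V - U) \<le> content_open V" if f: "adm (U \<inter> V) f" for f
  proof (rule ennreal_le_epsilon)
    fix e :: real assume e: "0 < e"
    define e' where "e' = e / (C + 1)"
    have e': "e' > 0" "C * e' \<le> e"
      using e C_nonneg by (auto simp: e'_def field_simps)
    define f' where "f' x = max 0 (f x - e')" for x
    have adm_f': "adm V f'"
      unfolding adm_def
    proof (intro conjI allI impI)
      show "continuous_on UNIV f'"
        using f unfolding f'_def adm_def by (intro continuous_intros) auto
      fix x
      have "f x \<le> 1" using f by (simp add: adm_def)
      then show "f' x \<le> 1" "0 \<le> f' x" using e' by (auto simp: f'_def)
      show "f' x = 0" if "x \<notin> V"
      proof -
        have "f x = 0" using f that by (simp add: adm_def)
        then show ?thesis using e' by (simp add: f'_def)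
      qed
    qed
    have "closed {x. e' \<le> f x}"
      using f by (intro closed_Collect_le) (auto simp: adm_def)
    then have opW: "open (V - {x. e' \<le> f x})" using V by (intro open_Diff)
    \<comment> \<open>As f vanishes off U, removing the closed level set removes nothing of V -
      U.\<close>
    have "V - U \<subseteq> V - {x. e' \<le> f x}" using f e' by (auto simp: adm_def)
    then have "outer (V - U) \<le> content_open (V - {x. e' \<le> f x})"
      using opW by (intro outer_le_content)
    then have "ennreal (L f') + outer (V - U) \<le> ennreal (L f') + content_open (V - {x. e' \<le> f x})"
      by (rule add_left_mono)
    also have "\<dots> = (SUP g\<in>Collect (adm (V - {x. e' \<le> f x})). ennreal (L f') + ennreal (L g))"
      unfolding content_open_def using adm_zero by (intro ennreal_SUP_add_right) auto
    also have "\<dots> \<le> content_open V"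
    proof (rule SUP_least)
      fix g assume "g \<in> Collect (adm (V - {x. e' \<le> f x}))"
      then have g: "adm (V - {x. e' \<le> f x}) g" by simp
      have fg: "f' x = 0 \<or> g x = 0" for x
        using g by (cases "e' \<le> f x") (auto simp: adm_def f'_def)
      have "adm V (\<lambda>x. f' x + g x)"
        unfolding adm_def
      proof (intro conjI allI impI)
        show "continuous_on UNIV (\<lambda>x. f' x + g x)"
          using adm_f' g by (intro continuous_on_add) (auto simp: adm_def)
        fix x
        have "0 \<le> f' x" "0 \<le> g x" "f' x \<le> 1" "g x \<le> 1" using adm_f' g by (auto simp: adm_def)
        then show "0 \<le> f' x + g x" "f' x + g x \<le> 1" using fg[of x] by auto
        show "f' x + g x = 0" if "x \<notin> V" using adm_f' g that by (auto simp: adm_def)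
      qed
      then show "ennreal (L f') + ennreal (L g) \<le> content_open V"
        using adm_f' g by (intro ennreal_L_add_le) (auto intro: adm_mono)
    qed
    finally have 1: "ennreal (L f') + outer (V - U) \<le> content_open V" .
    have "L f \<le> L f' + C * e'"
    proof (rule L_close)
      show "\<bar>f x - f' x\<bar> \<le> e'" for x
      proof -
        have "0 \<le> f x" using f by (simp add: adm_def)
        then show ?thesis using e' by (auto simp: f'_def max_def)
      qed
    qed (use f adm_f' e' in \<open>auto simp: adm_def\<close>)
    then have "ennreal (L f) \<le> ennreal (L f' + e)" using e' by (intro ennreal_leI) simp
    also have "\<dots> \<le> ennreal (L f') + ennreal e" by (rule ennreal_plus_le)
    finally have "ennreal (L f) + outer (V - U) \<le> (ennreal (L f') + outer (V - U)) + ennreal e"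
      by (metis add_right_mono add.assoc add.commute)
    also have "\<dots> \<le> content_open V + ennreal e" using 1 by (rule add_right_mono)
    finally show "ennreal (L f) + outer (V - U) \<le> content_open V + ennreal e" .
  qed
  have "outer (U \<inter> E) + outer (- U \<inter> E) \<le> content_open (U \<inter> V) + outer (V - U)"
    using U V by (intro add_mono outer_le_content outer_mono) auto
  also have "\<dots> = (SUP f\<in>Collect (adm (U \<inter> V)). ennreal (L f) + outer (V - U))"
    unfolding content_open_def using adm_zero by (intro ennreal_SUP_add_left[symmetric]) auto
  also have "\<dots> \<le> content_open V" by (intro SUP_least key) simp
  finally show "outer (U \<inter> E) + outer (- U \<inter> E) \<le> content_open V" .
qed

text \<open>Caratheodory's construction: the sets that split every set additively form a
  sigma-algebra on which the outer measure is a measure, and it contains the open sets.\<close>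

lemma exists_measure:
  "\<exists>\<mu> :: 'a measure. sets \<mu> = sets borel \<and> finite_measure \<mu> \<and> (\<forall>U. open U \<longrightarrow> emeasure \<mu> U = content_open U)"
proof -
  let ?\<Lambda> = "lambda_system UNIV (Pow UNIV) outer"
  interpret P: sigma_algebra "UNIV :: 'a set" "Pow UNIV" by (rule sigma_algebra_Pow)
  have ms: "measure_space UNIV ?\<Lambda> outer"
    by (rule P.caratheodory_lemma[OF outer_measure_space_outer])
  then interpret S: sigma_algebra "UNIV :: 'a set" ?\<Lambda> by (simp add: measure_space_def)
  have "U \<in> ?\<Lambda>" if U: "open U" for U
  proof -
    have "outer (U \<inter> E) + outer ((UNIV - U) \<inter> E) = outer E" for E
    proof (rule antisym)
      show "outer (U \<inter> E) + outer ((UNIV - U) \<inter> E) \<le> outer E"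
        using outer_split_open[OF U, of E] by (simp add: Compl_eq_Diff_UNIV)
      have "subadditive (Pow UNIV) outer"
        using outer_measure_space_outer unfolding outer_measure_space_def
        by (intro P.countably_subadditive_subadditive) auto
      then have "outer ((U \<inter> E) \<union> ((UNIV - U) \<inter> E)) \<le> outer (U \<inter> E) + outer ((UNIV - U) \<inter> E)"
        by (rule subadditiveD) auto
      moreover have "(U \<inter> E) \<union> ((UNIV - U) \<inter> E) = E" by blast
      ultimately show "outer E \<le> outer (U \<inter> E) + outer ((UNIV - U) \<inter> E)" by simp
    qed
    then show ?thesis by (simp add: lambda_system_def)
  qed
  then have "sigma_sets UNIV {U. open U} \<subseteq> ?\<Lambda>"
    by (intro S.sigma_sets_subset) auto
  then have sub: "sets (borel :: 'a measure) \<subseteq> ?\<Lambda>" by (simp add: borel_def)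
  have ms': "measure_space UNIV (sets borel) outer"
    using measure_down[OF ms _ sub] sets.sigma_algebra_axioms[of "borel :: 'a measure"] by simp
  define \<mu> where "\<mu> = measure_of UNIV (sets (borel :: 'a measure)) outer"
  have sets: "sets \<mu> = sets borel"
    unfolding \<mu>_def by (metis sets.sets_measure_of_eq space_borel)
  have em: "emeasure \<mu> A = outer A" if "A \<in> sets borel" for A
    unfolding \<mu>_def
    by (rule emeasure_measure_of_sigma) (use ms' that in \<open>auto simp: measure_space_def\<close>)
  have "emeasure \<mu> (space \<mu>) \<noteq> \<infinity>"
    using em[of UNIV] outer_le[of UNIV] sets_eq_imp_space_eq[OF sets] by (auto simp: top_unique)
  then have "finite_measure \<mu>" by (rule finite_measureI)
  then show ?thesis using sets em outer_open by (intro exI[of _ \<mu>]) auto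
qed

end

section \<open>Comparison of the functional with its measure by horizontal layers\<close>

lemma layer_sum:
  fixes y :: real
  assumes "0 \<le> y"
  shows "(\<Sum>k<n. min 1 (max 0 (y - real k))) = min (real n) y"
proof (induction n)
  case (Suc n)
  have "min (real n) y + min 1 (max 0 (y - real n)) = min (real (Suc n)) y"
    by (auto simp: min_def max_def)
  with Suc show ?case by simp
qed (use assms in simp)

context bounded_functional
begin

context
  fixes \<mu> :: "'a measure"
  assumes sets_\<mu>: "sets \<mu> = sets borel" and finite_\<mu>: "finite_measure \<mu>"
    and em_\<mu>: "\<And>U. open U \<Longrightarrow> emeasure \<mu> U = content_open U"
begin

interpretation finite_measure \<mu> by (fact finite_\<mu>)

lemma measure_open_ge:
  assumes "adm U g" "open U"
  shows "L g \<le> measure \<mu> U"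
proof -
  have "ennreal (L g) \<le> ennreal (measure \<mu> U)"
    using content_open_upper[OF assms(1)] em_\<mu>[OF assms(2)] by (simp add: emeasure_eq_measure)
  then show ?thesis by (simp add: ennreal_le_iff)
qed

lemma measure_open_approx:
  assumes U: "open U" and e: "0 < e"
  shows "\<exists>g. adm U g \<and> measure \<mu> U - e \<le> L g"
proof (cases "measure \<mu> U \<le> e")
  case True
  then show ?thesis using adm_zero L_zero by (intro exI[of _ "\<lambda>x. 0"]) auto
next
  case False
  have "ennreal (measure \<mu> U - e) < ennreal (measure \<mu> U)"
    using e False by (intro ennreal_lessI) auto
  also have "\<dots> = (SUP g\<in>Collect (adm U). ennreal (L g))"
    using em_\<mu>[OF U] by (simp add: emeasure_eq_measure content_open_def)
  finally obtain g where g: "adm U g" "ennreal (measure \<mu> U - e) < ennreal (L g)"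
    unfolding less_SUP_iff by blast
  have "\<not> L g \<le> measure \<mu> U - e"
    using g(2) by (meson ennreal_leI not_le)
  then show ?thesis using g(1) by (intro exI[of _ g]) simp
qed

lemma integrable_continuous_bounded:
  assumes "continuous_on UNIV (f :: 'a \<Rightarrow> real)" "\<And>x. \<bar>f x\<bar> \<le> B"
  shows "integrable \<mu> f"
proof (rule integrable_const_bound)
  show "AE x in \<mu>. norm (f x) \<le> B" using assms by simp
  show "f \<in> borel_measurable \<mu>"
    using borel_measurable_continuous_onI[OF assms(1)] sets_\<mu> measurable_cong_sets by blast
qed

text \<open>The function n f is cut into slices of height one. Each slice lies between the
  indicators of two consecutive superlevel sets; these are open, so their measures are known from
  the functional.\<close>

lemma layers:
  assumes f: "continuous_on UNIV f" "\<And>x. 0 \<le> f x" "\<And>x. f x \<le> 1" and n: "0 < n"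
  defines "h \<equiv> \<lambda>k x. min 1 (max 0 (real n * f x - real k))"
  shows "\<And>k. adm {x. real k < real n * f x} (h k)"
    "\<And>k x. real (Suc k) < real n * f x \<Longrightarrow> h k x = 1"
    "\<And>x. (\<Sum>k<n. h k x) = real n * f x"
    "\<And>k. open {x. real k < real n * f x}"
    "(\<Sum>k<n. integral\<^sup>L \<mu> (h k)) = real n * integral\<^sup>L \<mu> f"
    "\<And>k. integral\<^sup>L \<mu> (h k) \<le> measure \<mu> {x. real k < real n * f x}"
    "\<And>k. measure \<mu> {x. real (Suc k) < real n * f x} \<le> integral\<^sup>L \<mu> (h k)"
proof -
  have h_cont: "continuous_on UNIV (h k)" for k
    unfolding h_def using f(1) by (intro continuous_intros)
  have int_h: "integrable \<mu> (h k)" for k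
    by (rule integrable_continuous_bounded[OF h_cont, of _ 1]) (auto simp: h_def)
  show op: "open {x. real k < real n * f x}" for k
    using f(1) by (intro open_Collect_less continuous_intros)
  have sets: "{x. real k < real n * f x} \<in> sets \<mu>" for k
    using op[of k] sets_\<mu> by auto
  have sp: "space \<mu> = UNIV" using sets_eq_imp_space_eq[OF sets_\<mu>] by simp
  have int_ind: "integrable \<mu> (indicat_real {x. real k < real n * f x})" for k
    using sets by (simp add: integrable_real_indicator emeasure_eq_measure)
  show adm: "adm {x. real k < real n * f x} (h k)" for k
    using h_cont by (auto simp: adm_def h_def)
  show one: "h k x = 1" if "real (Suc k) < real n * f x" for k x
    using that by (simp add: h_def)
  show sum_h: "(\<Sum>k<n. h k x) = real n * f x" for x
  proof -
    have "real n * f x \<le> real n * 1" using f(3) by (intro mult_left_mono) auto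
    then show ?thesis using layer_sum[of "real n * f x" n] f(2) by (simp add: h_def)
  qed
  have "(\<Sum>k<n. integral\<^sup>L \<mu> (h k)) = integral\<^sup>L \<mu> (\<lambda>x. \<Sum>k<n. h k x)"
    using int_h by (intro Bochner_Integration.integral_sum[symmetric]) auto
  then show "(\<Sum>k<n. integral\<^sup>L \<mu> (h k)) = real n * integral\<^sup>L \<mu> f" by (simp add: sum_h)
  show "integral\<^sup>L \<mu> (h k) \<le> measure \<mu> {x. real k < real n * f x}" for k
  proof -
    have "integral\<^sup>L \<mu> (h k) \<le> integral\<^sup>L \<mu> (indicat_real {x. real k < real n * f x})"
      using int_h int_ind by (intro integral_mono) (auto simp: h_def indicator_def)
    then show ?thesis by (simp add: sp)
  qed
  show "measure \<mu> {x. real (Suc k) < real n * f x} \<le> integral\<^sup>L \<mu> (h k)" for k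
  proof -
    have "integral\<^sup>L \<mu> (indicat_real {x. real (Suc k) < real n * f x}) \<le> integral\<^sup>L \<mu> (h k)"
    proof (rule integral_mono[OF int_ind int_h])
      fix x
      show "indicat_real {x. real (Suc k) < real n * f x} x \<le> h k x"
        using one[of k x] adm[of k] by (auto simp: indicator_def adm_def)
    qed
    then show ?thesis by (simp add: sp)
  qed
qed

text \<open>Passing to the next level costs one term, at most the total mass; after division by n
  this is the error of the layer method.\<close>

lemma sum_measure_shift:
  fixes m :: "nat \<Rightarrow> 'a set"
  assumes "0 < n"
  shows "(\<Sum>k<n. measure \<mu> (m k)) \<le> measure \<mu> (space \<mu>) + (\<Sum>k<n. measure \<mu> (m (Suc k)))"
proof -
  obtain j where j: "n = Suc j" using assms by (cases n) auto
  have "(\<Sum>k<n. measure \<mu> (m k)) = measure \<mu> (m 0) + (\<Sum>k<j. measure \<mu> (m (Suc k)))"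
    unfolding j by (rule sum.lessThan_Suc_shift)
  also have "\<dots> \<le> measure \<mu> (space \<mu>) + (\<Sum>k<n. measure \<mu> (m (Suc k)))"
    unfolding j by (intro add_mono bounded_measure sum_mono2) auto
  finally show ?thesis .
qed

text \<open>A slice is admissible for its superlevel set, and its integral dominates the measure of
  the next one. The shift between the two costs mass / n, which vanishes in the limit.\<close>

lemma functional_le_integral:
  assumes f: "continuous_on UNIV f" "\<And>x. 0 \<le> f x" "\<And>x. f x \<le> 1"
  shows "L f \<le> integral\<^sup>L \<mu> f"
proof -
  have bd: "L f \<le> integral\<^sup>L \<mu> f + measure \<mu> (space \<mu>) / real (Suc j)" for j
  proof -
    define n where "n = Suc j"
    have n: "0 < n" by (simp add: n_def)
    let ?h = "\<lambda>k x. min 1 (max 0 (real n * f x - real k))"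
    note lay = layers[OF f n]
    have "real n * L f = L (\<lambda>x. \<Sum>k<n. ?h k x)"
      using L_scale[OF f(1)] by (simp add: lay(3))
    also have "\<dots> = (\<Sum>k<n. L (?h k))"
      using lay(1) by (intro L_sum) (auto simp: adm_def)
    also have "\<dots> \<le> (\<Sum>k<n. measure \<mu> {x. real k < real n * f x})"
      by (intro sum_mono measure_open_ge lay)
    also have "\<dots> \<le> measure \<mu> (space \<mu>) + (\<Sum>k<n. measure \<mu> {x. real (Suc k) < real n * f x})"
      by (rule sum_measure_shift[OF n])
    also have "\<dots> \<le> measure \<mu> (space \<mu>) + (\<Sum>k<n. integral\<^sup>L \<mu> (?h k))"
      by (intro add_left_mono sum_mono lay)
    also have "\<dots> = measure \<mu> (space \<mu>) + real n * integral\<^sup>L \<mu> f" by (simp only: lay(5))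
    finally have "L f \<le> (measure \<mu> (space \<mu>) + real n * integral\<^sup>L \<mu> f) / real n"
      using n by (simp add: pos_le_divide_eq mult.commute)
    also have "\<dots> = integral\<^sup>L \<mu> f + measure \<mu> (space \<mu>) / real n"
      using n by (simp add: add_divide_distrib)
    finally show ?thesis by (simp only: n_def)
  qed
  have "(\<lambda>j. integral\<^sup>L \<mu> f + measure \<mu> (space \<mu>) / real (Suc j)) \<longlonglongrightarrow> integral\<^sup>L \<mu> f + 0"
    by (intro tendsto_add tendsto_const LIMSEQ_Suc lim_const_over_n)
  then show ?thesis using bd by (auto intro: LIMSEQ_le_const)
qed

text \<open>The integral of f plays the role of the positive part of L at f, the supremum of L g
  over 0 \<le> g \<le> f. The average of near-optimal functions for the superlevel sets is below f,
  because the k-th slice is already 1 wherever G k can be positive.\<close>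

lemma integral_attained:
  assumes f: "continuous_on UNIV f" "\<And>x. 0 \<le> f x" "\<And>x. f x \<le> 1" and e: "0 < e"
  shows "\<exists>g. continuous_on UNIV g \<and> (\<forall>x. 0 \<le> g x \<and> g x \<le> f x) \<and> integral\<^sup>L \<mu> f - e \<le> L g"
proof -
  \<comment> \<open>Half of e pays for the shift of levels, the other half for the defects e / 2 of
    the functions G k, which are averaged.\<close>
  obtain n where n: "0 < n" "measure \<mu> (space \<mu>) / real n \<le> e / 2"
  proof -
    obtain n where "2 * measure \<mu> (space \<mu>) / e < real n" using reals_Archimedean2 by blast
    then have "measure \<mu> (space \<mu>) / real (Suc n) \<le> e / 2"
      using e by (simp add: field_simps)
    then show ?thesis using that[of "Suc n"] by simp
  qed
  let ?h = "\<lambda>k x. min 1 (max 0 (real n * f x - real k))"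
  note lay = layers[OF f n(1)]
  have "\<forall>k. \<exists>g. adm {x. real (Suc k) < real n * f x} g \<and> measure \<mu> {x. real (Suc k) < real n * f x} - e / 2 \<le> L g"
    using measure_open_approx[OF lay(4), of "e / 2" "Suc _"] e by simp
  then obtain G where G: "\<And>k. adm {x. real (Suc k) < real n * f x} (G k)"
    "\<And>k. measure \<mu> {x. real (Suc k) < real n * f x} - e / 2 \<le> L (G k)" by metis
  define g where "g x = (1 / real n) * (\<Sum>k<n. G k x)" for x
  have G_cont: "continuous_on UNIV (\<lambda>x. \<Sum>k<n. G k x)"
    using G(1) by (intro continuous_on_sum) (auto simp: adm_def)
  have Gh: "G k x \<le> ?h k x" for k x
  proof (cases "real (Suc k) < real n * f x")
    case True
    then show ?thesis using lay(2)[OF True] G(1)[of k] by (simp add: adm_def)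
  next
    case False
    then have "G k x = 0" using G(1)[of k] by (simp add: adm_def)
    then show ?thesis by simp
  qed
  have "real n * integral\<^sup>L \<mu> f = (\<Sum>k<n. integral\<^sup>L \<mu> (?h k))" by (simp only: lay(5))
  also have "\<dots> \<le> (\<Sum>k<n. measure \<mu> {x. real k < real n * f x})"
    by (intro sum_mono lay)
  also have "\<dots> \<le> measure \<mu> (space \<mu>) + (\<Sum>k<n. measure \<mu> {x. real (Suc k) < real n * f x})"
    by (rule sum_measure_shift[OF n(1)])
  also have "(\<Sum>k<n. measure \<mu> {x. real (Suc k) < real n * f x}) \<le> (\<Sum>k<n. L (G k) + e / 2)"
    using G(2) by (intro sum_mono) (simp add: algebra_simps)
  also have "\<dots> = (\<Sum>k<n. L (G k)) + real n * (e / 2)" by (simp add: sum.distrib)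
  also have "(\<Sum>k<n. L (G k)) = L (\<lambda>x. \<Sum>k<n. G k x)"
    using G(1) by (intro L_sum[symmetric]) (auto simp: adm_def)
  also have "\<dots> = real n * L g"
    unfolding g_def using n(1) by (simp add: L_scale[OF G_cont] del: times_divide_eq_left)
  finally have "real n * integral\<^sup>L \<mu> f \<le> real n * (measure \<mu> (space \<mu>) / real n + L g + e / 2)"
    using n(1) by (simp add: algebra_simps)
  then have "integral\<^sup>L \<mu> f \<le> measure \<mu> (space \<mu>) / real n + L g + e / 2"
    using n(1) by (simp only: mult_le_cancel_left_pos of_nat_0_less_iff)
  with n(2) have 1: "integral\<^sup>L \<mu> f - e \<le> L g" by linarith
  have 2: "continuous_on UNIV g"
    unfolding g_def by (intro continuous_on_mult_left G_cont)
  have 3: "0 \<le> g x" for x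
    unfolding g_def using G(1) by (intro mult_nonneg_nonneg sum_nonneg) (auto simp: adm_def)
  have 4: "g x \<le> f x" for x
  proof -
    have "(\<Sum>k<n. G k x) \<le> real n * f x"
      using sum_mono[of "{..<n}" "\<lambda>k. G k x" "\<lambda>k. ?h k x"] Gh lay(3)[of x] by simp
    then show ?thesis using n(1) by (simp add: g_def field_simps)
  qed
  show ?thesis using 1 2 3 4 by blast
qed

end

lemma bounded_functional_uminus: "bounded_functional K (\<lambda>f. - L f) C"
proof
  show "\<bar>- L f\<bar> \<le> C * B" if "continuous_on UNIV f" "0 \<le> B" "\<And>x. x \<in> K \<Longrightarrow> \<bar>f x\<bar> \<le> B" for f B
    using L_bound[OF that] by simp
qed (auto simp: compact_K C_nonneg L_add L_scale)

text \<open>A function admissible for the complement vanishes on K, so the bound on L applies with B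
  = 0.\<close>

lemma null_outside:
  assumes "\<And>U. open U \<Longrightarrow> emeasure \<mu> U = content_open U"
  shows "emeasure \<mu> (- K) = 0"
proof -
  have "content_open (- K) \<le> 0"
    unfolding content_open_def
  proof (rule SUP_least)
    fix g assume "g \<in> Collect (adm (- K))"
    then have "\<bar>L g\<bar> \<le> C * 0" by (intro L_bound) (auto simp: adm_def)
    then show "ennreal (L g) \<le> 0" by simp
  qed
  then show ?thesis using assms[of "- K"] compact_imp_closed[OF compact_K] by (simp add: open_Compl)
qed

text \<open>The two measures represent the positive and the negative part of \<open>L\<close>; subtracting an
  almost optimal minorant of \<open>f\<close> for the one leaves an estimate for the other.\<close>

theorem riesz_representation:
  "\<exists>p n :: 'a measure. sets p = sets borel \<and> sets n = sets borel \<and> finite_measure p \<and> finite_measure n \<and>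
     emeasure p (- K) = 0 \<and> emeasure n (- K) = 0 \<and>
     (\<forall>f B. continuous_on UNIV f \<longrightarrow> (\<forall>x. \<bar>f x\<bar> \<le> B) \<longrightarrow> L f = integral\<^sup>L p f - integral\<^sup>L n f)"
proof -
  interpret N: bounded_functional K "\<lambda>f. - L f" C by (rule bounded_functional_uminus)
  obtain p where p: "sets p = sets borel" "finite_measure p" "\<And>U. open U \<Longrightarrow> emeasure p U = content_open U"
    using exists_measure by blast
  obtain n where n: "sets n = sets borel" "finite_measure n" "\<And>U. open U \<Longrightarrow> emeasure n U = N.content_open U"
    using N.exists_measure by blast
  have eq1: "L f = integral\<^sup>L p f - integral\<^sup>L n f"
    if f: "continuous_on UNIV f" "\<And>x. 0 \<le> f x" "\<And>x. f x \<le> 1" for f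
  proof (rule antisym)
    have ip: "integrable p f" by (rule integrable_continuous_bounded[OF p f(1), of 1]) (use f in auto)
    have in': "integrable n f" by (rule N.integrable_continuous_bounded[OF n f(1), of 1]) (use f in auto)
    show "L f \<le> integral\<^sup>L p f - integral\<^sup>L n f"
    proof (rule field_le_epsilon)
      fix e :: real assume "0 < e"
      then obtain g where g: "continuous_on UNIV g" "\<And>x. 0 \<le> g x" "\<And>x. g x \<le> f x" "integral\<^sup>L n f - e \<le> - L g"
        using N.integral_attained[OF n f] by blast
      have "L f - L g = L (\<lambda>x. f x - g x)" using L_diff[OF f(1) g(1)] by simp
      also have "\<dots> \<le> integral\<^sup>L p (\<lambda>x. f x - g x)"
      proof (rule functional_le_integral[OF p])
        fix x show "0 \<le> f x - g x" "f x - g x \<le> 1" using g(2,3)[of x] f(3)[of x] by auto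
      qed (assumption | intro continuous_on_diff f g)+
      also have "\<dots> \<le> integral\<^sup>L p f"
      proof (rule integral_mono[OF _ ip])
        show "integrable p (\<lambda>x. f x - g x)"
        proof (rule integrable_continuous_bounded[OF p, of _ 1])
          show "\<bar>f x - g x\<bar> \<le> 1" for x using g(2,3)[of x] f(2,3)[of x] by auto
        qed (assumption | intro continuous_on_diff f g)+
      qed (use g in simp)
      finally show "L f \<le> integral\<^sup>L p f - integral\<^sup>L n f + e" using g(4) by simp
    qed
    show "integral\<^sup>L p f - integral\<^sup>L n f \<le> L f"
    proof (rule field_le_epsilon)
      fix e :: real assume "0 < e"
      then obtain g where g: "continuous_on UNIV g" "\<And>x. 0 \<le> g x" "\<And>x. g x \<le> f x" "integral\<^sup>L p f - e \<le> L g"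
        using integral_attained[OF p f] by blast
      have "- (L f - L g) = - L (\<lambda>x. f x - g x)" using L_diff[OF f(1) g(1)] by simp
      also have "\<dots> \<le> integral\<^sup>L n (\<lambda>x. f x - g x)"
      proof (rule N.functional_le_integral[OF n])
        fix x show "0 \<le> f x - g x" "f x - g x \<le> 1" using g(2,3)[of x] f(3)[of x] by auto
      qed (assumption | intro continuous_on_diff f g)+
      also have "\<dots> \<le> integral\<^sup>L n f"
      proof (rule integral_mono[OF _ in'])
        show "integrable n (\<lambda>x. f x - g x)"
        proof (rule N.integrable_continuous_bounded[OF n, of _ 1])
          show "\<bar>f x - g x\<bar> \<le> 1" for x using g(2,3)[of x] f(2,3)[of x] by auto
        qed (assumption | intro continuous_on_diff f g)+
      qed (use g in simp)
      finally show "integral\<^sup>L p f - integral\<^sup>L n f \<le> L f + e" using g(4) by simp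
    qed
  qed
  have "L f = integral\<^sup>L p f - integral\<^sup>L n f"
    if f: "continuous_on UNIV f" "\<forall>x. \<bar>f x\<bar> \<le> B" for f B
  proof -
    \<comment> \<open>An affine change takes [-b, b] to [0, 1]; the summand 1 excludes division by
      zero.\<close>
    define b where "b = \<bar>B\<bar> + 1"
    have b: "b > 0" "\<And>x. \<bar>f x\<bar> \<le> b" using f(2) by (auto simp: b_def intro: order_trans)
    let ?g = "\<lambda>x. (1 / (2 * b)) * f x + 1 / 2"
    have c: "continuous_on UNIV (\<lambda>x. (1 / (2 * b)) * f x)" using f(1) by (rule continuous_on_mult_left)
    have "L ?g = integral\<^sup>L p ?g - integral\<^sup>L n ?g"
    proof (rule eq1)
      show "0 \<le> ?g x" "?g x \<le> 1" for x
        using b(2)[of x] b(1) by (auto simp: field_simps abs_le_iff)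
    qed (intro continuous_on_add c continuous_on_const)
    moreover have "L ?g = (1 / (2 * b)) * L f + L (\<lambda>x. 1 / 2)"
      unfolding L_add[OF c continuous_on_const] by (simp only: L_scale[OF f(1)])
    moreover have "L (\<lambda>x. 1 / 2) = integral\<^sup>L p (\<lambda>x. 1 / 2) - integral\<^sup>L n (\<lambda>x. 1 / 2)"
      by (rule eq1) auto
    moreover have "integral\<^sup>L p ?g = (1 / (2 * b)) * integral\<^sup>L p f + integral\<^sup>L p (\<lambda>x. 1 / 2)"
      using integrable_continuous_bounded[OF p f(1) b(2)]
        integrable_continuous_bounded[OF p continuous_on_const, of "1 / 2" "1 / 2"]
      by (subst Bochner_Integration.integral_add) auto
    moreover have "integral\<^sup>L n ?g = (1 / (2 * b)) * integral\<^sup>L n f + integral\<^sup>L n (\<lambda>x. 1 / 2)"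
      using N.integrable_continuous_bounded[OF n f(1) b(2)]
        N.integrable_continuous_bounded[OF n continuous_on_const, of "1 / 2" "1 / 2"]
      by (subst Bochner_Integration.integral_add) auto
    ultimately have "(1 / (2 * b)) * L f = (1 / (2 * b)) * (integral\<^sup>L p f - integral\<^sup>L n f)"
      by (simp only: right_diff_distrib)
    then show ?thesis using b(1) by simp
  qed
  then show ?thesis
    using p n null_outside[OF p(3)] N.null_outside[OF n(3)] by blast
qed

end

section \<open>Complex measures\<close>

text \<open>Values are finite by type; that the variation is finite has to be derived from countable
  additivity.\<close>

definition signed_measure :: "'s measure \<Rightarrow> ('s set \<Rightarrow> real) \<Rightarrow> bool" where
  "signed_measure M \<rho> \<longleftrightarrow> (\<forall>A :: nat \<Rightarrow> 's set.
     range A \<subseteq> sets M \<longrightarrow> disjoint_family A \<longrightarrow> (\<lambda>n. \<rho> (A n)) sums \<rho> (\<Union>n. A n))"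

lemma signed_measureD:
  "signed_measure M \<rho> \<Longrightarrow> range A \<subseteq> sets M \<Longrightarrow> disjoint_family A \<Longrightarrow> (\<lambda>n. \<rho> (A n)) sums \<rho> (\<Union>n. A n)"
  by (auto simp: signed_measure_def)

lemma signed_measure_uminus: "signed_measure M \<rho> \<Longrightarrow> signed_measure M (\<lambda>E. - \<rho> E)"
  by (auto simp: signed_measure_def intro: sums_minus)

lemma complex_measures_signed:
  assumes "\<nu> \<in> complex_measures M"
  shows "signed_measure M (\<lambda>E. Re (\<nu> E))" "signed_measure M (\<lambda>E. Im (\<nu> E))"
  using assms by (auto simp: signed_measure_def complex_measures_def sums_complex_iff)

lemma signed_measure_empty:
  assumes "signed_measure M \<rho>"
  shows "\<rho> {} = 0"
proof -
  have "(\<lambda>n::nat. \<rho> {}) sums \<rho> {}"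
    using signed_measureD[OF assms, of "\<lambda>n. {}"] by (auto simp: disjoint_family_on_def)
  then show ?thesis using sums_summable summable_const_iff by blast
qed

lemma signed_measure_Un:
  assumes \<rho>: "signed_measure M \<rho>" and "A \<in> sets M" "B \<in> sets M" "A \<inter> B = {}"
  shows "\<rho> (A \<union> B) = \<rho> A + \<rho> B"
proof -
  have "(\<lambda>n. \<rho> (binaryset A B n)) sums \<rho> (\<Union>n. binaryset A B n)"
    using assms by (intro signed_measureD[OF \<rho>]) (auto simp: range_binaryset_eq disjoint_family_on_def binaryset_def)
  moreover have "(\<lambda>n. \<rho> (binaryset A B n)) sums (\<rho> A + \<rho> B)"
    using signed_measure_empty[OF \<rho>] by (rule binaryset_sums)
  ultimately show ?thesis using sums_unique2 by (auto simp: UN_binaryset_eq)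
qed

lemma signed_measure_Diff:
  assumes \<rho>: "signed_measure M \<rho>" and "A \<in> sets M" "B \<in> sets M" "B \<subseteq> A"
  shows "\<rho> A = \<rho> B + \<rho> (A - B)"
  using signed_measure_Un[OF \<rho>, of B "A - B"] assms by (simp add: Un_absorb1 sets.Diff)

section \<open>The positive variation as a finite measure\<close>

definition pos_variation :: "'s measure \<Rightarrow> ('s set \<Rightarrow> real) \<Rightarrow> 's set \<Rightarrow> ennreal" where
  "pos_variation M \<rho> E = (SUP B\<in>{B \<in> sets M. B \<subseteq> E}. ennreal (\<rho> B))"

lemma pos_variation_upper: "B \<in> sets M \<Longrightarrow> B \<subseteq> E \<Longrightarrow> ennreal (\<rho> B) \<le> pos_variation M \<rho> E"
  unfolding pos_variation_def by (rule SUP_upper) simp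

lemma pos_variation_mono: "E \<subseteq> F \<Longrightarrow> pos_variation M \<rho> E \<le> pos_variation M \<rho> F"
  unfolding pos_variation_def by (intro SUP_subset_mono) auto

text \<open>Negative values are clipped, so the union of two candidates is used only when both
  values are nonnegative; otherwise one candidate alone does it.\<close>

lemma pos_variation_superadditive:
  assumes \<rho>: "signed_measure M \<rho>" and EF: "E \<inter> F = {}"
  shows "pos_variation M \<rho> E + pos_variation M \<rho> F \<le> pos_variation M \<rho> (E \<union> F)"
proof -
  have ne: "{B \<in> sets M. B \<subseteq> X} \<noteq> {}" for X by blast
  have 1: "ennreal (\<rho> A) + ennreal (\<rho> B) \<le> pos_variation M \<rho> (E \<union> F)"
    if A: "A \<in> sets M" "A \<subseteq> E" and B: "B \<in> sets M" "B \<subseteq> F" for A B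
  proof -
    consider "\<rho> A \<le> 0" | "\<rho> B \<le> 0" | "0 \<le> \<rho> A" "0 \<le> \<rho> B" by linarith
    then show ?thesis
    proof cases
      case 1
      then show ?thesis using pos_variation_upper[of B M "E \<union> F" \<rho>] B by (simp add: ennreal_neg le_supI2)
    next
      case 2
      then show ?thesis using pos_variation_upper[of A M "E \<union> F" \<rho>] A by (simp add: ennreal_neg le_supI1)
    next
      case 3
      have "\<rho> (A \<union> B) = \<rho> A + \<rho> B" using A B EF by (intro signed_measure_Un[OF \<rho>]) auto
      moreover have "ennreal (\<rho> (A \<union> B)) \<le> pos_variation M \<rho> (E \<union> F)"
        using A B by (intro pos_variation_upper) auto
      ultimately show ?thesis using 3 by simp
    qed
  qed
  have 2: "ennreal (\<rho> A) + pos_variation M \<rho> F \<le> pos_variation M \<rho> (E \<union> F)"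
    if A: "A \<in> sets M" "A \<subseteq> E" for A
    unfolding pos_variation_def[of M \<rho> F] ennreal_SUP_add_right[OF ne]
    by (intro SUP_least 1 A) auto
  show ?thesis
    unfolding pos_variation_def[of M \<rho> E] ennreal_SUP_add_left[OF ne, symmetric]
    by (intro SUP_least 2) auto
qed

lemma pos_variation_empty:
  assumes "signed_measure M \<rho>"
  shows "pos_variation M \<rho> {} = 0"
proof -
  have "{B \<in> sets M. B \<subseteq> {}} = {{}}" by auto
  then show ?thesis unfolding pos_variation_def using signed_measure_empty[OF assms] by simp
qed

text \<open>Finite superadditivity gives one inequality in the limit. For the other, a candidate B
  inside the union is cut into the parts B \<inter> A i, on whose values the signed measure is
  countably additive.\<close>

lemma pos_variation_countably_additive:
  assumes \<rho>: "signed_measure M \<rho>"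
  shows "countably_additive (sets M) (pos_variation M \<rho>)"
proof (rule countably_additiveI)
  fix A :: "nat \<Rightarrow> 'a set" assume A: "range A \<subseteq> sets M" "disjoint_family A" "(\<Union>i. A i) \<in> sets M"
  show "(\<Sum>i. pos_variation M \<rho> (A i)) = pos_variation M \<rho> (\<Union>i. A i)"
  proof (rule antisym)
    have "(\<Sum>i<n. pos_variation M \<rho> (A i)) \<le> pos_variation M \<rho> (\<Union>i<n. A i)" for n
    proof (induction n)
      case (Suc n)
      have disj: "(\<Union>i<n. A i) \<inter> A n = {}"
      proof -
        have "A i \<inter> A n = {}" if "i < n" for i
          using disjoint_family_onD[OF A(2), of i n] that by simp
        then show ?thesis by blast
      qed
      have "(\<Sum>i<Suc n. pos_variation M \<rho> (A i)) \<le> pos_variation M \<rho> (\<Union>i<n. A i) + pos_variation M \<rho> (A n)"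
        using Suc by (simp add: add_right_mono)
      also have "\<dots> \<le> pos_variation M \<rho> ((\<Union>i<n. A i) \<union> A n)"
        by (rule pos_variation_superadditive[OF \<rho> disj])
      also have "(\<Union>i<n. A i) \<union> A n = (\<Union>i<Suc n. A i)" by (auto simp: less_Suc_eq)
      finally show ?case .
    qed simp
    then have "(\<Sum>i<n. pos_variation M \<rho> (A i)) \<le> pos_variation M \<rho> (\<Union>i. A i)" for n
      by (rule order_trans) (intro pos_variation_mono UN_mono; simp)
    then show "(\<Sum>i. pos_variation M \<rho> (A i)) \<le> pos_variation M \<rho> (\<Union>i. A i)"
      unfolding suminf_eq_SUP by (intro SUP_least)
    show "pos_variation M \<rho> (\<Union>i. A i) \<le> (\<Sum>i. pos_variation M \<rho> (A i))"
      unfolding pos_variation_def[of M \<rho> "\<Union>i. A i"]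
    proof (rule SUP_least)
      fix B assume "B \<in> {B \<in> sets M. B \<subseteq> (\<Union>i. A i)}"
      then have B: "B \<in> sets M" "B = (\<Union>i. B \<inter> A i)" by auto
      have BA: "B \<inter> A i \<in> sets M" for i using A(1) B(1) by auto
      have "(\<lambda>i. \<rho> (B \<inter> A i)) sums \<rho> (\<Union>i. B \<inter> A i)"
        using A BA by (intro signed_measureD[OF \<rho>]) (auto simp: disjoint_family_on_def)
      then have "(\<lambda>n. ennreal (\<Sum>i<n. \<rho> (B \<inter> A i))) \<longlonglongrightarrow> ennreal (\<rho> B)"
        using B(2) unfolding sums_def by (intro tendsto_ennrealI) simp
      moreover have "ennreal (\<Sum>i<n. \<rho> (B \<inter> A i)) \<le> (\<Sum>i. pos_variation M \<rho> (A i))" for n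
      proof -
        have "ennreal (\<Sum>i<n. \<rho> (B \<inter> A i)) \<le> (\<Sum>i<n. ennreal (\<rho> (B \<inter> A i)))"
          by (rule ennreal_sum_le)
        also have "\<dots> \<le> (\<Sum>i<n. pos_variation M \<rho> (A i))"
          using BA by (intro sum_mono pos_variation_upper) auto
        also have "\<dots> \<le> (\<Sum>i. pos_variation M \<rho> (A i))" by (rule sum_le_suminf) auto
        finally show ?thesis .
      qed
      ultimately show "ennreal (\<rho> B) \<le> (\<Sum>i. pos_variation M \<rho> (A i))"
        by (intro LIMSEQ_le_const2) auto
    qed
  qed
qed

text \<open>\<open>jordan_pos\<close> is built by \<open>measure_of\<close>, and the values of the
  generating set function can be read off once that function is known to be a measure.\<close>

lemma jordan_pos_measure:
  assumes \<rho>: "signed_measure M \<rho>"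
  shows "sets (jordan_pos M \<rho>) = sets M" "space (jordan_pos M \<rho>) = space M"
    "\<And>E. E \<in> sets M \<Longrightarrow> emeasure (jordan_pos M \<rho>) E = pos_variation M \<rho> E"
proof -
  have eq: "jordan_pos M \<rho> = measure_of (space M) (sets M) (pos_variation M \<rho>)"
    unfolding jordan_pos_def pos_variation_def[abs_def] ..
  show "sets (jordan_pos M \<rho>) = sets M" "space (jordan_pos M \<rho>) = space M"
    unfolding eq by (simp_all add: sets.sets_measure_of_eq sets.space_measure_of_eq)
  show "emeasure (jordan_pos M \<rho>) E = pos_variation M \<rho> E" if "E \<in> sets M" for E
    unfolding eq
    by (rule emeasure_measure_of_sigma)
      (use that pos_variation_empty[OF \<rho>] pos_variation_countably_additive[OF \<rho>] sets.sigma_algebra_axioms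
        in \<open>auto simp: positive_def\<close>)
qed

text \<open>A set of infinite variation could be shrunk again and again, cutting off pieces of measure at
  least one in absolute value.\<close>

lemma finite_measure_jordan_pos:
  assumes \<rho>: "signed_measure M \<rho>"
  shows "finite_measure (jordan_pos M \<rho>)"
proof (rule finite_measureI)
  let ?P = "pos_variation M \<rho>"
  have step: "\<exists>E'. (E' \<in> sets M \<and> ?P E' = \<infinity>) \<and> E' \<subseteq> E \<and> 1 \<le> \<bar>\<rho> (E - E')\<bar>"
    if E: "E \<in> sets M \<and> ?P E = \<infinity>" for E
  proof -
    \<comment> \<open>The surplus over |\<rho> E| forces \<rho> B > 1 and \<rho> (E - B) < -1. So
      whichever of B and E - B keeps infinite variation, the part cut off has measure at least 1 in
      absolute value.\<close>
    have "ennreal (\<bar>\<rho> E\<bar> + 1) < ?P E" using E by (simp add: less_top)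
    then obtain B where B: "B \<in> sets M" "B \<subseteq> E" "ennreal (\<bar>\<rho> E\<bar> + 1) < ennreal (\<rho> B)"
      unfolding pos_variation_def less_SUP_iff by auto
    have b: "\<bar>\<rho> E\<bar> + 1 < \<rho> B" using B(3) by (meson ennreal_leI not_le)
    have d: "\<rho> E = \<rho> B + \<rho> (E - B)" using E B by (intro signed_measure_Diff[OF \<rho>]) auto
    have EB: "E - B \<in> sets M" using E B by auto
    have "emeasure (jordan_pos M \<rho>) (B \<union> (E - B)) = emeasure (jordan_pos M \<rho>) B + emeasure (jordan_pos M \<rho>) (E - B)"
      using B EB by (intro plus_emeasure[symmetric]) (auto simp: jordan_pos_measure[OF \<rho>])
    then have "?P E = ?P B + ?P (E - B)"
      using E B EB by (simp add: jordan_pos_measure(3)[OF \<rho>] Un_absorb1)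
    then consider "?P B = \<infinity>" | "?P (E - B) = \<infinity>"
      using E ennreal_add_eq_top[of "?P B" "?P (E - B)"] by (metis infinity_ennreal_def)
    then show ?thesis
    proof cases
      case 1
      then show ?thesis using B b d by (intro exI[of _ B]) auto
    next
      case 2
      have "E - (E - B) = B" using B by blast
      then show ?thesis using 2 EB b by (intro exI[of _ "E - B"]) auto
    qed
  qed
  have "?P (space M) \<noteq> \<infinity>"
  proof
    assume inf: "?P (space M) = \<infinity>"
    obtain E where E: "\<And>n. E n \<in> sets M \<and> ?P (E n) = \<infinity>"
      "\<And>n. E (Suc n) \<subseteq> E n \<and> 1 \<le> \<bar>\<rho> (E n - E (Suc n))\<bar>"
      using dependent_nat_choice[where P="\<lambda>n E. E \<in> sets M \<and> ?P E = \<infinity>"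
          and Q="\<lambda>n E E'. E' \<subseteq> E \<and> 1 \<le> \<bar>\<rho> (E - E')\<bar>"] inf step sets.top by metis
    have dec: "E n \<subseteq> E m" if "m \<le> n" for m n
      using lift_Suc_antimono_le[of E m n] E(2) that by auto
    have "disjoint_family (\<lambda>n. E n - E (Suc n))"
      unfolding disjoint_family_on_def
    proof (intro ballI impI)
      fix m n :: nat assume "m \<noteq> n"
      then consider "Suc m \<le> n" | "Suc n \<le> m" by linarith
      then show "(E m - E (Suc m)) \<inter> (E n - E (Suc n)) = {}"
        by cases (use dec in blast)+
    qed
    \<comment> \<open>The pieces cut off are disjoint, so their measures form a convergent series,
      against the lower bound 1.\<close>
    then have "summable (\<lambda>n. \<rho> (E n - E (Suc n)))"
      using E(1) by (intro sums_summable[OF signed_measureD[OF \<rho>]]) auto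
    then have "(\<lambda>n. \<rho> (E n - E (Suc n))) \<longlonglongrightarrow> 0" by (rule summable_LIMSEQ_zero)
    then have "(\<lambda>n. \<bar>\<rho> (E n - E (Suc n))\<bar>) \<longlonglongrightarrow> 0" by (rule tendsto_rabs_zero)
    then have "(1::real) \<le> 0" using E(2) by (intro LIMSEQ_le_const) auto
    then show False by simp
  qed
  then show "emeasure (jordan_pos M \<rho>) (space (jordan_pos M \<rho>)) \<noteq> \<infinity>"
    by (simp add: jordan_pos_measure[OF \<rho>])
qed

text \<open>No Hahn decomposition is involved: for B \<subseteq> E one has \<rho> B = \<rho> E -
  \<rho> (E - B) \<le> \<rho> E + n, with n the negative variation of E. The supremum over B gives
  one inequality, the same argument for - \<rho> the other.\<close>

lemma jordan_decomposition:
  assumes \<rho>: "signed_measure M \<rho>" and E: "E \<in> sets M"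
  shows "\<rho> E = measure (jordan_pos M \<rho>) E - measure (jordan_pos M (\<lambda>E. - \<rho> E)) E"
proof -
  have le: "measure (jordan_pos M \<rho>) E \<le> \<rho> E + measure (jordan_pos M (\<lambda>E. - \<rho> E)) E"
    if \<rho>: "signed_measure M \<rho>" for \<rho>
  proof -
    have \<rho>': "signed_measure M (\<lambda>E. - \<rho> E)" using \<rho> by (rule signed_measure_uminus)
    interpret P: finite_measure "jordan_pos M \<rho>" by (rule finite_measure_jordan_pos[OF \<rho>])
    interpret N: finite_measure "jordan_pos M (\<lambda>E. - \<rho> E)" by (rule finite_measure_jordan_pos[OF \<rho>'])
    let ?n = "measure (jordan_pos M (\<lambda>E. - \<rho> E)) E"
    have low: "- \<rho> B \<le> ?n" if "B \<in> sets M" "B \<subseteq> E" for B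
    proof -
      have "ennreal (- \<rho> B) \<le> ennreal ?n"
        using pos_variation_upper[OF that, of "\<lambda>E. - \<rho> E"] jordan_pos_measure(3)[OF \<rho>' E]
        by (simp add: N.emeasure_eq_measure)
      then show ?thesis by (simp add: ennreal_le_iff)
    qed
    have "ennreal (measure (jordan_pos M \<rho>) E) = pos_variation M \<rho> E"
      using jordan_pos_measure(3)[OF \<rho> E] by (simp add: P.emeasure_eq_measure)
    also have "\<dots> \<le> ennreal (\<rho> E + ?n)"
      unfolding pos_variation_def
    proof (rule SUP_least)
      fix B assume "B \<in> {B \<in> sets M. B \<subseteq> E}"
      then have B: "B \<in> sets M" "B \<subseteq> E" by auto
      then have "\<rho> E = \<rho> B + \<rho> (E - B)" using E by (intro signed_measure_Diff[OF \<rho>]) auto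
      moreover have "- \<rho> (E - B) \<le> ?n" using B E by (intro low) auto
      ultimately show "ennreal (\<rho> B) \<le> ennreal (\<rho> E + ?n)" by (intro ennreal_leI) simp
    qed
    finally show ?thesis using low[OF E] by (simp add: ennreal_le_iff)
  qed
  show ?thesis using le[OF \<rho>] le[OF signed_measure_uminus[OF \<rho>]] by simp
qed

text \<open>The equality of two differences is written with sums, since differences in
  \<open>ennreal\<close> are truncated; it passes from sets to functions by the induction that
  builds measurable functions.\<close>

lemma nn_integral_balance:
  assumes sets: "sets p = sets M" "sets n = sets M" "sets a = sets M" "sets b = sets M"
    and eq: "\<And>E. E \<in> sets M \<Longrightarrow> emeasure p E + emeasure b E = emeasure n E + emeasure a E"
    and f: "f \<in> borel_measurable M"
  shows "integral\<^sup>N p f + integral\<^sup>N b f = integral\<^sup>N n f + integral\<^sup>N a f"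
proof -
  have meas: "g \<in> borel_measurable q" if "g \<in> borel_measurable M" "sets q = sets M" for g :: "'a \<Rightarrow> ennreal" and q
    using that measurable_cong_sets by blast
  have sp: "space p = space M" "space n = space M" "space a = space M" "space b = space M"
    using sets by (auto dest: sets_eq_imp_space_eq)
  show ?thesis
    using f
  proof induction
    case (cong f g)
    then have "integral\<^sup>N p f = integral\<^sup>N p g" "integral\<^sup>N b f = integral\<^sup>N b g"
      "integral\<^sup>N n f = integral\<^sup>N n g" "integral\<^sup>N a f = integral\<^sup>N a g"
      by (auto intro!: nn_integral_cong simp: sp)
    with cong show ?case by simp
  next
    case (set A)
    then show ?case using eq sets by simp
  next
    case (mult u c)
    then show ?case
      by (simp add: nn_integral_cmult meas sets flip: distrib_left)
  next
    case (add u v)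
    then show ?case
      by (simp add: nn_integral_add meas sets) (metis (no_types, lifting) add.assoc add.left_commute)
  next
    case (seq U)
    have S: "integral\<^sup>N q (SUP i. U i) = (SUP i. integral\<^sup>N q (U i))" if "sets q = sets M" for q
    proof -
      have "integral\<^sup>N q (\<lambda>x. SUP i. U i x) = (SUP i. integral\<^sup>N q (U i))"
        by (rule nn_integral_monotone_convergence_SUP[OF \<open>incseq U\<close> meas[OF seq.hyps(1) that]])
      moreover have "(SUP i. U i) = (\<lambda>x. SUP i. U i x)" by (rule ext) (rule SUP_apply)
      ultimately show ?thesis by simp
    qed
    have I: "incseq (\<lambda>i. integral\<^sup>N q (U i))" for q
      using \<open>incseq U\<close> by (auto simp: incseq_def le_fun_def intro!: nn_integral_mono)
    have A: "(SUP i. integral\<^sup>N q (U i)) + (SUP i. integral\<^sup>N q' (U i)) = (SUP i. integral\<^sup>N q (U i) + integral\<^sup>N q' (U i))" for q q'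
      using I by (intro ennreal_SUP_add[symmetric])
    show ?case unfolding S[OF sets(1)] S[OF sets(2)] S[OF sets(3)] S[OF sets(4)] A
      using seq.IH by simp
  qed
qed

text \<open>Real and imaginary parts, then positive and negative parts, reduce this to the balance
  of nonnegative integrals; boundedness of f makes all of them finite.\<close>

lemma integral_balance:
  fixes f :: "'s \<Rightarrow> complex"
  assumes fin: "finite_measure p" "finite_measure n" "finite_measure a" "finite_measure b"
    and sets: "sets p = sets M" "sets n = sets M" "sets a = sets M" "sets b = sets M"
    and eq: "\<And>E. E \<in> sets M \<Longrightarrow> measure p E - measure n E = measure a E - measure b E"
    and f: "f \<in> borel_measurable M" "\<And>x. x \<in> space M \<Longrightarrow> cmod (f x) \<le> B"
  shows "integral\<^sup>L p f - integral\<^sup>L n f = integral\<^sup>L a f - integral\<^sup>L b f"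
proof -
  have sp: "space p = space M" "space n = space M" "space a = space M" "space b = space M"
    using sets by (auto dest: sets_eq_imp_space_eq)
  have int: "integrable q g"
    if "finite_measure q" "sets q = sets M" "g \<in> borel_measurable M" "\<And>x. x \<in> space M \<Longrightarrow> norm (g x) \<le> c"
    for q and g :: "'s \<Rightarrow> 'b::{banach,second_countable_topology}" and c
  proof (rule finite_measure.integrable_const_bound[OF that(1)])
    show "AE x in q. norm (g x) \<le> c"
      using that sets_eq_imp_space_eq[OF that(2)] by (intro AE_I2) auto
    show "g \<in> borel_measurable q" using that measurable_cong_sets by blast
  qed
  have em: "emeasure p E + emeasure b E = emeasure n E + emeasure a E" if "E \<in> sets M" for E
  proof -
    have "measure p E + measure b E = measure n E + measure a E" using eq[OF that] by linarith
    then show ?thesis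
      by (simp add: finite_measure.emeasure_eq_measure[OF fin(1)] finite_measure.emeasure_eq_measure[OF fin(2)]
          finite_measure.emeasure_eq_measure[OF fin(3)] finite_measure.emeasure_eq_measure[OF fin(4)]
          flip: ennreal_plus)
  qed
  have nonneg: "integral\<^sup>L p g + integral\<^sup>L b g = integral\<^sup>L n g + integral\<^sup>L a g"
    if g: "g \<in> borel_measurable M" "\<And>x. 0 \<le> g x" "\<And>x. x \<in> space M \<Longrightarrow> norm (g x) \<le> c"
    for g :: "'s \<Rightarrow> real" and c
  proof -
    have N: "integral\<^sup>N q (\<lambda>x. ennreal (g x)) = ennreal (integral\<^sup>L q g)"
      if "finite_measure q" "sets q = sets M" for q
      using int[OF that g(1,3)] g(2) by (intro nn_integral_eq_integral) auto
    have "integral\<^sup>N p (\<lambda>x. ennreal (g x)) + integral\<^sup>N b (\<lambda>x. ennreal (g x))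
        = integral\<^sup>N n (\<lambda>x. ennreal (g x)) + integral\<^sup>N a (\<lambda>x. ennreal (g x))"
      using g(1) by (intro nn_integral_balance[OF sets em]) auto
    then have "ennreal (integral\<^sup>L p g + integral\<^sup>L b g) = ennreal (integral\<^sup>L n g + integral\<^sup>L a g)"
      using g(2) by (simp add: N fin sets)
    then show ?thesis using g(2) by (subst (asm) ennreal_inj) auto
  qed
  have real: "integral\<^sup>L p g - integral\<^sup>L n g = integral\<^sup>L a g - integral\<^sup>L b g"
    if g: "g \<in> borel_measurable M" "\<And>x. x \<in> space M \<Longrightarrow> norm (g x) \<le> c" for g :: "'s \<Rightarrow> real" and c
  proof -
    have mx: "norm (max 0 (g x)) \<le> c" "norm (max 0 (- g x)) \<le> c" if "x \<in> space M" for x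
      using g(2)[OF that] by auto
    have d: "integral\<^sup>L q g = integral\<^sup>L q (\<lambda>x. max 0 (g x)) - integral\<^sup>L q (\<lambda>x. max 0 (- g x))"
      if q: "finite_measure q" "sets q = sets M" for q
    proof -
      have "integral\<^sup>L q (\<lambda>x. max 0 (g x) - max 0 (- g x)) = integral\<^sup>L q (\<lambda>x. max 0 (g x)) - integral\<^sup>L q (\<lambda>x. max 0 (- g x))"
      proof (rule Bochner_Integration.integral_diff)
        show "integrable q (\<lambda>x. max 0 (g x))" "integrable q (\<lambda>x. max 0 (- g x))"
          using g(1) by (auto intro!: int[OF q _ mx(1)] int[OF q _ mx(2)])
      qed
      moreover have "(\<lambda>x. max 0 (g x) - max 0 (- g x)) = g" by (auto simp: max_def)
      ultimately show ?thesis by simp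
    qed
    have n1: "integral\<^sup>L p (\<lambda>x. max 0 (g x)) + integral\<^sup>L b (\<lambda>x. max 0 (g x)) = integral\<^sup>L n (\<lambda>x. max 0 (g x)) + integral\<^sup>L a (\<lambda>x. max 0 (g x))"
      using g(1) by (intro nonneg[OF _ _ mx(1)]) auto
    have n2: "integral\<^sup>L p (\<lambda>x. max 0 (- g x)) + integral\<^sup>L b (\<lambda>x. max 0 (- g x)) = integral\<^sup>L n (\<lambda>x. max 0 (- g x)) + integral\<^sup>L a (\<lambda>x. max 0 (- g x))"
      using g(1) by (intro nonneg[OF _ _ mx(2)]) auto
    show ?thesis using n1 n2 d[OF fin(1) sets(1)] d[OF fin(2) sets(2)] d[OF fin(3) sets(3)] d[OF fin(4) sets(4)]
      by linarith
  qed
  have R: "Re (integral\<^sup>L q f) = integral\<^sup>L q (\<lambda>x. Re (f x))" "Im (integral\<^sup>L q f) = integral\<^sup>L q (\<lambda>x. Im (f x))"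
    if "finite_measure q" "sets q = sets M" for q
    using int[OF that f] by simp_all
  show ?thesis
  proof (rule complex_eqI)
    show "Re (integral\<^sup>L p f - integral\<^sup>L n f) = Re (integral\<^sup>L a f - integral\<^sup>L b f)"
    proof -
      have "norm (Re (f x)) \<le> B" if "x \<in> space M" for x
        using order_trans[OF abs_Re_le_cmod f(2)[OF that]] by simp
      then show ?thesis using real[of "\<lambda>x. Re (f x)" B] f(1) by (simp add: R fin sets)
    qed
    show "Im (integral\<^sup>L p f - integral\<^sup>L n f) = Im (integral\<^sup>L a f - integral\<^sup>L b f)"
    proof -
      have "norm (Im (f x)) \<le> B" if "x \<in> space M" for x
        using order_trans[OF abs_Im_le_cmod f(2)[OF that]] by simp
      then show ?thesis using real[of "\<lambda>x. Im (f x)" B] f(1) by (simp add: R fin sets)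
    qed
  qed
qed

text \<open>Any representation by four finite measures is allowed, not only the Jordan one, so that
  measures from the Riesz theorem fit.\<close>

definition measure_quadruple ::
    "'s measure \<Rightarrow> 's measure \<Rightarrow> 's measure \<Rightarrow> 's measure \<Rightarrow> 's measure \<Rightarrow> ('s set \<Rightarrow> complex) \<Rightarrow> bool" where
  "measure_quadruple M p n p' n' \<nu> \<longleftrightarrow>
     (\<forall>q\<in>{p, n, p', n'}. finite_measure q \<and> sets q = sets M) \<and>
     (\<forall>E\<in>sets M. \<nu> E = of_real (measure p E - measure n E) + \<i> * of_real (measure p' E - measure n' E))"

lemma complex_measure_quadruple:
  assumes "\<nu> \<in> complex_measures M"
  shows "measure_quadruple M (jordan_pos M (\<lambda>E. Re (\<nu> E))) (jordan_pos M (\<lambda>E. - Re (\<nu> E)))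
    (jordan_pos M (\<lambda>E. Im (\<nu> E))) (jordan_pos M (\<lambda>E. - Im (\<nu> E))) \<nu>"
  unfolding measure_quadruple_def
proof (intro conjI ballI)
  note s = complex_measures_signed[OF assms]
  note s' = s[THEN signed_measure_uminus]
  show "finite_measure q" "sets q = sets M"
    if "q \<in> {jordan_pos M (\<lambda>E. Re (\<nu> E)), jordan_pos M (\<lambda>E. - Re (\<nu> E)),
      jordan_pos M (\<lambda>E. Im (\<nu> E)), jordan_pos M (\<lambda>E. - Im (\<nu> E))}" for q
    using that finite_measure_jordan_pos[OF s(1)] finite_measure_jordan_pos[OF s(2)]
      finite_measure_jordan_pos[OF s'(1)] finite_measure_jordan_pos[OF s'(2)]
      jordan_pos_measure(1)[OF s(1)] jordan_pos_measure(1)[OF s(2)]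
      jordan_pos_measure(1)[OF s'(1)] jordan_pos_measure(1)[OF s'(2)] by auto
  fix E assume E: "E \<in> sets M"
  show "\<nu> E = of_real (measure (jordan_pos M (\<lambda>E. Re (\<nu> E))) E - measure (jordan_pos M (\<lambda>E. - Re (\<nu> E))) E)
      + \<i> * of_real (measure (jordan_pos M (\<lambda>E. Im (\<nu> E))) E - measure (jordan_pos M (\<lambda>E. - Im (\<nu> E))) E)"
    unfolding jordan_decomposition[OF s(1) E, symmetric] jordan_decomposition[OF s(2) E, symmetric]
    by (rule complex_eq)
qed

lemma finite_measure_sums:
  assumes "finite_measure p" "sets p = sets M" "range A \<subseteq> sets M" "disjoint_family A"
  shows "(\<lambda>n::nat. measure p (A n)) sums measure p (\<Union>n. A n)"
  using finite_measure.finite_measure_UNION[OF assms(1), of A] assms by simp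

lemma measure_quadruple_complex_measure:
  assumes "measure_quadruple M p n p' n' \<nu>" "\<nu> \<in> extensional (sets M)"
  shows "\<nu> \<in> complex_measures M"
  unfolding complex_measures_def
proof (intro CollectI conjI allI impI)
  fix A :: "nat \<Rightarrow> 'a set" assume A: "range A \<subseteq> sets M" "disjoint_family A"
  have \<nu>: "\<nu> E = of_real (measure p E - measure n E) + \<i> * of_real (measure p' E - measure n' E)"
    if "E \<in> sets M" for E using assms(1) that by (simp add: measure_quadruple_def)
  have s: "(\<lambda>n. measure q (A n)) sums measure q (\<Union>n. A n)" if "q \<in> {p, n, p', n'}" for q
    using assms(1) A that by (intro finite_measure_sums) (auto simp: measure_quadruple_def)
  have "(\<lambda>i. of_real (measure p (A i) - measure n (A i)) + \<i> * of_real (measure p' (A i) - measure n' (A i)))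
    sums (of_real (measure p (\<Union>i. A i) - measure n (\<Union>i. A i))
      + \<i> * of_real (measure p' (\<Union>i. A i) - measure n' (\<Union>i. A i)))"
    by (intro sums_add sums_mult sums_of_real sums_diff s) auto
  moreover have "\<nu> (A i) = of_real (measure p (A i) - measure n (A i)) + \<i> * of_real (measure p' (A i) - measure n' (A i))" for i
    using A by (intro \<nu>) auto
  moreover have "(\<Union>i. A i) \<in> sets M" using A by auto
  ultimately show "(\<lambda>i. \<nu> (A i)) sums \<nu> (\<Union>i. A i)" by (simp add: \<nu>)
qed (fact assms(2))

text \<open>The integral is defined through Jordan parts, while the Riesz theorem supplies measures
  of its own. Both represent the same set function, and by \<open>integral_balance\<close> that
  decides the integral.\<close>

lemma complex_measure_integral_quadruple:
  assumes \<nu>: "\<nu> \<in> complex_measures M" and q: "measure_quadruple M p n p' n' \<nu>"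
    and f: "f \<in> borel_measurable M" "\<And>x. x \<in> space M \<Longrightarrow> cmod (f x) \<le> B"
  shows "complex_measure_integral M \<nu> f =
    (integral\<^sup>L p f - integral\<^sup>L n f) + \<i> * (integral\<^sup>L p' f - integral\<^sup>L n' f)"
proof -
  note j = complex_measure_quadruple[OF \<nu>]
  have E: "measure (jordan_pos M (\<lambda>E. Re (\<nu> E))) E - measure (jordan_pos M (\<lambda>E. - Re (\<nu> E))) E = measure p E - measure n E"
    "measure (jordan_pos M (\<lambda>E. Im (\<nu> E))) E - measure (jordan_pos M (\<lambda>E. - Im (\<nu> E))) E = measure p' E - measure n' E"
    if "E \<in> sets M" for E
  proof -
    have "Re (\<nu> E) = measure p E - measure n E" "Im (\<nu> E) = measure p' E - measure n' E"
      using q that by (simp_all add: measure_quadruple_def)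
    moreover have "Re (\<nu> E) = measure (jordan_pos M (\<lambda>E. Re (\<nu> E))) E - measure (jordan_pos M (\<lambda>E. - Re (\<nu> E))) E"
      "Im (\<nu> E) = measure (jordan_pos M (\<lambda>E. Im (\<nu> E))) E - measure (jordan_pos M (\<lambda>E. - Im (\<nu> E))) E"
      using jordan_decomposition[OF complex_measures_signed(1)[OF \<nu>] that]
        jordan_decomposition[OF complex_measures_signed(2)[OF \<nu>] that] by simp_all
    ultimately show "measure (jordan_pos M (\<lambda>E. Re (\<nu> E))) E - measure (jordan_pos M (\<lambda>E. - Re (\<nu> E))) E = measure p E - measure n E"
      "measure (jordan_pos M (\<lambda>E. Im (\<nu> E))) E - measure (jordan_pos M (\<lambda>E. - Im (\<nu> E))) E = measure p' E - measure n' E"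
      by simp_all
  qed
  have 1: "integral\<^sup>L (jordan_pos M (\<lambda>E. Re (\<nu> E))) f - integral\<^sup>L (jordan_pos M (\<lambda>E. - Re (\<nu> E))) f
      = integral\<^sup>L p f - integral\<^sup>L n f"
    using j q by (intro integral_balance[OF _ _ _ _ _ _ _ _ E(1) f]) (auto simp: measure_quadruple_def)
  have 2: "integral\<^sup>L (jordan_pos M (\<lambda>E. Im (\<nu> E))) f - integral\<^sup>L (jordan_pos M (\<lambda>E. - Im (\<nu> E))) f
      = integral\<^sup>L p' f - integral\<^sup>L n' f"
    using j q by (intro integral_balance[OF _ _ _ _ _ _ _ _ E(2) f]) (auto simp: measure_quadruple_def)
  show ?thesis unfolding complex_measure_integral_def 1 2 ..
qed

text \<open>Dominated convergence with the constant 1, for each of the four finite measures.\<close>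

lemma complex_measure_integral_tendsto:
  assumes \<nu>: "\<nu> \<in> complex_measures M" and E: "E \<in> sets M"
    and f: "\<And>k. f k \<in> borel_measurable M" "\<And>k x. x \<in> space M \<Longrightarrow> cmod (f k x) \<le> 1"
      "\<And>x. x \<in> space M \<Longrightarrow> (\<lambda>k. f k x) \<longlonglongrightarrow> indicator E x"
  shows "(\<lambda>k. complex_measure_integral M \<nu> (f k)) \<longlonglongrightarrow> \<nu> E"
proof -
  note j = complex_measure_quadruple[OF \<nu>]
  have lim: "(\<lambda>k. integral\<^sup>L q (f k)) \<longlonglongrightarrow> of_real (measure q E)"
    if "finite_measure q \<and> sets q = sets M" for q
  proof -
    interpret finite_measure q using that by blast
    have sp: "space q = space M" using that sets_eq_imp_space_eq by blast
    \<comment> \<open>The indicator is written as a real multiple of 1 to match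
      \<open>has_bochner_integral_indicator\<close>.\<close>
    have "(\<lambda>k. integral\<^sup>L q (f k)) \<longlonglongrightarrow> integral\<^sup>L q (\<lambda>x. indicator E x *\<^sub>R (1::complex))"
    proof (rule integral_dominated_convergence[where w="\<lambda>x. 1"])
      show "(\<lambda>x. indicator E x *\<^sub>R (1::complex)) \<in> borel_measurable q"
        using E that by auto
      show "f k \<in> borel_measurable q" for k
        using f(1)[of k] that measurable_cong_sets by blast
      show "AE x in q. (\<lambda>k. f k x) \<longlonglongrightarrow> indicator E x *\<^sub>R (1::complex)"
      proof (rule AE_I2)
        fix x assume "x \<in> space q"
        then have "(\<lambda>k. f k x) \<longlonglongrightarrow> indicator E x" using f(3) sp by simp
        moreover have "indicator E x *\<^sub>R (1::complex) = indicator E x" by (simp split: split_indicator)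
        ultimately show "(\<lambda>k. f k x) \<longlonglongrightarrow> indicator E x *\<^sub>R (1::complex)" by simp
      qed
      show "AE x in q. norm (f k x) \<le> 1" for k
        using f(2) sp by (intro AE_I2) simp
    qed simp
    also have "integral\<^sup>L q (\<lambda>x. indicator E x *\<^sub>R (1::complex)) = measure q E *\<^sub>R (1::complex)"
      using E that by (intro has_bochner_integral_integral_eq has_bochner_integral_indicator)
        (auto simp: emeasure_eq_measure)
    finally show ?thesis by (simp add: scaleR_conv_of_real)
  qed
  have "(\<lambda>k. complex_measure_integral M \<nu> (f k)) \<longlonglongrightarrow>
      (of_real (measure (jordan_pos M (\<lambda>E. Re (\<nu> E))) E) - of_real (measure (jordan_pos M (\<lambda>E. - Re (\<nu> E))) E))
      + \<i> * (of_real (measure (jordan_pos M (\<lambda>E. Im (\<nu> E))) E) - of_real (measure (jordan_pos M (\<lambda>E. - Im (\<nu> E))) E))"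
    unfolding complex_measure_integral_def
    using j by (intro tendsto_intros lim) (auto simp: measure_quadruple_def)
  moreover have "\<nu> E = (of_real (measure (jordan_pos M (\<lambda>E. Re (\<nu> E))) E) - of_real (measure (jordan_pos M (\<lambda>E. - Re (\<nu> E))) E))
      + \<i> * (of_real (measure (jordan_pos M (\<lambda>E. Im (\<nu> E))) E) - of_real (measure (jordan_pos M (\<lambda>E. - Im (\<nu> E))) E))"
    using j E by (simp add: measure_quadruple_def)
  ultimately show ?thesis by simp
qed

text \<open>Dynkin induction from the intersection-stable family of closed sets. It runs over Borel
  sets B of the whole space with the property P (B \<inter> K), so that the generator can be taken
  there.\<close>

lemma restrict_borel_induct [consumes 2, case_names closed compl union]:
  fixes K :: "'a::topological_space set"
  assumes K: "closed K" and E: "E \<in> sets (restrict_space borel K)"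
    and closed: "\<And>C. closed C \<Longrightarrow> C \<subseteq> K \<Longrightarrow> P C"
    and compl: "\<And>A. A \<in> sets (restrict_space borel K) \<Longrightarrow> P A \<Longrightarrow> P (K - A)"
    and union: "\<And>A :: nat \<Rightarrow> 'a set. disjoint_family A \<Longrightarrow> range A \<subseteq> sets (restrict_space borel K) \<Longrightarrow>
      (\<And>i. P (A i)) \<Longrightarrow> P (\<Union>i. A i)"
  shows "P E"
proof -
  have sets: "A \<inter> K \<in> sets (restrict_space borel K)" if "A \<in> sigma_sets UNIV (Collect closed)" for A
    using that by (auto simp: sets_restrict_space borel_eq_closed)
  obtain A where A: "A \<in> sets borel" "E = A \<inter> K" using E by (auto simp: sets_restrict_space)
  have "A \<in> sigma_sets UNIV (Collect closed)" using A(1) by (simp add: borel_eq_closed)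
  then have "P (A \<inter> K)"
  proof (rule sigma_sets_induct_disjoint[rotated 2])
    show "Int_stable (Collect closed :: 'a set set)" by (auto simp: Int_stable_def)
    show "P (B \<inter> K)" if "B \<in> Collect closed" for B using that K by (intro closed) auto
    show "P ({} \<inter> K)" using closed[of "{}"] by simp
    show "P ((UNIV - B) \<inter> K)" if "B \<in> sigma_sets UNIV (Collect closed)" "P (B \<inter> K)" for B
    proof -
      have "(UNIV - B) \<inter> K = K - B \<inter> K" by blast
      then show ?thesis using compl[OF sets[OF that(1)] that(2)] by simp
    qed
    show "P ((\<Union>i. B i) \<inter> K)"
      if "disjoint_family B" "range B \<subseteq> sigma_sets UNIV (Collect closed)" "\<And>i. P (B i \<inter> K)"
      for B :: "nat \<Rightarrow> 'a set"
    proof -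
      have "P (\<Union>i. B i \<inter> K)"
      proof (rule union)
        show "disjoint_family (\<lambda>i. B i \<inter> K)" using that(1) unfolding disjoint_family_on_def by blast
        show "range (\<lambda>i. B i \<inter> K) \<subseteq> sets (restrict_space borel K)" using that(2) sets by blast
      qed (fact that)
      then show ?thesis by simp
    qed
  qed simp
  then show ?thesis using A by simp
qed

text \<open>The functions max 0 (1 - k d(x, C)) tend to the indicator because a point off a closed
  set has positive distance to it. The empty set is treated apart, since \<open>infdist\<close> to
  it is 0.\<close>

lemma closed_indicator_approximation:
  fixes C :: "'a::metric_space set"
  assumes C: "closed C"
  obtains f :: "nat \<Rightarrow> 'a \<Rightarrow> real"
  where "\<And>k. continuous_on UNIV (f k)" "\<And>k x. 0 \<le> f k x" "\<And>k x. f k x \<le> 1"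
    "\<And>x. (\<lambda>k. f k x) \<longlonglongrightarrow> indicator C x"
proof (cases "C = {}")
  case True
  show ?thesis by (rule that[of "\<lambda>k x. 0"]) (auto simp: True)
next
  case False
  define f where "f k x = max 0 (1 - real k * infdist x C)" for k x
  show ?thesis
  proof (rule that[of f])
    show "continuous_on UNIV (f k)" for k
      unfolding f_def by (intro continuous_on_max continuous_on_const continuous_on_diff continuous_on_mult
        continuous_on_infdist continuous_on_id)
    show "0 \<le> f k x" for k x by (simp add: f_def)
    show "f k x \<le> 1" for k x by (simp add: f_def infdist_nonneg)
    show "(\<lambda>k. f k x) \<longlonglongrightarrow> indicator C x" for x
    proof (cases "x \<in> C")
      case True
      then show ?thesis by (simp add: f_def)
    next
      case out: False
      then have d: "0 < infdist x C" using C False by (intro infdist_pos_not_in_closed)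
      obtain N where N: "1 / infdist x C < real N" using reals_Archimedean2 by blast
      have "f k x = 0" if "N \<le> k" for k
      proof -
        have "1 < real N * infdist x C" using N d by (simp add: field_simps)
        also have "\<dots> \<le> real k * infdist x C" using that d by (intro mult_right_mono) auto
        finally show ?thesis by (simp add: f_def)
      qed
      then have "(\<lambda>k. f k x) \<longlonglongrightarrow> 0"
        by (intro tendsto_eventually) (auto simp: eventually_sequentially)
      then show ?thesis using out by simp
    qed
  qed
qed

section \<open>The contour integral of the resolvent\<close>

lemma cdual_add: "\<Lambda> \<in> cdual \<Longrightarrow> \<Lambda>' \<in> cdual \<Longrightarrow> \<Lambda> + \<Lambda>' \<in> cdual"
  by (simp add: cdual_def blinfun.add_left distrib_left)

lemma cdual_scaleR: "\<Lambda> \<in> cdual \<Longrightarrow> r *\<^sub>R \<Lambda> \<in> cdual"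
  by (simp add: cdual_def blinfun.scaleR_left)

lemma subspace_cdual: "subspace cdual"
  by (rule subspaceI) (auto simp: cdual_add cdual_scaleR, simp add: cdual_def)

lemma cdual_scale_apply: "blinfun_apply (cdual_scale c \<Lambda>) a = c * blinfun_apply \<Lambda> a"
  by (simp add: cdual_scale_def)

lemma cdual_scale_cdual: "\<Lambda> \<in> cdual \<Longrightarrow> cdual_scale c \<Lambda> \<in> cdual"
  by (simp add: cdual_def cdual_scale_apply)

lemma cdual_scale_of_real: "cdual_scale (of_real r) \<Lambda> = r *\<^sub>R \<Lambda>"
  by (rule blinfun_eqI) (simp add: cdual_scale_apply blinfun.scaleR_left scaleR_conv_of_real)

lemma closed_cdual: "closed cdual"
proof -
  have "closed {\<Lambda> :: 'a \<Rightarrow>\<^sub>L complex. blinfun_apply \<Lambda> (c *\<^sub>C a) = c * blinfun_apply \<Lambda> a}" for c a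
    by (intro closed_Collect_eq continuous_on_mult_left
      linear_continuous_on[OF blinfun.bounded_linear_left])
  then have "closed (\<Inter>c. \<Inter>a. {\<Lambda> :: 'a \<Rightarrow>\<^sub>L complex. blinfun_apply \<Lambda> (c *\<^sub>C a) = c * blinfun_apply \<Lambda> a})"
    by (intro closed_INT ballI)
  moreover have "cdual = (\<Inter>c. \<Inter>a. {\<Lambda> :: 'a \<Rightarrow>\<^sub>L complex. blinfun_apply \<Lambda> (c *\<^sub>C a) = c * blinfun_apply \<Lambda> a})"
    by (auto simp: cdual_def)
  ultimately show ?thesis by simp
qed

text \<open>Multiplication by b is absorbed into the functional; this turns formulas for \<Lambda>
  (R w) into formulas for \<Lambda> (b R w).\<close>

lemma cdual_mult:
  assumes "\<Lambda> \<in> cdual"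
  shows "\<Lambda> o\<^sub>L blinfun_mult_right b \<in> cdual"
  using assms by (simp add: cdual_def mult_scaleC_right)

locale enclosing_curve =
  fixes x :: "'a::complex_banach_algebra" and \<gamma> :: "(real \<Rightarrow> complex) list"
  assumes bounding: "bounding_curve \<gamma>" and enclosing: "spectrum x \<subseteq> curve_int \<gamma>"
begin

lemma smooth: "\<forall>g\<in>set \<gamma>. smooth_closed_curve g"
  using bounding by (simp add: bounding_curve_def)

lemma curve_image_disjoint: "curve_image \<gamma> \<inter> spectrum x = {}"
  using enclosing by (auto simp: curve_int_def)

lemma continuous_on_curve_resolvent: "continuous_on (curve_image \<gamma>) (resolvent x)"
  by (rule continuous_on_resolvent[OF curve_image_disjoint])

lemma continuous_on_curve_functional: "continuous_on (curve_image \<gamma>) (\<lambda>w. blinfun_apply \<Lambda> (resolvent x w))"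
  by (rule bounded_linear.continuous_on[OF blinfun.bounded_linear_right continuous_on_curve_resolvent])

text \<open>As a function of a, the integral is itself in the dual. Holomorphy of \<Psi> (R z) and
  its limit at infinity are then instances of what is known for every functional.\<close>

lemma curve_integral_functional:
  assumes \<Lambda>: "\<Lambda> \<in> cdual"
  obtains \<Psi> where "\<Psi> \<in> cdual"
    "\<And>a. blinfun_apply \<Psi> a = curve_integral \<gamma> (\<lambda>w. blinfun_apply \<Lambda> (a * resolvent x w))"
proof -
  let ?Q = "\<lambda>a. curve_integral \<gamma> (\<lambda>w. blinfun_apply \<Lambda> (a * resolvent x w))"
  have c: "continuous_on (curve_image \<gamma>) (\<lambda>w. blinfun_apply \<Lambda> (a * resolvent x w))" for a
    by (intro bounded_linear.continuous_on[OF blinfun.bounded_linear_right] continuous_on_mult_left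
      continuous_on_curve_resolvent)
  obtain B where B: "B \<ge> 0" "\<And>f M. continuous_on (curve_image \<gamma>) f \<Longrightarrow> \<forall>z\<in>curve_image \<gamma>. cmod (f z) \<le> M \<Longrightarrow>
      0 \<le> M \<Longrightarrow> cmod (curve_integral \<gamma> f) \<le> M * B"
    using curve_integral_bound[OF smooth] by auto
  have "bounded (resolvent x ` curve_image \<gamma>)"
    by (intro compact_imp_bounded compact_continuous_image continuous_on_curve_resolvent compact_curve_image smooth)
  then obtain D where D: "\<And>w. w \<in> curve_image \<gamma> \<Longrightarrow> norm (resolvent x w) \<le> D" "D > 0"
    unfolding bounded_pos by auto
  have "bounded_linear ?Q"
  proof
    show "?Q (a + b) = ?Q a + ?Q b" for a b
      using curve_integral_add[OF smooth c c] by (simp add: distrib_right blinfun.add_right)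
    show "?Q (r *\<^sub>R a) = r *\<^sub>R ?Q a" for r a
      using curve_integral_cmult[OF smooth c, of "of_real r"]
      by (simp add: blinfun.scaleR_right scaleR_conv_of_real[where 'a=complex])
    have "norm (?Q a) \<le> norm a * (norm \<Lambda> * D * B)" for a
    proof -
      have "norm (?Q a) \<le> (norm \<Lambda> * (norm a * D)) * B"
      proof (rule B(2)[OF c], intro ballI)
        fix w assume w: "w \<in> curve_image \<gamma>"
        have "cmod (blinfun_apply \<Lambda> (a * resolvent x w)) \<le> norm \<Lambda> * norm (a * resolvent x w)"
          by (rule norm_blinfun)
        also have "\<dots> \<le> norm \<Lambda> * (norm a * D)"
          using D(1)[OF w] by (intro mult_left_mono order_trans[OF norm_mult_ineq]) auto
        finally show "cmod (blinfun_apply \<Lambda> (a * resolvent x w)) \<le> norm \<Lambda> * (norm a * D)" .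
      qed (use D in simp)
      then show ?thesis by (simp add: mult_ac)
    qed
    then show "\<exists>K. \<forall>a. norm (?Q a) \<le> norm a * K" by blast
  qed
  then have ap: "blinfun_apply (Blinfun ?Q) a = ?Q a" for a
    by (simp add: bounded_linear_Blinfun_apply)
  have "Blinfun ?Q \<in> cdual"
    unfolding cdual_def
  proof (intro CollectI allI)
    fix k a
    show "blinfun_apply (Blinfun ?Q) (k *\<^sub>C a) = k * blinfun_apply (Blinfun ?Q) a"
      unfolding ap using curve_integral_cmult[OF smooth c, of k a] by (simp add: mult_scaleC_left cdualD[OF \<Lambda>])
  qed
  with ap that show ?thesis by blast
qed

text \<open>Outside the spectrum, the function in question is
  \<open>2 \<pi> \<i> \<Lambda> (R z) - \<integral> \<Lambda> (R z * R w) dw\<close>; by the resolvent identity it coincides inside the curve with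
  the Cauchy transform of \<open>\<Lambda> (R w)\<close>, which is holomorphic across the spectrum.  So it extends to an
  entire function that vanishes at infinity.\<close>

lemma cauchy_resolvent_product:
  assumes \<Lambda>: "\<Lambda> \<in> cdual" and z: "z \<notin> spectrum x"
  shows "curve_integral \<gamma> (\<lambda>w. blinfun_apply \<Lambda> (resolvent x z * resolvent x w))
    = 2 * of_real pi * \<i> * blinfun_apply \<Lambda> (resolvent x z)"
proof -
  let ?R = "resolvent x"
  let ?ct = "\<lambda>z. curve_integral \<gamma> (\<lambda>w. blinfun_apply \<Lambda> (?R w) / (w - z))"
  obtain \<Psi> where \<Psi>: "\<Psi> \<in> cdual"
    "\<And>a. blinfun_apply \<Psi> a = curve_integral \<gamma> (\<lambda>w. blinfun_apply \<Lambda> (a * ?R w))"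
    using curve_integral_functional[OF \<Lambda>] by blast
  define G where "G z = 2 * of_real pi * \<i> * blinfun_apply \<Lambda> (?R z) - blinfun_apply \<Psi> (?R z)" for z
  \<comment> \<open>On the spectrum, where the resolvent has no meaning, the Cauchy transform
    supplies the values.\<close>
  define H where "H z = (if z \<in> spectrum x then ?ct z else G z)" for z
  have inside: "H z = ?ct z" if z: "z \<in> curve_int \<gamma>" for z
  proof (cases "z \<in> spectrum x")
    case False
    have img: "z \<notin> curve_image \<gamma>" and wind: "curve_winding \<gamma> z = 1"
      using z by (auto simp: curve_int_def)
    have c1: "continuous_on (curve_image \<gamma>) (\<lambda>w. 1 / (w - z))"
      using img by (intro continuous_intros) auto
    have c2: "continuous_on (curve_image \<gamma>) (\<lambda>w. blinfun_apply \<Lambda> (?R w) / (w - z))"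
      using img by (intro continuous_intros continuous_on_curve_functional) auto
    \<comment> \<open>The product splits into a constant times the Cauchy kernel, minus the
      integrand of the Cauchy transform. As the winding number is 1, integration of the first part
      cancels the term 2 \<pi> \<i> \<Lambda> (R z) of G.\<close>
    have "blinfun_apply \<Lambda> (?R z * ?R w)
        = blinfun_apply \<Lambda> (?R z) * (1 / (w - z)) + (- 1) * (blinfun_apply \<Lambda> (?R w) / (w - z))"
      if w: "w \<in> curve_image \<gamma>" for w
    proof -
      have "w \<notin> spectrum x" "w \<noteq> z" using w img curve_image_disjoint by auto
      then have "blinfun_apply \<Lambda> (?R z) - blinfun_apply \<Lambda> (?R w) = (w - z) * blinfun_apply \<Lambda> (?R z * ?R w)"
        using arg_cong[OF resolvent_identity[of w x z], of "blinfun_apply \<Lambda>"] False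
        by (simp add: blinfun.diff_right cdualD[OF \<Lambda>])
      then have "blinfun_apply \<Lambda> (?R z * ?R w) = (blinfun_apply \<Lambda> (?R z) - blinfun_apply \<Lambda> (?R w)) / (w - z)"
        using \<open>w \<noteq> z\<close> by simp
      then show ?thesis by (simp add: diff_divide_distrib)
    qed
    then have "blinfun_apply \<Psi> (?R z) = curve_integral \<gamma>
        (\<lambda>w. blinfun_apply \<Lambda> (?R z) * (1 / (w - z)) + (- 1) * (blinfun_apply \<Lambda> (?R w) / (w - z)))"
      unfolding \<Psi>(2) by (rule curve_integral_cong)
    also have "\<dots> = blinfun_apply \<Lambda> (?R z) * curve_integral \<gamma> (\<lambda>w. 1 / (w - z)) + (- 1) * ?ct z"
      by (subst curve_integral_add[OF smooth continuous_on_mult_left[OF c1] continuous_on_mult_left[OF c2]])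
        (simp only: curve_integral_cmult[OF smooth c1] curve_integral_cmult[OF smooth c2])
    also have "curve_integral \<gamma> (\<lambda>w. 1 / (w - z)) = 2 * of_real pi * \<i>"
      using curve_integral_winding[OF smooth img] by (simp add: wind)
    finally show ?thesis using False by (simp add: H_def G_def)
  qed (simp add: H_def)
  have hol: "H holomorphic_on - spectrum x"
  proof (rule holomorphic_transform)
    show "G holomorphic_on - spectrum x"
      unfolding G_def
      by (intro holomorphic_on_diff holomorphic_on_mult holomorphic_on_const holomorphic_on_resolvent \<Lambda> \<Psi>(1))
  qed (simp add: H_def)
  have hol': "H holomorphic_on curve_int \<gamma>"
  proof (rule holomorphic_transform)
    show "?ct holomorphic_on curve_int \<gamma>"
      by (rule holomorphic_on_subset[OF cauchy_transform_holomorphic[OF smooth continuous_on_curve_functional]])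
        (auto simp: curve_int_def)
  qed (simp add: inside)
  have "H holomorphic_on (- spectrum x \<union> curve_int \<gamma>)"
    by (intro holomorphic_on_Un hol hol' open_Compl closed_spectrum open_curve_int bounding)
  moreover have "- spectrum x \<union> curve_int \<gamma> = UNIV" using enclosing by blast
  ultimately have entire: "H holomorphic_on UNIV" by simp
  have "(G \<longlongrightarrow> 2 * of_real pi * \<i> * blinfun_apply \<Lambda> 0 - blinfun_apply \<Psi> 0) at_infinity"
    unfolding G_def
    by (intro tendsto_diff tendsto_mult tendsto_const
      bounded_linear.tendsto[OF blinfun.bounded_linear_right] tendsto_resolvent_at_infinity)
  then have "(G \<longlongrightarrow> 0) at_infinity" by (simp add: blinfun.zero_right)
  moreover have "\<forall>\<^sub>F z in at_infinity. H z = G z"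
    unfolding eventually_at_infinity
    by (rule exI[of _ "norm x + 1"]) (use resolvent_outside(1)[of x] in \<open>force simp: H_def\<close>)
  ultimately have "(H \<longlongrightarrow> 0) at_infinity" by (simp add: tendsto_cong)
  then have "H z = 0" by (rule Liouville_weak[OF entire])
  then show ?thesis using z by (simp add: H_def G_def \<Psi>(2))
qed

text \<open>For a fixed z outside the spectrum, c = b (z - x) satisfies c R(z) = b; the product
  formula for the functional a \<mapsto> \<Lambda> (c a) then becomes the claim.\<close>

lemma cauchy_resolvent:
  assumes \<Lambda>: "\<Lambda> \<in> cdual"
  shows "curve_integral \<gamma> (\<lambda>w. blinfun_apply \<Lambda> (b * resolvent x w)) = 2 * of_real pi * \<i> * blinfun_apply \<Lambda> b"
proof -
  define z where "z = complex_of_real (norm x + 1)"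
  have z: "z \<notin> spectrum x"
    by (rule resolvent_outside(1)) (simp add: z_def add_nonneg_pos del: of_real_add)
  define c where "c = b * (z *\<^sub>C 1 - x)"
  have c: "c * (resolvent x z * y) = b * y" for y
  proof -
    have "c * (resolvent x z * y) = b * ((z *\<^sub>C 1 - x) * resolvent x z) * y"
      unfolding c_def by (simp only: mult.assoc)
    then show ?thesis by (simp add: resolvent_inverse(1)[OF z])
  qed
  have "c * resolvent x z = b" using c[of 1] by simp
  then show ?thesis
    using cauchy_resolvent_product[OF cdual_mult[OF \<Lambda>, of c] z] by (simp add: c)
qed

text \<open>On the curve w R(w) = x R(w) + 1; the constant integrates to zero over closed curves,
  and the rest is \<open>cauchy_resolvent\<close> with b = x.\<close>

lemma curve_integral_ident_resolvent:
  assumes \<Lambda>: "\<Lambda> \<in> cdual"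
  shows "curve_integral \<gamma> (\<lambda>w. w * blinfun_apply \<Lambda> (resolvent x w)) = 2 * of_real pi * \<i> * blinfun_apply \<Lambda> x"
proof -
  have "w * blinfun_apply \<Lambda> (resolvent x w) = blinfun_apply \<Lambda> (x * resolvent x w) + blinfun_apply \<Lambda> 1"
    if "w \<in> curve_image \<gamma>" for w
  proof -
    have "w \<notin> spectrum x" using that curve_image_disjoint by blast
    then have "w *\<^sub>C resolvent x w = x * resolvent x w + 1"
      using resolvent_inverse(1)[of w x] by (simp add: left_diff_distrib mult_scaleC_left diff_eq_eq add.commute)
    from arg_cong[OF this, of "blinfun_apply \<Lambda>"] show ?thesis
      by (simp add: cdualD[OF \<Lambda>] blinfun.add_right)
  qed
  then have "curve_integral \<gamma> (\<lambda>w. w * blinfun_apply \<Lambda> (resolvent x w))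
      = curve_integral \<gamma> (\<lambda>w. blinfun_apply \<Lambda> (x * resolvent x w) + blinfun_apply \<Lambda> 1)"
    by (rule curve_integral_cong)
  also have "\<dots> = curve_integral \<gamma> (\<lambda>w. blinfun_apply \<Lambda> (x * resolvent x w)) + curve_integral \<gamma> (\<lambda>w. blinfun_apply \<Lambda> 1)"
    by (intro curve_integral_add smooth bounded_linear.continuous_on[OF blinfun.bounded_linear_right]
      continuous_on_mult_left continuous_on_curve_resolvent continuous_on_const)
  finally show ?thesis by (simp add: cauchy_resolvent[OF \<Lambda>] curve_integral_const[OF smooth])
qed

end

section \<open>The smooth calculus\<close>

locale regular_curve = enclosing_curve x \<gamma> for x :: "'a::complex_banach_algebra" and \<gamma> +
  assumes regular: "regular_element x"
begin

definition region :: "complex set" where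
  "region = curve_int \<gamma> - spectrum x"

definition area_integral :: "(complex \<Rightarrow> complex) \<Rightarrow> ('a \<Rightarrow>\<^sub>L complex) \<Rightarrow> complex" where
  "area_integral k \<Lambda> = set_lebesgue_integral lebesgue region (\<lambda>z. k z * blinfun_apply \<Lambda> (resolvent x z))"

definition boundary_integral :: "(complex \<Rightarrow> complex) \<Rightarrow> ('a \<Rightarrow>\<^sub>L complex) \<Rightarrow> complex" where
  "boundary_integral f \<Lambda> = curve_integral \<gamma> (\<lambda>z. f z * blinfun_apply \<Lambda> (resolvent x z))"

lemma smooth_calculus_formula_eq:
  assumes "\<Lambda> \<in> cdual"
  shows "smooth_calculus_formula x \<gamma> f \<Lambda>
    = 1 / (2 * of_real pi * \<i>) * boundary_integral f \<Lambda> - 1 / of_real pi * area_integral (dbar f) \<Lambda>"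
  unfolding smooth_calculus_formula_def boundary_integral_def area_integral_def curve_integral_def
    dunford_integral_def region_def cdualD[OF assms] ..

lemma open_region: "open region"
  unfolding region_def by (intro open_Diff open_curve_int bounding closed_spectrum)

lemma region_sets: "region \<in> sets lebesgue"
  using open_region by simp

lemma region_lmeasurable: "region \<in> lmeasurable"
  by (rule bounded_set_imp_lmeasurable[OF bounded_subset[OF bounded_curve_int[OF bounding]] region_sets])
    (auto simp: region_def)

text \<open>Regularity is applied to the inside of the curve, which is open and bounded, hence a
  precompact neighbourhood of the spectrum.\<close>

lemma region_functional_integrable:
  assumes "\<Lambda> \<in> cdual"
  shows "set_integrable lebesgue region (\<lambda>z. blinfun_apply \<Lambda> (resolvent x z))"
proof -
  have "curve_int \<gamma> \<in> sets lebesgue" "spectrum x \<subseteq> interior (curve_int \<gamma>)" "compact (closure (curve_int \<gamma>))"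
    using open_curve_int[OF bounding] bounded_curve_int[OF bounding] enclosing
    by (simp_all add: interior_open compact_closure)
  then have "dunford_integrable_on (resolvent x) lebesgue (curve_int \<gamma> - spectrum x)"
    using regular unfolding regular_element_def by blast
  then show ?thesis using assms by (simp add: dunford_integrable_on_def region_def)
qed

text \<open>k is bounded on the compact closure of the inside, so the product is dominated by a
  multiple of an integrable function.\<close>

lemma region_product_integrable:
  assumes \<Lambda>: "\<Lambda> \<in> cdual" and k: "continuous_on UNIV k"
  shows "set_integrable lebesgue region (\<lambda>z. k z * blinfun_apply \<Lambda> (resolvent x z))"
proof -
  have "compact (closure (curve_int \<gamma>))" using bounded_curve_int[OF bounding] by (simp add: compact_closure)
  then have "bounded (k ` closure (curve_int \<gamma>))"
    by (intro compact_imp_bounded compact_continuous_image) (rule continuous_on_subset[OF k subset_UNIV])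
  then obtain D where D: "\<And>z. z \<in> closure (curve_int \<gamma>) \<Longrightarrow> cmod (k z) \<le> D"
    unfolding bounded_iff by auto
  have D': "cmod (k z) \<le> D" if "z \<in> region" for z
    using that closure_subset by (intro D) (auto simp: region_def)
  let ?f = "\<lambda>z. blinfun_apply \<Lambda> (resolvent x z)"
  have i: "integrable lebesgue (\<lambda>z. indicator region z *\<^sub>R ?f z)"
    using region_functional_integrable[OF \<Lambda>] by (simp add: set_integrable_def)
  have "integrable lebesgue (\<lambda>z. indicator region z *\<^sub>R (k z * ?f z))"
  proof (rule Bochner_Integration.integrable_bound)
    show "integrable lebesgue (\<lambda>z. of_real D * (indicator region z *\<^sub>R ?f z))"
      using i by (rule integrable_mult_right)
    have "k \<in> borel_measurable lebesgue"
      using borel_measurable_continuous_onI[OF k] by (intro measurable_completion) simp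
    then have "(\<lambda>z. k z * (indicator region z *\<^sub>R ?f z)) \<in> borel_measurable lebesgue"
      using i by (intro borel_measurable_times) auto
    then show "(\<lambda>z. indicator region z *\<^sub>R (k z * ?f z)) \<in> borel_measurable lebesgue"
      by (simp add: mult.left_commute)
    show "AE z in lebesgue. norm (indicator region z *\<^sub>R (k z * ?f z)) \<le> norm (of_real D * (indicator region z *\<^sub>R ?f z))"
    proof (rule AE_I2)
      fix z
      show "norm (indicator region z *\<^sub>R (k z * ?f z)) \<le> norm (of_real D * (indicator region z *\<^sub>R ?f z))"
      proof (cases "z \<in> region")
        case True
        have "cmod (k z) \<le> \<bar>D\<bar>" using D'[OF True] by simp
        then show ?thesis using True by (simp add: norm_mult mult_right_mono)
      qed simp
    qed
  qed
  then show ?thesis by (simp add: set_integrable_def)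
qed

lemma area_integral_add_left:
  assumes "\<Lambda> \<in> cdual" "continuous_on UNIV k" "continuous_on UNIV k'"
  shows "area_integral (\<lambda>z. k z + k' z) \<Lambda> = area_integral k \<Lambda> + area_integral k' \<Lambda>"
  using set_integral_add(2)[OF region_product_integrable[OF assms(1,2)] region_product_integrable[OF assms(1,3)]]
  by (simp add: area_integral_def distrib_right)

lemma area_integral_cmult_left: "area_integral (\<lambda>z. c * k z) \<Lambda> = c * area_integral k \<Lambda>"
  by (simp add: area_integral_def mult.assoc)

lemma area_integral_add_right:
  assumes "\<Lambda> \<in> cdual" "\<Lambda>' \<in> cdual" "continuous_on UNIV k"
  shows "area_integral k (\<Lambda> + \<Lambda>') = area_integral k \<Lambda> + area_integral k \<Lambda>'"
  using set_integral_add(2)[OF region_product_integrable[OF assms(1,3)] region_product_integrable[OF assms(2,3)]]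
  by (simp add: area_integral_def distrib_left blinfun.add_left)

lemma area_integral_scale_right: "area_integral k (cdual_scale c \<Lambda>) = c * area_integral k \<Lambda>"
  by (simp add: area_integral_def cdual_scale_apply mult.left_commute)

lemma boundary_continuous:
  fixes \<Lambda> :: "'a \<Rightarrow>\<^sub>L complex"
  assumes "continuous_on UNIV f"
  shows "continuous_on (curve_image \<gamma>) (\<lambda>z. f z * blinfun_apply \<Lambda> (resolvent x z))"
  by (rule continuous_on_mult[OF continuous_on_subset[OF assms subset_UNIV] continuous_on_curve_functional])

lemma boundary_integral_add_left:
  assumes "continuous_on UNIV f" "continuous_on UNIV f'"
  shows "boundary_integral (\<lambda>z. f z + f' z) \<Lambda> = boundary_integral f \<Lambda> + boundary_integral f' \<Lambda>"
  using curve_integral_add[OF smooth boundary_continuous[OF assms(1)] boundary_continuous[OF assms(2)]]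
  by (simp add: boundary_integral_def distrib_right)

lemma boundary_integral_cmult_left:
  assumes "continuous_on UNIV f"
  shows "boundary_integral (\<lambda>z. c * f z) \<Lambda> = c * boundary_integral f \<Lambda>"
  using curve_integral_cmult[OF smooth boundary_continuous[OF assms]]
  by (simp add: boundary_integral_def mult.assoc)

lemma boundary_integral_add_right:
  assumes "continuous_on UNIV f"
  shows "boundary_integral f (\<Lambda> + \<Lambda>') = boundary_integral f \<Lambda> + boundary_integral f \<Lambda>'"
  using curve_integral_add[OF smooth boundary_continuous[OF assms] boundary_continuous[OF assms]]
  by (simp add: boundary_integral_def distrib_left blinfun.add_left)

lemma boundary_integral_scale_right:
  assumes "continuous_on UNIV f"
  shows "boundary_integral f (cdual_scale c \<Lambda>) = c * boundary_integral f \<Lambda>"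
  using curve_integral_cmult[OF smooth boundary_continuous[OF assms]]
  by (simp add: boundary_integral_def cdual_scale_apply mult.left_commute)

lemma boundary_integral_bounded:
  assumes f: "continuous_on UNIV f"
  shows "\<exists>K. \<forall>\<Lambda>. cmod (boundary_integral f \<Lambda>) \<le> K * norm \<Lambda>"
proof -
  obtain B where B: "B \<ge> 0" "\<And>f M. continuous_on (curve_image \<gamma>) f \<Longrightarrow> \<forall>z\<in>curve_image \<gamma>. cmod (f z) \<le> M \<Longrightarrow>
      0 \<le> M \<Longrightarrow> cmod (curve_integral \<gamma> f) \<le> M * B"
    using curve_integral_bound[OF smooth] by auto
  have "continuous_on (curve_image \<gamma>) (\<lambda>z. norm (f z) * norm (resolvent x z))"
    by (intro continuous_on_mult continuous_on_norm continuous_on_curve_resolvent continuous_on_subset[OF f]) simp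
  then have "bounded ((\<lambda>z. norm (f z) * norm (resolvent x z)) ` curve_image \<gamma>)"
    by (intro compact_imp_bounded compact_continuous_image compact_curve_image smooth)
  then obtain D where D: "\<And>w. w \<in> curve_image \<gamma> \<Longrightarrow> norm (norm (f w) * norm (resolvent x w)) \<le> D" "D > 0"
    unfolding bounded_pos by auto
  have "cmod (boundary_integral f \<Lambda>) \<le> (D * B) * norm \<Lambda>" for \<Lambda>
  proof -
    have "cmod (boundary_integral f \<Lambda>) \<le> (D * norm \<Lambda>) * B"
      unfolding boundary_integral_def
    proof (rule B(2)[OF boundary_continuous[OF f]], intro ballI)
      fix w assume w: "w \<in> curve_image \<gamma>"
      have "cmod (f w * blinfun_apply \<Lambda> (resolvent x w)) \<le> cmod (f w) * (norm \<Lambda> * norm (resolvent x w))"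
        unfolding norm_mult by (intro mult_left_mono norm_blinfun) simp
      also have "\<dots> = norm (norm (f w) * norm (resolvent x w)) * norm \<Lambda>" by simp
      also have "\<dots> \<le> D * norm \<Lambda>" using D(1)[OF w] by (intro mult_right_mono) auto
      finally show "cmod (f w * blinfun_apply \<Lambda> (resolvent x w)) \<le> D * norm \<Lambda>" .
    qed (use D in simp)
    then show ?thesis by (simp add: mult_ac)
  qed
  then show ?thesis by blast
qed

text \<open>Dunford integrals are bounded functionals on the dual: on the part of the region where the
  resolvent is bounded by \<open>n\<close> this is clear, and the integrals over these parts converge pointwise.\<close>

lemma area_integral_bounded:
  assumes k: "continuous_on UNIV k"
  shows "\<exists>K. \<forall>\<Lambda>\<in>cdual. cmod (area_integral k \<Lambda>) \<le> K * norm \<Lambda>"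
proof -
  define A where "A n = {z \<in> region. norm (resolvent x z) \<le> real n}" for n
  define T where "T n \<Lambda> = set_lebesgue_integral lebesgue (A n) (\<lambda>z. k z * blinfun_apply \<Lambda> (resolvent x z))" for n and \<Lambda> :: "'a \<Rightarrow>\<^sub>L complex"
  have A_sets: "A n \<in> sets lebesgue" for n
  proof -
    have "continuous_on region (\<lambda>z. norm (resolvent x z))"
      by (intro continuous_on_norm continuous_on_resolvent) (auto simp: region_def)
    \<comment> \<open>A n is relatively closed in the open region, on which the resolvent is
      continuous; this gives measurability.\<close>
    then have "open (region \<inter> (\<lambda>z. norm (resolvent x z)) -` {real n<..})"
      by (intro continuous_open_preimage open_region open_greaterThan)
    moreover have "A n = region - region \<inter> (\<lambda>z. norm (resolvent x z)) -` {real n<..}"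
      by (auto simp: A_def)
    ultimately show ?thesis using region_sets by auto
  qed
  have A_sub: "A n \<subseteq> region" for n by (auto simp: A_def)
  have A_meas: "A n \<in> lmeasurable" for n
    using fmeasurableI2[OF region_lmeasurable A_sub A_sets] .
  have A_int: "set_integrable lebesgue (A n) (\<lambda>z. k z * blinfun_apply \<Lambda> (resolvent x z))" if "\<Lambda> \<in> cdual" for n \<Lambda>
    by (rule set_integrable_subset[OF region_product_integrable[OF that k] A_sets A_sub])
  have A_UN: "(\<Union>n. A n) = region"
    using real_arch_simple by (auto simp: A_def)
  have "incseq A" by (auto simp: incseq_def A_def)
  have lim: "(\<lambda>n. T n \<Lambda>) \<longlonglongrightarrow> area_integral k \<Lambda>" if "\<Lambda> \<in> cdual" for \<Lambda>
    unfolding T_def area_integral_def A_UN[symmetric]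
    by (rule set_integral_cont_up) (use A_sets \<open>incseq A\<close> region_product_integrable[OF that k] A_UN in simp_all)
  have "compact (closure (curve_int \<gamma>))" using bounded_curve_int[OF bounding] by (simp add: compact_closure)
  then have "bounded (k ` closure (curve_int \<gamma>))"
    by (intro compact_imp_bounded compact_continuous_image) (rule continuous_on_subset[OF k subset_UNIV])
  then obtain D where D: "\<And>z. z \<in> closure (curve_int \<gamma>) \<Longrightarrow> cmod (k z) \<le> D" "D > 0"
    unfolding bounded_pos by auto
  have D': "cmod (k z) \<le> D" if "z \<in> region" for z
    using that closure_subset by (intro D) (auto simp: region_def)
  have bdd: "\<exists>K. \<forall>\<Lambda>\<in>cdual. cmod (T n \<Lambda>) \<le> K * norm \<Lambda>" for n
  proof (intro exI ballI)
    fix \<Lambda> :: "'a \<Rightarrow>\<^sub>L complex" assume \<Lambda>: "\<Lambda> \<in> cdual"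
    \<comment> \<open>D bounds k and n bounds the resolvent; the measure of A n is finite because
      the region is bounded.\<close>
    let ?c = "D * (norm \<Lambda> * real n)"
    have "cmod (T n \<Lambda>) \<le> integral\<^sup>L lebesgue (\<lambda>z. norm (indicator (A n) z *\<^sub>R (k z * blinfun_apply \<Lambda> (resolvent x z))))"
      unfolding T_def set_lebesgue_integral_def by (rule integral_norm_bound)
    also have "\<dots> \<le> integral\<^sup>L lebesgue (\<lambda>z. ?c * indicator (A n) z)"
    proof (rule integral_mono)
      show "integrable lebesgue (\<lambda>z. norm (indicator (A n) z *\<^sub>R (k z * blinfun_apply \<Lambda> (resolvent x z))))"
        using A_int[OF \<Lambda>, of n] unfolding set_integrable_def by (rule integrable_norm)
      show "integrable lebesgue (\<lambda>z. ?c * indicator (A n) z)"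
        using A_meas[of n] by (intro integrable_mult_right integrable_real_indicator) (auto simp: fmeasurable_def)
      fix z
      show "norm (indicator (A n) z *\<^sub>R (k z * blinfun_apply \<Lambda> (resolvent x z))) \<le> ?c * indicator (A n) z"
      proof (cases "z \<in> A n")
        case True
        have "cmod (blinfun_apply \<Lambda> (resolvent x z)) \<le> norm \<Lambda> * norm (resolvent x z)" by (rule norm_blinfun)
        also have "\<dots> \<le> norm \<Lambda> * real n" using True by (intro mult_left_mono) (auto simp: A_def)
        finally have "cmod (k z) * cmod (blinfun_apply \<Lambda> (resolvent x z)) \<le> ?c"
          using D'[of z] D(2) True A_sub by (intro mult_mono) auto
        then show ?thesis using True by (simp add: norm_mult)
      qed simp
    qed
    also have "\<dots> = (D * real n * measure lebesgue (A n)) * norm \<Lambda>"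
      by simp
    finally show "cmod (T n \<Lambda>) \<le> (D * real n * measure lebesgue (A n)) * norm \<Lambda>" .
  qed
  show ?thesis
  proof (rule banach_steinhaus_limit[OF closed_cdual subspace_cdual _ _ bdd lim])
    show "T n (\<Lambda> + \<Lambda>') = T n \<Lambda> + T n \<Lambda>'" if "\<Lambda> \<in> cdual" "\<Lambda>' \<in> cdual" for n \<Lambda> \<Lambda>'
      using set_integral_add(2)[OF A_int[OF that(1)] A_int[OF that(2)]]
      by (simp add: T_def distrib_left blinfun.add_left)
    show "T n (r *\<^sub>R \<Lambda>) = r *\<^sub>R T n \<Lambda>" if "\<Lambda> \<in> cdual" for n r \<Lambda>
      by (simp add: T_def blinfun.scaleR_left scaleR_conv_of_real[where 'a=complex] mult.left_commute)
  qed
qed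

abbreviation calc :: "(complex \<Rightarrow> complex) \<Rightarrow> ('a \<Rightarrow>\<^sub>L complex) \<Rightarrow> complex" where
  "calc \<equiv> smooth_calculus_formula x \<gamma>"

context
  fixes p :: "complex \<Rightarrow> complex"
  assumes p: "polynomial_function p"
begin

lemma polynomial_regularity: "continuous_on UNIV p" "continuous_on UNIV (dbar p)" "\<And>z. p differentiable at z"
  using p by (auto intro: continuous_on_polymonial_function continuous_on_dbar differentiable_at_polynomial_function)

lemma calc_add_right:
  assumes "\<Lambda> \<in> cdual" "\<Lambda>' \<in> cdual"
  shows "calc p (\<Lambda> + \<Lambda>') = calc p \<Lambda> + calc p \<Lambda>'"
  using assms polynomial_regularity
  by (simp add: smooth_calculus_formula_eq cdual_add boundary_integral_add_right area_integral_add_right algebra_simps add_divide_distrib)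

lemma calc_scale_right:
  assumes "\<Lambda> \<in> cdual"
  shows "calc p (cdual_scale c \<Lambda>) = c * calc p \<Lambda>"
  using assms polynomial_regularity
  by (simp add: smooth_calculus_formula_eq cdual_scale_cdual boundary_integral_scale_right area_integral_scale_right algebra_simps)

lemma calc_bounded: "\<exists>K. \<forall>\<Lambda>\<in>cdual. cmod (calc p \<Lambda>) \<le> K * norm \<Lambda>"
proof -
  obtain K where K: "\<And>\<Lambda>. cmod (boundary_integral p \<Lambda>) \<le> K * norm \<Lambda>"
    using boundary_integral_bounded[OF polynomial_regularity(1)] by blast
  obtain K' where K': "\<And>\<Lambda>. \<Lambda> \<in> cdual \<Longrightarrow> cmod (area_integral (dbar p) \<Lambda>) \<le> K' * norm \<Lambda>"
    using area_integral_bounded[OF polynomial_regularity(2)] by blast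
  have "cmod (calc p \<Lambda>) \<le> (1 / (2 * pi) * K + 1 / pi * K') * norm \<Lambda>" if \<Lambda>: "\<Lambda> \<in> cdual" for \<Lambda>
  proof -
    have "cmod (calc p \<Lambda>) \<le> cmod (1 / (2 * of_real pi * \<i>) * boundary_integral p \<Lambda>)
        + cmod (1 / of_real pi * area_integral (dbar p) \<Lambda>)"
      unfolding smooth_calculus_formula_eq[OF \<Lambda>] by (rule norm_triangle_ineq4)
    also have "\<dots> = 1 / (2 * pi) * cmod (boundary_integral p \<Lambda>) + 1 / pi * cmod (area_integral (dbar p) \<Lambda>)"
      by (simp add: norm_mult norm_divide)
    also have "\<dots> \<le> 1 / (2 * pi) * (K * norm \<Lambda>) + 1 / pi * (K' * norm \<Lambda>)"
      by (intro add_mono mult_left_mono K K'[OF \<Lambda>]) auto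
    finally show ?thesis by (simp add: distrib_right)
  qed
  then show ?thesis by blast
qed

lemma calc_cmult_left:
  assumes "\<Lambda> \<in> cdual"
  shows "calc (\<lambda>z. c * p z) \<Lambda> = c * calc p \<Lambda>"
proof -
  have "dbar (\<lambda>z. c * p z) = (\<lambda>z. c * dbar p z)" using dbar_cmult[OF polynomial_regularity(3)] by blast
  then show ?thesis using assms polynomial_regularity
    by (simp add: smooth_calculus_formula_eq boundary_integral_cmult_left area_integral_cmult_left algebra_simps)
qed

lemma calc_add_left:
  assumes q: "polynomial_function q" and \<Lambda>: "\<Lambda> \<in> cdual"
  shows "calc (\<lambda>z. p z + q z) \<Lambda> = calc p \<Lambda> + calc q \<Lambda>"
proof -
  have q_regularity: "continuous_on UNIV q" "continuous_on UNIV (dbar q)" "q differentiable at z" for z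
    using q by (auto intro: continuous_on_polymonial_function continuous_on_dbar differentiable_at_polynomial_function)
  have "dbar (\<lambda>z. p z + q z) = (\<lambda>z. dbar p z + dbar q z)" using dbar_add[OF polynomial_regularity(3) q_regularity(3)] by blast
  then show ?thesis using \<Lambda> polynomial_regularity q_regularity
    by (simp add: smooth_calculus_formula_eq boundary_integral_add_left area_integral_add_left algebra_simps add_divide_distrib)
qed

end

lemma calc_ident:
  assumes "\<Lambda> \<in> cdual"
  shows "calc (\<lambda>z. z) \<Lambda> = blinfun_apply \<Lambda> x"
  using assms
  by (simp add: smooth_calculus_formula_eq boundary_integral_def area_integral_def dbar_id[abs_def]
    curve_integral_ident_resolvent set_lebesgue_integral_def)

end

section \<open>The continuous calculus\<close>

locale calculus =
  fixes x :: "'a::complex_banach_algebra"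
  assumes regular: "regular_element x" and well_defined: "continuous_calculus_well_defined x"
begin

text \<open>The radius leaves room for the circle of radius norm x + 1 between the spectrum and the
  boundary of the disc.\<close>

definition disc :: "complex set" where "disc = ball 0 (norm x + 2)"

text \<open>This is literally the choice made in \<open>smooth_calculus\<close>, so that on the disc
  the smooth calculus unfolds to \<open>calc\<close> and all functions share one curve.\<close>

definition path :: "(real \<Rightarrow> complex) list" where "path = (SOME \<gamma>. smooth_calculus_curve x disc \<gamma>)"

lemma disc: "open disc" "spectrum x \<subseteq> disc"
  using spectrum_subset_cball[of x] by (auto simp: disc_def)

lemma path: "smooth_calculus_curve x disc path"
proof -
  have r: "0 < norm x + 1" by (simp add: add_nonneg_pos)
  have "smooth_calculus_curve x disc [circlepath 0 (norm x + 1)]"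
    unfolding smooth_calculus_curve_def bounding_curve_circlepath(2,3)[OF r] disc_def
    using bounding_curve_circlepath(1)[OF r] spectrum_subset_cball[of x] by auto
  then show ?thesis unfolding path_def by (rule someI)
qed

sublocale regular_curve x path
  using path regular by unfold_locales (auto simp: smooth_calculus_curve_def)

lemma smooth_calculus_disc: "smooth_calculus x disc f = calc f"
  by (simp add: smooth_calculus_def path_def)

abbreviation cc :: "(complex \<Rightarrow> complex) \<Rightarrow> ('a \<Rightarrow>\<^sub>L complex) \<Rightarrow> complex" where
  "cc \<equiv> continuous_calculus x"

text \<open>Tietze extends f with the same bound B, and Stone-Weierstrass approximates the extension
  on the closed disc. Thus the supremum over the spectrum controls polynomials on the whole
  disc.\<close>

lemma polynomial_approximation:
  assumes f: "continuous_on (spectrum x) f" and B: "0 \<le> B" "\<And>z. z \<in> spectrum x \<Longrightarrow> cmod (f z) \<le> B"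
  obtains F p where "smooth_approximation x f disc F p" "\<And>n. polynomial_function (p n)"
    "\<And>n z. z \<in> disc \<Longrightarrow> cmod (p n z) \<le> B + inverse (real (Suc n))"
proof -
  obtain F where F: "continuous_on UNIV F" "\<And>z. z \<in> spectrum x \<Longrightarrow> F z = f z" "\<And>z. cmod (F z) \<le> B"
    using Tietze[OF f _ B, of UNIV] closed_spectrum[of x] by auto
  have "\<exists>p. polynomial_function p \<and> (\<forall>z\<in>cball 0 (norm x + 2). norm (F z - p z) < inverse (real (Suc n)))" for n
    by (rule Stone_Weierstrass_polynomial_function) (auto intro: continuous_on_subset[OF F(1)])
  then obtain p where p: "\<And>n. polynomial_function (p n)"
    "\<And>n z. z \<in> cball 0 (norm x + 2) \<Longrightarrow> norm (F z - p n z) < inverse (real (Suc n))" by metis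
  have close: "norm (p n z - F z) < inverse (real (Suc n))" if "z \<in> disc" for n z
    using p(2)[of z n] that by (simp add: disc_def norm_minus_commute)
  show ?thesis
  proof (rule that)
    have "uniform_limit disc p F sequentially"
    proof (rule uniform_limitI)
      fix e :: real assume "0 < e"
      then have "\<forall>\<^sub>F n in sequentially. inverse (real (Suc n)) < e"
        using LIMSEQ_inverse_real_of_nat order_tendstoD(2) by blast
      then show "\<forall>\<^sub>F n in sequentially. \<forall>z\<in>disc. dist (p n z) (F z) < e"
      proof eventually_elim
        case (elim n)
        then show ?case unfolding dist_norm using close less_trans by blast
      qed
    qed
    then show "smooth_approximation x f disc F p"
      unfolding smooth_approximation_def
      using disc F continuous_on_subset[OF F(1)] smooth_on_polynomial_function[OF p(1)] by auto
    fix n z assume "z \<in> disc"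
    then have "cmod (p n z - F z) + cmod (F z) \<le> inverse (real (Suc n)) + B"
      by (intro add_mono less_imp_le[OF close] F(3))
    then show "cmod (p n z) \<le> B + inverse (real (Suc n))"
      using norm_triangle_ineq[of "p n z - F z" "F z"] by simp
  qed (rule p(1))
qed

lemma spectrum_bounded_function:
  assumes "continuous_on (spectrum x) (f :: complex \<Rightarrow> complex)"
  obtains B where "0 \<le> B" "\<And>z. z \<in> spectrum x \<Longrightarrow> cmod (f z) \<le> B"
proof -
  have "bounded (f ` spectrum x)"
    by (intro compact_imp_bounded compact_continuous_image assms compact_spectrum)
  then obtain B where "B > 0" "\<And>y. y \<in> f ` spectrum x \<Longrightarrow> cmod y \<le> B" unfolding bounded_pos by auto
  then show ?thesis using that[of B] by auto
qed

text \<open>\<open>continuous_calculus_limit\<close> quantifies over all approximations, so a single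
  one on the disc already determines the limit; this makes the definite description in
  \<open>continuous_calculus\<close> denote it.\<close>

lemma calculus_limit:
  assumes f: "continuous_on (spectrum x) f" and \<Lambda>: "\<Lambda> \<in> cdual"
    and approx: "smooth_approximation x f disc F h"
  shows "(\<lambda>n. calc (h n) \<Lambda>) \<longlonglongrightarrow> cc f \<Lambda>"
proof -
  have lim: "(\<lambda>n. calc (h n) \<Lambda>) \<longlonglongrightarrow> L" if "continuous_calculus_limit x f \<Lambda> L" for L
    using that approx unfolding continuous_calculus_limit_def smooth_calculus_disc[symmetric] by blast
  obtain L where L: "continuous_calculus_limit x f \<Lambda> L"
    using well_defined f \<Lambda> unfolding continuous_calculus_well_defined_def by blast
  have "cc f \<Lambda> = L"
    unfolding continuous_calculus_def
  proof (rule the_equality)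
    show "L' = L" if "continuous_calculus_limit x f \<Lambda> L'" for L'
      using LIMSEQ_unique[OF lim[OF that] lim[OF L]] .
  qed (rule L)
  then show ?thesis using lim[OF L] by simp
qed

lemma calculus_cong:
  assumes "\<And>z. z \<in> spectrum x \<Longrightarrow> f z = g z"
  shows "cc f \<Lambda> = cc g \<Lambda>"
proof -
  have "smooth_approximation x f = smooth_approximation x g"
    unfolding smooth_approximation_def[abs_def] using assms by (intro ext) auto
  then show ?thesis by (simp add: continuous_calculus_def continuous_calculus_limit_def)
qed

text \<open>Were the values on the polynomials bounded by one not bounded, rescaled polynomials would
  tend to zero uniformly with values tending to infinity, against the existence of the limit.\<close>

lemma calc_pointwise_bounded:
  assumes \<Lambda>: "\<Lambda> \<in> cdual"
  shows "\<exists>C. \<forall>p\<in>{p. polynomial_function p \<and> (\<forall>z\<in>disc. cmod (p z) \<le> 1)}. cmod (calc p \<Lambda>) \<le> C"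
proof (rule ccontr)
  assume "\<not> ?thesis"
  then have "\<forall>C. \<exists>p. polynomial_function p \<and> (\<forall>z\<in>disc. cmod (p z) \<le> 1) \<and> C < cmod (calc p \<Lambda>)"
    by (auto simp: not_le)
  then obtain P where P: "\<And>C. polynomial_function (P C)" "\<And>C z. z \<in> disc \<Longrightarrow> cmod (P C z) \<le> 1"
    "\<And>C. C < cmod (calc (P C) \<Lambda>)" by metis
  \<comment> \<open>With m = n + 1, the value of P (m^2) exceeds m^2 in modulus; after division by m
    the supremum is at most 1 / m while the value still exceeds m.\<close>
  define h where "h n z = of_real (inverse (real (Suc n))) * P (real (Suc n) ^ 2) z" for n z
  have poly: "polynomial_function (h n)" for n
    unfolding h_def by (intro polynomial_function_cmult P)
  have "uniform_limit disc h (\<lambda>z. 0) sequentially"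
  proof (rule uniform_limitI)
    fix e :: real assume "0 < e"
    then have "\<forall>\<^sub>F n in sequentially. inverse (real (Suc n)) < e"
      using LIMSEQ_inverse_real_of_nat order_tendstoD(2) by blast
    then show "\<forall>\<^sub>F n in sequentially. \<forall>z\<in>disc. dist (h n z) 0 < e"
    proof eventually_elim
      case (elim n)
      show ?case
      proof
        fix z assume "z \<in> disc"
        then have "inverse (real (Suc n)) * cmod (P (real (Suc n) ^ 2) z) \<le> inverse (real (Suc n)) * 1"
          by (intro mult_left_mono P) auto
        moreover have "cmod (h n z) = inverse (real (Suc n)) * cmod (P (real (Suc n) ^ 2) z)"
          unfolding h_def norm_mult norm_of_real by simp
        ultimately have "cmod (h n z) < e" using elim by linarith
        then show "dist (h n z) 0 < e" by simp
      qed
    qed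
  qed
  then have "smooth_approximation x (\<lambda>z. 0) disc (\<lambda>z. 0) h"
    unfolding smooth_approximation_def using disc smooth_on_polynomial_function[OF poly] by auto
  then have "(\<lambda>n. calc (h n) \<Lambda>) \<longlonglongrightarrow> cc (\<lambda>z. 0) \<Lambda>"
    by (intro calculus_limit \<Lambda>) auto
  then have "Bseq (\<lambda>n. calc (h n) \<Lambda>)" by (intro convergent_imp_Bseq convergentI)
  then obtain C where C: "\<And>n. cmod (calc (h n) \<Lambda>) \<le> C" unfolding Bseq_def by blast
  obtain n where n: "C < real n" using reals_Archimedean2 by blast
  let ?m = "real (Suc n)"
  have "calc (h n) \<Lambda> = of_real (inverse ?m) * calc (P (?m ^ 2)) \<Lambda>"
    unfolding h_def by (rule calc_cmult_left[OF P(1) \<Lambda>])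
  then have "cmod (calc (h n) \<Lambda>) = \<bar>inverse ?m\<bar> * cmod (calc (P (?m ^ 2)) \<Lambda>)"
    by (simp only: norm_mult norm_of_real)
  moreover have "inverse ?m * ?m ^ 2 \<le> inverse ?m * cmod (calc (P (?m ^ 2)) \<Lambda>)"
    by (intro mult_left_mono less_imp_le[OF P(3)]) auto
  moreover have "inverse ?m * ?m ^ 2 = ?m" "\<bar>inverse ?m\<bar> = inverse ?m" by (simp_all add: power2_eq_square)
  ultimately have "?m \<le> cmod (calc (h n) \<Lambda>)" by (simp only:)
  then show False using C[of n] n by simp
qed

text \<open>Polynomials are the index set and the dual is the Banach space. A bound B is reached by
  rescaling to supremum one, hence B > 0.\<close>

lemma calc_uniformly_bounded:
  obtains K where "0 \<le> K" "\<And>p \<Lambda> B. polynomial_function p \<Longrightarrow> \<Lambda> \<in> cdual \<Longrightarrow> 0 < B \<Longrightarrow>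
    (\<And>z. z \<in> disc \<Longrightarrow> cmod (p z) \<le> B) \<Longrightarrow> cmod (calc p \<Lambda>) \<le> K * norm \<Lambda> * B"
proof -
  let ?I = "{p. polynomial_function p \<and> (\<forall>z\<in>disc. cmod (p z) \<le> 1)}"
  have "\<exists>K. \<forall>p\<in>?I. \<forall>\<Lambda>\<in>cdual. norm (calc p \<Lambda>) \<le> K * norm \<Lambda>"
  proof (rule uniform_boundedness[OF closed_cdual subspace_cdual])
    show "calc p (\<Lambda> + \<Lambda>') = calc p \<Lambda> + calc p \<Lambda>'" if "p \<in> ?I" "\<Lambda> \<in> cdual" "\<Lambda>' \<in> cdual" for p \<Lambda> \<Lambda>'
      using that by (intro calc_add_right) auto
    show "calc p (c *\<^sub>R \<Lambda>) = c *\<^sub>R calc p \<Lambda>" if "p \<in> ?I" "\<Lambda> \<in> cdual" for p c \<Lambda>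
      using that calc_scale_right[of p \<Lambda> "of_real c"] by (simp add: cdual_scale_of_real scaleR_conv_of_real)
    show "\<exists>K. \<forall>\<Lambda>\<in>cdual. norm (calc p \<Lambda>) \<le> K * norm \<Lambda>" if "p \<in> ?I" for p
      using that by (intro calc_bounded) auto
    show "\<exists>C. \<forall>p\<in>?I. norm (calc p \<Lambda>) \<le> C" if "\<Lambda> \<in> cdual" for \<Lambda>
      using that by (rule calc_pointwise_bounded)
  qed
  then obtain K where K: "\<And>p \<Lambda>. p \<in> ?I \<Longrightarrow> \<Lambda> \<in> cdual \<Longrightarrow> norm (calc p \<Lambda>) \<le> K * norm \<Lambda>" by blast
  show ?thesis
  proof (rule that[of "max K 0"])
    fix p and \<Lambda> :: "'a \<Rightarrow>\<^sub>L complex" and B :: real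
    assume p: "polynomial_function p" and \<Lambda>: "\<Lambda> \<in> cdual" and B: "0 < B" "\<And>z. z \<in> disc \<Longrightarrow> cmod (p z) \<le> B"
    have "(\<lambda>z. of_real (inverse B) * p z) \<in> ?I"
    proof (intro CollectI conjI ballI polynomial_function_cmult p)
      fix z assume "z \<in> disc"
      then show "cmod (of_real (inverse B) * p z) \<le> 1"
        using B(1) B(2)[of z] unfolding norm_mult norm_of_real by (simp add: field_simps)
    qed
    then have "cmod (calc (\<lambda>z. of_real (inverse B) * p z) \<Lambda>) \<le> K * norm \<Lambda>" using K \<Lambda> by blast
    also have "\<dots> \<le> max K 0 * norm \<Lambda>" by (intro mult_right_mono) auto
    finally have "inverse B * cmod (calc p \<Lambda>) \<le> max K 0 * norm \<Lambda>"
      using B by (simp add: calc_cmult_left[OF p \<Lambda>] norm_mult norm_inverse)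
    then show "cmod (calc p \<Lambda>) \<le> max K 0 * norm \<Lambda> * B"
      using B by (simp add: field_simps)
  qed simp
qed

lemma calculus_bounded:
  "\<exists>K\<ge>0. \<forall>f. continuous_on (spectrum x) f \<longrightarrow> (\<forall>\<Lambda>\<in>cdual. \<forall>B\<ge>0.
     (\<forall>z\<in>spectrum x. cmod (f z) \<le> B) \<longrightarrow> cmod (cc f \<Lambda>) \<le> K * norm \<Lambda> * B)"
proof -
  obtain K where K: "0 \<le> K" "\<And>p \<Lambda> B. polynomial_function p \<Longrightarrow> \<Lambda> \<in> cdual \<Longrightarrow> 0 < B \<Longrightarrow>
    (\<And>z. z \<in> disc \<Longrightarrow> cmod (p z) \<le> B) \<Longrightarrow> cmod (calc p \<Lambda>) \<le> K * norm \<Lambda> * B"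
    using calc_uniformly_bounded by blast
  show ?thesis
  proof (intro exI[of _ K] conjI allI ballI impI)
    show "0 \<le> K" by (fact K(1))
  next
    fix f and \<Lambda> :: "'a \<Rightarrow>\<^sub>L complex" and B :: real
    assume f: "continuous_on (spectrum x) f" and \<Lambda>: "\<Lambda> \<in> cdual"
      and B0: "0 \<le> B" and bound: "\<forall>z\<in>spectrum x. cmod (f z) \<le> B"
    then have B: "0 \<le> B" "\<And>z. z \<in> spectrum x \<Longrightarrow> cmod (f z) \<le> B" by auto
    obtain F p where p: "smooth_approximation x f disc F p" "\<And>n. polynomial_function (p n)"
      "\<And>n z. z \<in> disc \<Longrightarrow> cmod (p n z) \<le> B + inverse (real (Suc n))"
      using polynomial_approximation[OF f B] by blast
    have "(\<lambda>n. cmod (calc (p n) \<Lambda>)) \<longlonglongrightarrow> cmod (cc f \<Lambda>)"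
      by (intro tendsto_norm calculus_limit[OF f \<Lambda> p(1)])
    moreover have "(\<lambda>n. K * norm \<Lambda> * (B + inverse (real (Suc n)))) \<longlonglongrightarrow> K * norm \<Lambda> * (B + 0)"
      by (intro tendsto_mult tendsto_add tendsto_const LIMSEQ_inverse_real_of_nat)
    \<comment> \<open>The summand 1 / (n + 1) keeps the bound positive when B = 0, as the estimate
      for polynomials demands.\<close>
    moreover have "cmod (calc (p n) \<Lambda>) \<le> K * norm \<Lambda> * (B + inverse (real (Suc n)))" for n
      using B(1) by (intro K(2)[OF p(2) \<Lambda> _ p(3)]) (auto intro: add_nonneg_pos)
    ultimately show "cmod (cc f \<Lambda>) \<le> K * norm \<Lambda> * B"
      using LIMSEQ_le[of "\<lambda>n. cmod (calc (p n) \<Lambda>)"] by auto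
  qed
qed

section \<open>Linearity of the continuous calculus in the function and in the functional\<close>

lemma calculus_add_left:
  assumes f: "continuous_on (spectrum x) f" and g: "continuous_on (spectrum x) g" and \<Lambda>: "\<Lambda> \<in> cdual"
  shows "cc (\<lambda>z. f z + g z) \<Lambda> = cc f \<Lambda> + cc g \<Lambda>"
proof -
  obtain F p where p: "smooth_approximation x f disc F p" "\<And>n. polynomial_function (p n)"
    using spectrum_bounded_function[OF f] polynomial_approximation[OF f] by metis
  obtain G q where q: "smooth_approximation x g disc G q" "\<And>n. polynomial_function (q n)"
    using spectrum_bounded_function[OF g] polynomial_approximation[OF g] by metis
  \<comment> \<open>Sums of approximations approximate the sum, and the calculus can be computed
    along any approximation.\<close>
  have "smooth_approximation x (\<lambda>z. f z + g z) disc (\<lambda>z. F z + G z) (\<lambda>n z. p n z + q n z)"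
    unfolding smooth_approximation_def
  proof (intro conjI allI ballI)
    show "smooth_on disc (\<lambda>z. p n z + q n z)" for n
      by (intro smooth_on_polynomial_function polynomial_function_add p q)
  qed (use p(1) q(1) in \<open>auto simp: smooth_approximation_def intro: continuous_on_add uniform_limit_add\<close>)
  then have "(\<lambda>n. calc (\<lambda>z. p n z + q n z) \<Lambda>) \<longlonglongrightarrow> cc (\<lambda>z. f z + g z) \<Lambda>"
    by (intro calculus_limit \<Lambda> continuous_on_add f g)
  moreover have "(\<lambda>n. calc (\<lambda>z. p n z + q n z) \<Lambda>) \<longlonglongrightarrow> cc f \<Lambda> + cc g \<Lambda>"
    unfolding calc_add_left[OF p(2) q(2) \<Lambda>]
    by (intro tendsto_add calculus_limit[OF f \<Lambda> p(1)] calculus_limit[OF g \<Lambda> q(1)])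
  ultimately show ?thesis by (rule LIMSEQ_unique)
qed

lemma calculus_cmult_left:
  assumes f: "continuous_on (spectrum x) f" and \<Lambda>: "\<Lambda> \<in> cdual"
  shows "cc (\<lambda>z. c * f z) \<Lambda> = c * cc f \<Lambda>"
proof -
  obtain F p where p: "smooth_approximation x f disc F p" "\<And>n. polynomial_function (p n)"
    using spectrum_bounded_function[OF f] polynomial_approximation[OF f] by metis
  have "smooth_approximation x (\<lambda>z. c * f z) disc (\<lambda>z. c * F z) (\<lambda>n z. c * p n z)"
    unfolding smooth_approximation_def
  proof (intro conjI allI ballI)
    show "smooth_on disc (\<lambda>z. c * p n z)" for n
      by (intro smooth_on_polynomial_function polynomial_function_cmult p)
    show "uniform_limit disc (\<lambda>n z. c * p n z) (\<lambda>z. c * F z) sequentially"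
      using p(1) by (intro bounded_linear.uniform_limit[OF bounded_linear_mult_right])
        (auto simp: smooth_approximation_def)
  qed (use p(1) in \<open>auto simp: smooth_approximation_def intro: continuous_on_mult_left\<close>)
  then have "(\<lambda>n. calc (\<lambda>z. c * p n z) \<Lambda>) \<longlonglongrightarrow> cc (\<lambda>z. c * f z) \<Lambda>"
    by (intro calculus_limit \<Lambda> continuous_on_mult_left f)
  moreover have "(\<lambda>n. calc (\<lambda>z. c * p n z) \<Lambda>) \<longlonglongrightarrow> c * cc f \<Lambda>"
    unfolding calc_cmult_left[OF p(2) \<Lambda>]
    by (intro tendsto_mult tendsto_const calculus_limit[OF f \<Lambda> p(1)])
  ultimately show ?thesis by (rule LIMSEQ_unique)
qed

lemma calculus_add_right:
  assumes f: "continuous_on (spectrum x) f" and \<Lambda>: "\<Lambda> \<in> cdual" "\<Lambda>' \<in> cdual"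
  shows "cc f (\<Lambda> + \<Lambda>') = cc f \<Lambda> + cc f \<Lambda>'"
proof -
  obtain F p where p: "smooth_approximation x f disc F p" "\<And>n. polynomial_function (p n)"
    using spectrum_bounded_function[OF f] polynomial_approximation[OF f] by metis
  have "(\<lambda>n. calc (p n) (\<Lambda> + \<Lambda>')) \<longlonglongrightarrow> cc f (\<Lambda> + \<Lambda>')"
    by (intro calculus_limit[OF f _ p(1)] cdual_add \<Lambda>)
  moreover have "(\<lambda>n. calc (p n) (\<Lambda> + \<Lambda>')) \<longlonglongrightarrow> cc f \<Lambda> + cc f \<Lambda>'"
    unfolding calc_add_right[OF p(2) \<Lambda>]
    by (intro tendsto_add calculus_limit[OF f _ p(1)] \<Lambda>)
  ultimately show ?thesis by (rule LIMSEQ_unique)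
qed

lemma calculus_scale_right:
  assumes f: "continuous_on (spectrum x) f" and \<Lambda>: "\<Lambda> \<in> cdual"
  shows "cc f (cdual_scale c \<Lambda>) = c * cc f \<Lambda>"
proof -
  obtain F p where p: "smooth_approximation x f disc F p" "\<And>n. polynomial_function (p n)"
    using spectrum_bounded_function[OF f] polynomial_approximation[OF f] by metis
  have "(\<lambda>n. calc (p n) (cdual_scale c \<Lambda>)) \<longlonglongrightarrow> cc f (cdual_scale c \<Lambda>)"
    by (intro calculus_limit[OF f _ p(1)] cdual_scale_cdual \<Lambda>)
  moreover have "(\<lambda>n. calc (p n) (cdual_scale c \<Lambda>)) \<longlonglongrightarrow> c * cc f \<Lambda>"
    unfolding calc_scale_right[OF p(2) \<Lambda>]
    by (intro tendsto_mult tendsto_const calculus_limit[OF f \<Lambda> p(1)])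
  ultimately show ?thesis by (rule LIMSEQ_unique)
qed

text \<open>The identity is smooth and approximates itself, so its value is that of the smooth
  calculus.\<close>

lemma calculus_ident:
  assumes \<Lambda>: "\<Lambda> \<in> cdual"
  shows "cc (\<lambda>z. z) \<Lambda> = blinfun_apply \<Lambda> x"
proof -
  have "smooth_approximation x (\<lambda>z. z) disc (\<lambda>z. z) (\<lambda>n z. z)"
    unfolding smooth_approximation_def
    using disc by (auto intro: smooth_on_polynomial_function uniform_limit_const)
  then have "(\<lambda>n::nat. calc (\<lambda>z. z) \<Lambda>) \<longlonglongrightarrow> cc (\<lambda>z. z) \<Lambda>"
    by (intro calculus_limit \<Lambda> continuous_on_id)
  then show ?thesis using LIMSEQ_unique tendsto_const calc_ident[OF \<Lambda>] by metis
qed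

end

section \<open>The representing measures\<close>

text \<open>The functions f k do not depend on the measure. One sequence can therefore compare two
  measures, and along a family it exhibits \<Lambda> \<mapsto> \<mu> \<Lambda> C as a pointwise
  limit.\<close>

lemma complex_measure_closed_limit:
  fixes K :: "'a::metric_space set"
  assumes C: "closed C" "C \<subseteq> K"
  obtains f :: "nat \<Rightarrow> 'a \<Rightarrow> complex" where "\<And>k. continuous_on K (f k)"
    "\<And>\<nu>. \<nu> \<in> complex_measures (restrict_space borel K) \<Longrightarrow>
      (\<lambda>k. complex_measure_integral (restrict_space borel K) \<nu> (f k)) \<longlonglongrightarrow> \<nu> C"
proof -
  let ?M = "restrict_space borel K"
  obtain f :: "nat \<Rightarrow> 'a \<Rightarrow> real" where f: "\<And>k. continuous_on UNIV (f k)" "\<And>k x. 0 \<le> f k x" "\<And>k x. f k x \<le> 1"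
    "\<And>x. (\<lambda>k. f k x) \<longlonglongrightarrow> indicator C x"
    using closed_indicator_approximation[OF C(1)] by blast
  let ?f = "\<lambda>k x. complex_of_real (f k x)"
  have c: "continuous_on K (?f k)" for k
    by (intro continuous_on_of_real continuous_on_subset[OF f(1)]) auto
  have CM: "C \<in> sets ?M" using C by (auto simp: sets_restrict_space)
  show ?thesis
  proof (rule that[of ?f, OF c])
    fix \<nu> assume \<nu>: "\<nu> \<in> complex_measures ?M"
    show "(\<lambda>k. complex_measure_integral ?M \<nu> (?f k)) \<longlonglongrightarrow> \<nu> C"
    proof (rule complex_measure_integral_tendsto[OF \<nu> CM])
      show "?f k \<in> borel_measurable ?M" for k
        using c by (rule borel_measurable_continuous_on_restrict)
      show "(\<lambda>k. ?f k x) \<longlonglongrightarrow> indicator C x" for x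
        using tendsto_of_real[OF f(4)[of x], where 'a=complex] by (simp split: split_indicator_asm)
    qed (use f(2,3) in \<open>simp add: abs_le_iff\<close>)
  qed
qed

lemma complex_measures_eqI:
  fixes K :: "'a::metric_space set"
  assumes K: "closed K"
    and \<nu>: "\<nu> \<in> complex_measures (restrict_space borel K)" and \<nu>': "\<nu>' \<in> complex_measures (restrict_space borel K)"
    and eq: "\<And>f. continuous_on K f \<Longrightarrow>
      complex_measure_integral (restrict_space borel K) \<nu> f = complex_measure_integral (restrict_space borel K) \<nu>' f"
  shows "\<nu> = \<nu>'"
proof (rule extensionalityI[of _ "sets (restrict_space borel K)"])
  let ?M = "restrict_space borel K"
  show "\<nu> \<in> extensional (sets ?M)" "\<nu>' \<in> extensional (sets ?M)"
    using \<nu> \<nu>' by (auto simp: complex_measures_def)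
  have sums: "(\<lambda>i. \<nu> (A i)) sums \<nu> (\<Union>i. A i)" if "\<nu> \<in> complex_measures ?M" "disjoint_family A" "range A \<subseteq> sets ?M"
    for \<nu> and A :: "nat \<Rightarrow> 'a set"
    using that by (auto simp: complex_measures_def)
  have on_closed: "\<nu> C = \<nu>' C" if C: "closed C" "C \<subseteq> K" for C
  proof -
    obtain f :: "nat \<Rightarrow> 'a \<Rightarrow> complex" where f: "\<And>k. continuous_on K (f k)"
      "\<And>\<nu>. \<nu> \<in> complex_measures ?M \<Longrightarrow> (\<lambda>k. complex_measure_integral ?M \<nu> (f k)) \<longlonglongrightarrow> \<nu> C"
      using complex_measure_closed_limit[OF C] by blast
    show ?thesis
      using LIMSEQ_unique[OF f(2)[OF \<nu>]] f(2)[OF \<nu>'] by (simp add: eq[OF f(1)])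
  qed
  fix E assume "E \<in> sets ?M"
  with K show "\<nu> E = \<nu>' E"
  proof (induction rule: restrict_borel_induct)
    case (closed C)
    then show ?case by (rule on_closed)
  next
    case (compl A)
    have KM: "K \<in> sets ?M" using K by (auto simp: sets_restrict_space)
    have AK: "A \<subseteq> K" using sets.sets_into_space[OF compl(1)] by (simp add: space_restrict_space)
    have "\<nu> (K - A) = \<nu> K - \<nu> A" if "\<nu> \<in> complex_measures ?M" for \<nu>
      using signed_measure_Diff[OF complex_measures_signed(1)[OF that] KM compl(1) AK]
        signed_measure_Diff[OF complex_measures_signed(2)[OF that] KM compl(1) AK]
      by (simp add: complex_eq_iff)
    from this[OF \<nu>] this[OF \<nu>'] show ?case using on_closed[OF K] compl(2) by simp
  next
    case (union A)
    then show ?case using sums[OF \<nu> union(1,2)] sums[OF \<nu>' union(1,2)] sums_unique2 by simp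
  qed
qed

text \<open>Elements of the bidual, as functions on \<open>cdual\<close>. Boundedness is used in
  place of continuity because Banach-Steinhaus carries it through pointwise limits.\<close>

definition dual_functional :: "(('a::complex_banach_algebra \<Rightarrow>\<^sub>L complex) \<Rightarrow> complex) \<Rightarrow> bool" where
  "dual_functional \<phi> \<longleftrightarrow>
     (\<forall>\<Lambda>\<in>cdual. \<forall>\<Lambda>'\<in>cdual. \<phi> (\<Lambda> + \<Lambda>') = \<phi> \<Lambda> + \<phi> \<Lambda>') \<and>
     (\<forall>c. \<forall>\<Lambda>\<in>cdual. \<phi> (cdual_scale c \<Lambda>) = c * \<phi> \<Lambda>) \<and>
     (\<exists>K. \<forall>\<Lambda>\<in>cdual. cmod (\<phi> \<Lambda>) \<le> K * norm \<Lambda>)"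

lemma dual_functional_cong:
  assumes "dual_functional \<psi>" and "\<And>\<Lambda>. \<Lambda> \<in> cdual \<Longrightarrow> \<phi> \<Lambda> = \<psi> \<Lambda>"
  shows "dual_functional \<phi>"
  using assms by (simp add: dual_functional_def cdual_add cdual_scale_cdual)

lemma dual_functional_zero: "dual_functional (\<lambda>\<Lambda>. 0)"
  by (auto simp: dual_functional_def intro: exI[of _ 0])

lemma dual_functional_add:
  assumes "dual_functional \<phi>" "dual_functional \<psi>"
  shows "dual_functional (\<lambda>\<Lambda>. \<phi> \<Lambda> + \<psi> \<Lambda>)"
proof -
  obtain K L where KL: "\<And>\<Lambda>. \<Lambda> \<in> cdual \<Longrightarrow> cmod (\<phi> \<Lambda>) \<le> K * norm \<Lambda>" "\<And>\<Lambda>. \<Lambda> \<in> cdual \<Longrightarrow> cmod (\<psi> \<Lambda>) \<le> L * norm \<Lambda>"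
    using assms unfolding dual_functional_def by blast
  have "cmod (\<phi> \<Lambda> + \<psi> \<Lambda>) \<le> (K + L) * norm \<Lambda>" if "\<Lambda> \<in> cdual" for \<Lambda>
    using norm_triangle_mono[OF KL(1)[OF that] KL(2)[OF that]] by (simp add: distrib_right)
  then show ?thesis using assms by (auto simp: dual_functional_def distrib_left)
qed

lemma dual_functional_uminus: "dual_functional \<phi> \<Longrightarrow> dual_functional (\<lambda>\<Lambda>. - \<phi> \<Lambda>)"
  by (auto simp: dual_functional_def)

lemma dual_functional_sum: "(\<And>i. i \<in> I \<Longrightarrow> dual_functional (\<phi> i)) \<Longrightarrow> dual_functional (\<lambda>\<Lambda>. \<Sum>i\<in>I. \<phi> i \<Lambda>)"
  by (induction I rule: infinite_finite_induct) (auto intro: dual_functional_zero dual_functional_add)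

lemma dual_functional_scaleR:
  "dual_functional \<phi> \<Longrightarrow> \<Lambda> \<in> cdual \<Longrightarrow> \<phi> (r *\<^sub>R \<Lambda>) = r *\<^sub>R \<phi> \<Lambda>"
  unfolding dual_functional_def cdual_scale_of_real[symmetric] by (simp add: scaleR_conv_of_real)

text \<open>Linearity passes to the limit directly; the bound needs Banach-Steinhaus, as the \<phi>
  n come without a common constant.\<close>

lemma dual_functional_limit:
  assumes \<phi>: "\<And>n. dual_functional (\<phi> n)" and lim: "\<And>\<Lambda>. \<Lambda> \<in> cdual \<Longrightarrow> (\<lambda>n. \<phi> n \<Lambda>) \<longlonglongrightarrow> \<psi> \<Lambda>"
  shows "dual_functional \<psi>"
  unfolding dual_functional_def
proof (intro conjI ballI allI)
  fix \<Lambda> :: "'a \<Rightarrow>\<^sub>L complex" assume \<Lambda>: "\<Lambda> \<in> cdual"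
  show "\<psi> (\<Lambda> + \<Lambda>') = \<psi> \<Lambda> + \<psi> \<Lambda>'" if \<Lambda>': "\<Lambda>' \<in> cdual" for \<Lambda>'
  proof (rule LIMSEQ_unique[OF lim[OF cdual_add[OF \<Lambda> \<Lambda>']]])
    have "\<phi> n (\<Lambda> + \<Lambda>') = \<phi> n \<Lambda> + \<phi> n \<Lambda>'" for n
      using \<phi> \<Lambda> \<Lambda>' by (auto simp: dual_functional_def)
    then show "(\<lambda>n. \<phi> n (\<Lambda> + \<Lambda>')) \<longlonglongrightarrow> \<psi> \<Lambda> + \<psi> \<Lambda>'"
      using tendsto_add[OF lim[OF \<Lambda>] lim[OF \<Lambda>']] by simp
  qed
  show "\<psi> (cdual_scale c \<Lambda>) = c * \<psi> \<Lambda>" for c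
  proof (rule LIMSEQ_unique[OF lim[OF cdual_scale_cdual[OF \<Lambda>]]])
    have "\<phi> n (cdual_scale c \<Lambda>) = c * \<phi> n \<Lambda>" for n
      using \<phi> \<Lambda> by (auto simp: dual_functional_def)
    then show "(\<lambda>n. \<phi> n (cdual_scale c \<Lambda>)) \<longlonglongrightarrow> c * \<psi> \<Lambda>"
      using tendsto_mult_left[OF lim[OF \<Lambda>], of c] by simp
  qed
next
  show "\<exists>K. \<forall>\<Lambda>\<in>cdual. cmod (\<psi> \<Lambda>) \<le> K * norm \<Lambda>"
  proof (rule banach_steinhaus_limit[OF closed_cdual subspace_cdual _ _ _ lim])
    show "\<phi> i (c *\<^sub>R \<Lambda>) = c *\<^sub>R \<phi> i \<Lambda>" if "\<Lambda> \<in> cdual" for i c \<Lambda>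
      using \<phi> that by (rule dual_functional_scaleR)
  qed (use \<phi> in \<open>auto simp: dual_functional_def\<close>)
qed

text \<open>Linear and bounded maps are Lipschitz; max K 0 appears because a Lipschitz constant must
  be nonnegative.\<close>

lemma continuous_on_dual_functional:
  assumes \<phi>: "dual_functional \<phi>"
  shows "continuous_on cdual \<phi>"
proof -
  obtain K where K: "\<And>\<Lambda>. \<Lambda> \<in> cdual \<Longrightarrow> cmod (\<phi> \<Lambda>) \<le> K * norm \<Lambda>"
    using \<phi> unfolding dual_functional_def by blast
  have "cmod (\<phi> \<Lambda> - \<phi> \<Lambda>') \<le> max K 0 * norm (\<Lambda> - \<Lambda>')" if "\<Lambda> \<in> cdual" "\<Lambda>' \<in> cdual" for \<Lambda> \<Lambda>'
  proof -
    have d: "\<Lambda> - \<Lambda>' \<in> cdual" using subspace_diff[OF subspace_cdual that] .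
    then have "\<phi> (\<Lambda> - \<Lambda>' + \<Lambda>') = \<phi> (\<Lambda> - \<Lambda>') + \<phi> \<Lambda>'"
      using \<phi> that unfolding dual_functional_def by blast
    then have "cmod (\<phi> \<Lambda> - \<phi> \<Lambda>') \<le> K * norm (\<Lambda> - \<Lambda>')" using K[OF d] by simp
    also have "\<dots> \<le> max K 0 * norm (\<Lambda> - \<Lambda>')" by (intro mult_right_mono) auto
    finally show ?thesis .
  qed
  then have "(max K 0)-lipschitz_on cdual \<phi>"
    by (intro lipschitz_onI) (auto simp: dist_norm)
  then show ?thesis by (rule lipschitz_on_continuous_on)
qed

section \<open>Existence and uniqueness of the representing family\<close>

context calculus
begin

lemma dual_functional_calculus:
  assumes "continuous_on (spectrum x) f"
  shows "dual_functional (cc f)"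
proof -
  obtain B where B: "0 \<le> B" "\<And>z. z \<in> spectrum x \<Longrightarrow> cmod (f z) \<le> B"
    using spectrum_bounded_function[OF assms] by blast
  obtain K where "\<forall>f. continuous_on (spectrum x) f \<longrightarrow> (\<forall>\<Lambda>\<in>cdual. \<forall>B\<ge>0.
    (\<forall>z\<in>spectrum x. cmod (f z) \<le> B) \<longrightarrow> cmod (cc f \<Lambda>) \<le> K * norm \<Lambda> * B)"
    using calculus_bounded by blast
  then have "cmod (cc f \<Lambda>) \<le> K * norm \<Lambda> * B" if "\<Lambda> \<in> cdual" for \<Lambda>
    using that assms B by simp
  then have "\<exists>K. \<forall>\<Lambda>\<in>cdual. cmod (cc f \<Lambda>) \<le> K * norm \<Lambda>"
    by (intro exI[of _ "K * B"]) (simp add: mult_ac)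
  then show ?thesis
    unfolding dual_functional_def
    by (intro conjI ballI allI calculus_add_right[OF assms] calculus_scale_right[OF assms])
qed

text \<open>g stands for \<open>Re\<close> and \<open>Im\<close>: the Riesz theorem for real
  functionals is applied once to each.\<close>

lemma representing_measures_exist:
  assumes g: "bounded_linear g" and \<Lambda>: "\<Lambda> \<in> cdual"
  shows "\<exists>p n. finite_measure p \<and> finite_measure n \<and> sets p = sets (spectrum_borel x) \<and> sets n = sets (spectrum_borel x) \<and>
    (\<forall>f. continuous_on UNIV f \<longrightarrow> bounded (range f) \<longrightarrow>
      g (cc (\<lambda>z. of_real (f z)) \<Lambda>) = integral\<^sup>L p f - integral\<^sup>L n f)"
proof -
  interpret g: bounded_linear g by (rule g)
  obtain D where D: "0 < D" "\<And>z. norm (g z) \<le> norm z * D" using g.pos_bounded by blast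
  obtain K where K: "0 \<le> K" "\<forall>f. continuous_on (spectrum x) f \<longrightarrow> (\<forall>\<Lambda>\<in>cdual. \<forall>B\<ge>0.
    (\<forall>z\<in>spectrum x. cmod (f z) \<le> B) \<longrightarrow> cmod (cc f \<Lambda>) \<le> K * norm \<Lambda> * B)"
    using calculus_bounded by blast
  have c: "continuous_on (spectrum x) (\<lambda>z. complex_of_real (f z))" if "continuous_on UNIV f" for f :: "complex \<Rightarrow> real"
    by (intro continuous_on_of_real continuous_on_subset[OF that]) auto
  interpret bounded_functional "spectrum x" "\<lambda>f. g (cc (\<lambda>z. of_real (f z)) \<Lambda>)" "K * norm \<Lambda> * D"
  proof
    show "compact (spectrum x)" by (rule compact_spectrum)
    show "0 \<le> K * norm \<Lambda> * D" using K(1) D(1) by simp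
    fix f :: "complex \<Rightarrow> real" assume f: "continuous_on UNIV f"
    show "g (cc (\<lambda>z. of_real (f z + h z)) \<Lambda>) = g (cc (\<lambda>z. of_real (f z)) \<Lambda>) + g (cc (\<lambda>z. of_real (h z)) \<Lambda>)"
      if "continuous_on UNIV h" for h
      using calculus_add_left[OF c[OF f] c[OF that] \<Lambda>] by (simp add: g.add)
    show "g (cc (\<lambda>z. of_real (r * f z)) \<Lambda>) = r * g (cc (\<lambda>z. of_real (f z)) \<Lambda>)" for r
      using calculus_cmult_left[OF c[OF f] \<Lambda>, of "of_real r"] g.scaleR[of r] by (simp add: scaleR_conv_of_real)
    show "\<bar>g (cc (\<lambda>z. of_real (f z)) \<Lambda>)\<bar> \<le> K * norm \<Lambda> * D * B"
      if "0 \<le> B" "\<And>z. z \<in> spectrum x \<Longrightarrow> \<bar>f z\<bar> \<le> B" for B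
    proof -
      have "cmod (cc (\<lambda>z. of_real (f z)) \<Lambda>) * D \<le> K * norm \<Lambda> * B * D"
        using that D(1) by (intro mult_right_mono K(2)[rule_format, OF c[OF f] \<Lambda>]) auto
      then show ?thesis using D(2)[of "cc (\<lambda>z. of_real (f z)) \<Lambda>"] by (simp add: mult_ac)
    qed
  qed
  obtain p n :: "complex measure" where pn: "sets p = sets borel" "sets n = sets borel" "finite_measure p" "finite_measure n"
     "emeasure p (- spectrum x) = 0" "emeasure n (- spectrum x) = 0"
     "\<And>f B. continuous_on UNIV f \<Longrightarrow> (\<forall>z. \<bar>f z\<bar> \<le> B) \<Longrightarrow>
        g (cc (\<lambda>z. of_real (f z)) \<Lambda>) = integral\<^sup>L p f - integral\<^sup>L n f"
    using riesz_representation by blast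
  \<comment> \<open>The Riesz measures live on the plane and give no mass to the complement of the
    spectrum, so restriction to the spectrum preserves the integrals.\<close>
  have restrict: "finite_measure (restrict_space q (spectrum x)) \<and>
      sets (restrict_space q (spectrum x)) = sets (spectrum_borel x) \<and>
      (\<forall>f :: complex \<Rightarrow> real. continuous_on UNIV f \<longrightarrow> integral\<^sup>L (restrict_space q (spectrum x)) f = integral\<^sup>L q f)"
    if q: "sets q = sets borel" "finite_measure q" "emeasure q (- spectrum x) = 0" for q
  proof (intro conjI allI impI)
    have s: "spectrum x \<in> sets q" using q(1) closed_spectrum[of x] by simp
    have sp: "space q = UNIV" using sets_eq_imp_space_eq[OF q(1)] by simp
    interpret finite_measure q by (rule q(2))
    show "finite_measure (restrict_space q (spectrum x))"
      using s by (rule finite_measure_restrict_space[OF q(2)])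
    show "sets (restrict_space q (spectrum x)) = sets (spectrum_borel x)"
      unfolding spectrum_borel_def by (rule sets_restrict_space_cong[OF q(1)])
    fix f :: "complex \<Rightarrow> real" assume f: "continuous_on UNIV f"
    have fm: "f \<in> borel_measurable q"
      using borel_measurable_continuous_onI[OF f] measurable_cong_sets[OF q(1) refl] by blast
    have "- spectrum x \<in> null_sets q" using q s by (auto simp: null_sets_def closed_spectrum)
    then have ae: "AE z in q. z \<in> spectrum x" using AE_not_in by force
    have "integral\<^sup>L (restrict_space q (spectrum x)) f = integral\<^sup>L q (\<lambda>z. indicator (spectrum x) z *\<^sub>R f z)"
      using s sp by (intro integral_restrict_space) simp
    also have "\<dots> = integral\<^sup>L q f"
      using ae fm s by (intro integral_cong_AE) auto
    finally show "integral\<^sup>L (restrict_space q (spectrum x)) f = integral\<^sup>L q f" .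
  qed
  note r = restrict[OF pn(1,3,5)] restrict[OF pn(2,4,6)]
  have "g (cc (\<lambda>z. of_real (f z)) \<Lambda>) =
      integral\<^sup>L (restrict_space p (spectrum x)) f - integral\<^sup>L (restrict_space n (spectrum x)) f"
    if f: "continuous_on UNIV f" "bounded (range f)" for f
  proof -
    obtain B where "\<forall>z. \<bar>f z\<bar> \<le> B" using f(2) unfolding bounded_iff by auto
    then show ?thesis using pn(7)[OF f(1)] r f(1) by auto
  qed
  then show ?thesis using r by blast
qed

text \<open>The Riesz formula covers bounded real continuous functions on the plane. A complex f is
  extended by Tietze and split as R + \<i> I; linearity of the calculus and of the four integrals
  puts it together again.\<close>

lemma representing_complex_measure:
  assumes \<Lambda>: "\<Lambda> \<in> cdual"
  shows "\<exists>\<nu>\<in>complex_measures (spectrum_borel x).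
    \<forall>f. continuous_on (spectrum x) f \<longrightarrow> cc f \<Lambda> = complex_measure_integral (spectrum_borel x) \<nu> f"
proof -
  let ?M = "spectrum_borel x"
  obtain p n where re: "finite_measure p" "finite_measure n" "sets p = sets ?M" "sets n = sets ?M"
    "\<And>f. continuous_on UNIV f \<Longrightarrow> bounded (range f) \<Longrightarrow> Re (cc (\<lambda>z. of_real (f z)) \<Lambda>) = integral\<^sup>L p f - integral\<^sup>L n f"
    using representing_measures_exist[OF bounded_linear_Re \<Lambda>] by blast
  obtain p' n' where im: "finite_measure p'" "finite_measure n'" "sets p' = sets ?M" "sets n' = sets ?M"
    "\<And>f. continuous_on UNIV f \<Longrightarrow> bounded (range f) \<Longrightarrow> Im (cc (\<lambda>z. of_real (f z)) \<Lambda>) = integral\<^sup>L p' f - integral\<^sup>L n' f"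
    using representing_measures_exist[OF bounded_linear_Im \<Lambda>] by blast
  define \<nu> where "\<nu> = (\<lambda>E\<in>sets ?M. complex_of_real (measure p E - measure n E) + \<i> * of_real (measure p' E - measure n' E))"
  have q: "measure_quadruple ?M p n p' n' \<nu>"
    unfolding measure_quadruple_def \<nu>_def using re(1-4) im(1-4) by auto
  have \<nu>: "\<nu> \<in> complex_measures ?M"
    by (rule measure_quadruple_complex_measure[OF q]) (simp add: \<nu>_def)
  have sp: "space ?M = spectrum x" by (simp add: spectrum_borel_def space_restrict_space)
  have "cc f \<Lambda> = complex_measure_integral ?M \<nu> f" if f: "continuous_on (spectrum x) f" for f
  proof -
    obtain B where B: "0 \<le> B" "\<And>z. z \<in> spectrum x \<Longrightarrow> cmod (f z) \<le> B"
      using spectrum_bounded_function[OF f] by blast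
    obtain F where F: "continuous_on UNIV F" "\<And>z. z \<in> spectrum x \<Longrightarrow> F z = f z" "\<And>z. cmod (F z) \<le> B"
      using Tietze[OF f _ B, of UNIV] closed_spectrum[of x] by auto
    define R I where "R z = Re (F z)" and "I z = Im (F z)" for z
    have RI: "continuous_on UNIV R" "continuous_on UNIV I"
      unfolding R_def I_def by (intro continuous_intros F)+
    have Rb: "\<bar>R z\<bar> \<le> B" and Ib: "\<bar>I z\<bar> \<le> B" for z
      using abs_Re_le_cmod[of "F z"] abs_Im_le_cmod[of "F z"] F(3)[of z] unfolding R_def I_def by linarith+
    have bdd: "bounded (range R)" "bounded (range I)"
      unfolding bounded_iff using Rb Ib by auto
    have c: "continuous_on (spectrum x) (\<lambda>z. complex_of_real (R z))" "continuous_on (spectrum x) (\<lambda>z. complex_of_real (I z))"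
      using RI by (auto intro!: continuous_on_of_real intro: continuous_on_subset)
    have "cc f \<Lambda> = cc (\<lambda>z. of_real (R z) + \<i> * of_real (I z)) \<Lambda>"
      by (intro calculus_cong) (simp add: R_def I_def F(2) complex_eq[symmetric])
    also have "\<dots> = cc (\<lambda>z. of_real (R z)) \<Lambda> + \<i> * cc (\<lambda>z. of_real (I z)) \<Lambda>"
      using calculus_add_left[OF c(1) continuous_on_mult_left[OF c(2)] \<Lambda>] calculus_cmult_left[OF c(2) \<Lambda>] by simp
    finally have 1: "cc f \<Lambda> = cc (\<lambda>z. of_real (R z)) \<Lambda> + \<i> * cc (\<lambda>z. of_real (I z)) \<Lambda>" .
    have real: "cc (\<lambda>z. of_real (h z)) \<Lambda> =
        of_real (integral\<^sup>L p h - integral\<^sup>L n h) + \<i> * of_real (integral\<^sup>L p' h - integral\<^sup>L n' h)"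
      if "continuous_on UNIV h" "bounded (range h)" for h
      using re(5)[OF that] im(5)[OF that] by (simp add: complex_eq_iff)
    have int: "integral\<^sup>L q f = of_real (integral\<^sup>L q R) + \<i> * of_real (integral\<^sup>L q I)"
      if q: "finite_measure q" "sets q = sets ?M" for q
    proof -
      have spq: "space q = spectrum x" using sets_eq_imp_space_eq[OF q(2)] sp by simp
      have meas: "h \<in> borel_measurable q" if "continuous_on UNIV h" for h :: "complex \<Rightarrow> real"
      proof -
        have "h \<in> borel_measurable ?M" unfolding spectrum_borel_def
          by (intro borel_measurable_continuous_on_restrict continuous_on_subset[OF that]) simp
        then show ?thesis using measurable_cong_sets[OF q(2) refl] by blast
      qed
      have int: "integrable q R" "integrable q I"
        using RI meas Rb Ib by (auto intro!: finite_measure.integrable_const_bound[OF q(1), of _ B])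
      have "integral\<^sup>L q f = integral\<^sup>L q (\<lambda>z. of_real (R z) + \<i> * of_real (I z))"
        by (rule Bochner_Integration.integral_cong) (auto simp: spq R_def I_def F(2) complex_eq[symmetric])
      also have "\<dots> = of_real (integral\<^sup>L q R) + \<i> * of_real (integral\<^sup>L q I)"
        using int by simp
      finally show ?thesis .
    qed
    have "f \<in> borel_measurable ?M"
      unfolding spectrum_borel_def by (rule borel_measurable_continuous_on_restrict[OF f])
    then have "complex_measure_integral ?M \<nu> f =
        (integral\<^sup>L p f - integral\<^sup>L n f) + \<i> * (integral\<^sup>L p' f - integral\<^sup>L n' f)"
      using B(2) sp by (intro complex_measure_integral_quadruple[OF \<nu> q]) auto
    also have "\<dots> = cc f \<Lambda>"
      unfolding 1 real[OF RI(1) bdd(1)] real[OF RI(2) bdd(2)]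
        int[OF re(1,3)] int[OF re(2,4)] int[OF im(1,3)] int[OF im(2,4)]
      by (simp add: algebra_simps)
    finally show ?thesis by simp
  qed
  with \<nu> show ?thesis by blast
qed

text \<open>Linearity and boundedness in \<Lambda> are conclusions here: the measures may have been
  chosen for each functional separately, yet representing the calculus ties them together.\<close>

lemma dual_functional_family:
  assumes \<mu>: "\<And>\<Lambda>. \<Lambda> \<in> cdual \<Longrightarrow> \<mu> \<Lambda> \<in> complex_measures (spectrum_borel x)"
    and rep: "represents_calculus x \<mu>" and E: "E \<in> sets (spectrum_borel x)"
  shows "dual_functional (\<lambda>\<Lambda>. \<mu> \<Lambda> E)"
proof -
  let ?M = "spectrum_borel x"
  have on_closed: "dual_functional (\<lambda>\<Lambda>. \<mu> \<Lambda> C)" if C: "closed C" "C \<subseteq> spectrum x" for C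
  proof -
    obtain f :: "nat \<Rightarrow> complex \<Rightarrow> complex" where f: "\<And>k. continuous_on (spectrum x) (f k)"
      "\<And>\<nu>. \<nu> \<in> complex_measures ?M \<Longrightarrow> (\<lambda>k. complex_measure_integral ?M \<nu> (f k)) \<longlonglongrightarrow> \<nu> C"
      unfolding spectrum_borel_def using complex_measure_closed_limit[OF C] by blast
    show ?thesis
    proof (rule dual_functional_limit[OF dual_functional_calculus[OF f(1)]])
      fix \<Lambda> :: "'a \<Rightarrow>\<^sub>L complex" assume \<Lambda>: "\<Lambda> \<in> cdual"
      have "complex_measure_integral ?M (\<mu> \<Lambda>) (f k) = cc (f k) \<Lambda>" for k
        using rep f(1) \<Lambda> by (simp add: represents_calculus_def family_integral_def)
      then show "(\<lambda>k. cc (f k) \<Lambda>) \<longlonglongrightarrow> \<mu> \<Lambda> C" using f(2)[OF \<mu>[OF \<Lambda>]] by simp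
    qed
  qed
  show ?thesis
    using closed_spectrum E unfolding spectrum_borel_def
  proof (induction rule: restrict_borel_induct)
    case (closed C)
    then show ?case by (rule on_closed)
  next
    case (compl A)
    note A = compl(1)[folded spectrum_borel_def]
    have KM: "spectrum x \<in> sets ?M" using closed_spectrum by (auto simp: sets_restrict_space spectrum_borel_def)
    have AK: "A \<subseteq> spectrum x" using sets.sets_into_space[OF compl(1)] by (simp add: space_restrict_space)
    show ?case
    proof (rule dual_functional_cong)
      show "dual_functional (\<lambda>\<Lambda>. \<mu> \<Lambda> (spectrum x) + - \<mu> \<Lambda> A)"
        by (intro dual_functional_add dual_functional_uminus compl on_closed closed_spectrum order_refl)
      show "\<mu> \<Lambda> (spectrum x - A) = \<mu> \<Lambda> (spectrum x) + - \<mu> \<Lambda> A" if "\<Lambda> \<in> cdual" for \<Lambda>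
        using signed_measure_Diff[OF complex_measures_signed(1)[OF \<mu>[OF that]] KM A AK]
          signed_measure_Diff[OF complex_measures_signed(2)[OF \<mu>[OF that]] KM A AK]
        by (simp add: complex_eq_iff)
    qed
  next
    case (union A)
    \<comment> \<open>The finite partial sums are bounded functionals;
      \<open>dual_functional_limit\<close> supplies the bound for the infinite union.\<close>
    have "(\<lambda>n. \<Sum>i<n. \<mu> \<Lambda> (A i)) \<longlonglongrightarrow> \<mu> \<Lambda> (\<Union>i. A i)" if "\<Lambda> \<in> cdual" for \<Lambda>
      using \<mu>[OF that] union(1,2) unfolding sums_def[symmetric] complex_measures_def spectrum_borel_def by blast
    then show ?case by (rule dual_functional_limit[OF dual_functional_sum[OF union(3)]])
  qed
qed

lemma represents_calculus_unique:
  assumes \<mu>: "vector_projection_family (spectrum_borel x) \<mu>" "represents_calculus x \<mu>"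
    and \<mu>': "vector_projection_family (spectrum_borel x) \<mu>'" "represents_calculus x \<mu>'"
  shows "\<mu> = \<mu>'"
proof (rule extensionalityI[of _ cdual])
  have fam: "\<mu> \<in> cdual \<rightarrow>\<^sub>E complex_measures (spectrum_borel x)" "\<mu>' \<in> cdual \<rightarrow>\<^sub>E complex_measures (spectrum_borel x)"
    using \<mu> \<mu>' by (auto simp: vector_projection_family_def)
  then show "\<mu> \<in> extensional cdual" "\<mu>' \<in> extensional cdual" by (auto simp: PiE_def)
  show "\<mu> \<Lambda> = \<mu>' \<Lambda>" if "\<Lambda> \<in> cdual" for \<Lambda>
  proof (rule complex_measures_eqI[OF closed_spectrum, folded spectrum_borel_def])
    show "\<mu> \<Lambda> \<in> complex_measures (spectrum_borel x)" "\<mu>' \<Lambda> \<in> complex_measures (spectrum_borel x)"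
      using fam that by auto
    show "complex_measure_integral (spectrum_borel x) (\<mu> \<Lambda>) f = complex_measure_integral (spectrum_borel x) (\<mu>' \<Lambda>) f"
      if "continuous_on (spectrum x) f" for f
      using \<mu>(2) \<mu>'(2) that \<open>\<Lambda> \<in> cdual\<close> by (simp add: represents_calculus_def family_integral_def)
  qed
qed

text \<open>A measure is picked for each \<Lambda> independently and the choice is restricted to
  \<open>cdual\<close>, as an extensional family requires; how it depends on \<Lambda> is then
  settled by \<open>dual_functional_family\<close>.\<close>

lemma represents_calculus_exists:
  "\<exists>\<mu>. vector_projection_family (spectrum_borel x) \<mu> \<and> represents_calculus x \<mu>"
proof -
  obtain \<nu> where \<nu>: "\<And>\<Lambda>. \<Lambda> \<in> cdual \<Longrightarrow> \<nu> \<Lambda> \<in> complex_measures (spectrum_borel x)"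
    "\<And>\<Lambda> f. \<Lambda> \<in> cdual \<Longrightarrow> continuous_on (spectrum x) f \<Longrightarrow>
       cc f \<Lambda> = complex_measure_integral (spectrum_borel x) (\<nu> \<Lambda>) f"
    using representing_complex_measure by metis
  define \<mu> where "\<mu> = restrict \<nu> cdual"
  have rep: "represents_calculus x \<mu>"
    by (simp add: represents_calculus_def family_integral_def \<mu>_def \<nu>)
  have "dual_functional (\<lambda>\<Lambda>. \<mu> \<Lambda> E)" if "E \<in> sets (spectrum_borel x)" for E
    using \<nu>(1) by (intro dual_functional_family[OF _ rep that]) (simp add: \<mu>_def)
  moreover have "\<mu> \<in> cdual \<rightarrow>\<^sub>E complex_measures (spectrum_borel x)"
    using \<nu>(1) by (auto simp: \<mu>_def)
  ultimately have "vector_projection_family (spectrum_borel x) \<mu>"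
    by (auto simp: vector_projection_family_def dual_functional_def intro!: continuous_on_dual_functional)
  then show ?thesis using rep by blast
qed

end

theorem theoremV3:
  fixes x :: "'a::complex_banach_algebra"
  assumes "regular_element x"
    and "continuous_calculus_well_defined x"
  shows "(\<exists>!\<mu>. vector_projection_family (spectrum_borel x) \<mu> \<and> represents_calculus x \<mu>) \<and>
    (\<forall>\<mu>. vector_projection_family (spectrum_borel x) \<mu> \<and> represents_calculus x \<mu> \<longrightarrow>
       (\<forall>\<Lambda>\<in>cdual. blinfun_apply \<Lambda> x = family_integral (spectrum_borel x) \<mu> (\<lambda>z. z) \<Lambda>))"
proof (intro conjI allI impI ballI)
  interpret calculus x by (unfold_locales) (fact assms)+
  show "\<exists>!\<mu>. vector_projection_family (spectrum_borel x) \<mu> \<and> represents_calculus x \<mu>"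
    using represents_calculus_exists represents_calculus_unique by blast
  fix \<mu> and \<Lambda> :: "'a \<Rightarrow>\<^sub>L complex"
  assume \<mu>: "vector_projection_family (spectrum_borel x) \<mu> \<and> represents_calculus x \<mu>" and \<Lambda>: "\<Lambda> \<in> cdual"
  have "family_integral (spectrum_borel x) \<mu> (\<lambda>z. z) \<Lambda> = cc (\<lambda>z. z) \<Lambda>"
    using \<mu> \<Lambda> continuous_on_id unfolding represents_calculus_def by metis
  then show "blinfun_apply \<Lambda> x = family_integral (spectrum_borel x) \<mu> (\<lambda>z. z) \<Lambda>"
    by (simp add: calculus_ident[OF \<Lambda>])
qed

end
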